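(* Assume that $\Lambda$ is bounded and let $\varepsilon>0$, $\delta\in(0,1)$ be given. For any starting point $(x^0,\lambda^0)\in\mathcal X\times\Lambda$, denote by $C^{\mathrm P}_{\mathsf{hp}}$ and $C^{\mathrm D}_{\mathsf{hp}}$ the primal and dual oracle complexities of the modified randomized IPDS algorithm (with the parameters and sub-problem solvers described in the context) to achieve an $\varepsilon$-duality gap with probability at least $1-\delta$, i.e. to produce $(x^{\rm out},\lambda^{\rm out})$ with $\Pr\{\Delta(x^{\rm out},\lambda^{\rm out})\le\varepsilon\}\ge1-\delta$. Then $$C^{\mathrm P}_{\mathsf{hp}}=O\left((n+\sqrt{n\kappa_{\mathcal X}})\sqrt{L_{\mathrm D}/\varepsilon}\,\log\big(\kappa_{\mathcal X}L_{\mathrm D}(n+\sqrt{n\kappa_{\mathcal X}})/(\varepsilon\delta)\big)\right),$$ $$C^{\mathrm D}_{\mathsf{hp}}=O\Big(\big(n\sqrt{L_{\mathrm D}/\varepsilon}+\sqrt{nL_{\lambda\lambda}L_{\mathrm D}}/\varepsilon\big)\log\Big(L_{\lambda\lambda}L_{\mathrm D}\big(n+\sqrt{nL_{\lambda\lambda}/L_{\mathrm D}}\big)/(\varepsilon\delta)\Big)\Big).$$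
   Context: Setting. $\mathbb E_1,\mathbb E_2$ are finite-dimensional real normed spaces (norms $\|\cdot\|$, dual norms $\|\cdot\|_*$, pairing $\langle\cdot,\cdot\rangle$). $\mathcal X\subseteq\mathbb E_1$, $\Lambda\subseteq\mathbb E_2$ are nonempty, closed, convex, $\mathcal X$ bounded. $f,g:\mathbb E_1\to\mathbb R\cup\{+\infty\}$, $h:\mathbb E_2\to\mathbb R\cup\{+\infty\}$ are convex, closed, proper, $\mathcal X\subseteq\mathrm{dom}\,g$, $\Lambda\subseteq\mathrm{dom}\,h$. $f$ is differentiable on an open set containing $\mathcal X$, and $\frac\mu2\|x-x'\|^2\le f(x)-f(x')-\langle\nabla f(x'),x-x'\rangle\le\frac L2\|x-x'\|^2$ for $x,x'\in\mathcal X$, with $L\ge\mu>0$. $\Phi=\frac1n\sum_{i=1}^n\Phi_i$ is real-valued on $\mathbb E_1\times\mathbb E_2$, each $\Phi_i$ is convex-concave and differentiable in each argument with Lipschitz partial gradients on $\mathcal X\times\Lambda$, and for all $x,x'\in\mathcal X$, $\lambda,\lambda'\in\Lambda$: $\|\nabla_x\Phi(x,\lambda)-\nabla_x\Phi(x',\lambda)\|_*\le L_{xx}\|x-x'\|$, $\|\nabla_x\Phi(x,\lambda)-\nabla_x\Phi(x,\lambda')\|_*\le L_{\lambda x}\|\lambda-\lambda'\|$, $\|\nabla_\lambda\Phi(x,\lambda)-\nabla_\lambda\Phi(x',\lambda)\|_*\le L_{\lambda x}\|x-x'\|$, $\|\nabla_\lambda\Phi(x,\lambda)-\nabla_\lambda\Phi(x,\lambda')\|_*\le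 L_{\lambda\lambda}\|\lambda-\lambda'\|$. The problem is $\min_{x\in\mathcal X}\max_{\lambda\in\Lambda}S(x,\lambda)$, $S(x,\lambda):=f(x)+g(x)+\Phi(x,\lambda)-h(\lambda)$; a saddle point exists. $\omega$ is a distance generating function (DGF) w.r.t. $(h,\Lambda)$: convex, closed, proper, $1$-strongly convex and continuous on $\Lambda$, essentially smooth, and such that for all $\alpha>0$, $\upsilon\in\mathbb E_2^*$ the problem $\min_{\lambda\in\Lambda}h(\lambda)+\langle\upsilon,\lambda\rangle+\alpha^{-1}\omega(\lambda)$ has a unique easily computable solution in $\Lambda^o:=\Lambda\cap\mathrm{int}\,\mathrm{dom}\,\omega$. Likewise $\overline\omega$ is a DGF w.r.t. $(g,\mathcal X)$ and $\mathcal X^o:=\mathcal X\cap\mathrm{int}\,\mathrm{dom}\,\overline\omega$. $L_{\mathrm D}:=L_{\lambda\lambda}+L_{\lambda x}^2/\mu$, $\kappa_{\mathcal X}:=(L+L_{xx})/\mu$, $B_{\omega,\Lambda}:=\sup_{\lambda\in\Lambda}|\omega(\lambda)|$. Definitions. $\psi^{\mathrm P}(x):=\sup_{\lambda\in\Lambda}S(x,\lambda)$, $\psi^{\mathrm D}(\lambda):=\inf_{x\in\mathcal X}S(x,\lambda)$, $\Delta(x,\lambda):=\psi^{\mathrm P}(x)-\psi^{\mathrm D}(\lambda)$. For $\rho>0$: $S_\rho(x,\lambda):=S(x,\lambda)-\rho\,\omega(\lambda)$, $\psi^{\mathrm P}_\rho(x):=\sup_{\lambda\in\Lambda}S_\rho(x,\lambda)$.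 Oracles. On input $(x,\lambda,i)$, $i\in\{1,\dots,n\}$, the primal oracle returns $\nabla_x\Phi_i(x,\lambda)$ and the dual oracle returns $\nabla_\lambda\Phi_i(x,\lambda)$; on input $(x,0)$ the primal oracle returns $\nabla f(x)$. Primal (dual) oracle complexity is the number of calls to the primal (dual) oracle. Modified randomized IPDS algorithm. Parameters: $\rho_0=8L_{\mathrm D}>0$, $\tau_k=\frac{k+1}{k+3}$, $\gamma_k=\eta_k=\frac{\varepsilon}{4(k+3)}$, total number of iterations $K=\big\lceil2\sqrt{16L_{\mathrm D}B_{\omega,\Lambda}+\Delta(x^0,\lambda^0)}/\sqrt\varepsilon\big\rceil+1$. For $k=0,\dots,K-1$: (1) produce $\widetilde\lambda_{\rho_k,\eta_k}(x^k)\in\Lambda$ with $\mathbb E[\psi^{\mathrm P}_{\rho_k}(x^k)-S_{\rho_k}(x^k,\widetilde\lambda_{\rho_k,\eta_k}(x^k))\mid\mathcal F_{k,0}]\le\eta_k\delta/(3K)$ a.s.; (2) $\hat\lambda^k=\tau_k\lambda^k+(1-\tau_k)\widetilde\lambda_{\rho_k,\eta_k}(x^k)$; (3) produce $\widetilde x_{\gamma_k}(\hat\lambda^k)\in\mathcal X$ with $\mathbb E[S(\widetilde x_{\gamma_k}(\hat\lambda^k),\hat\lambda^k)-\psi^{\mathrm D}(\hat\lambda^k)\mid\mathcal F_{k,1}]\le\gamma_k\delta/(3K)$ a.s.; (4) $x^{k+1}=\tau_kx^k+(1-\tau_k)\widetilde x_{\gamma_k}(\hat\lambda^k)$; (5)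 $\rho_{k+1}=\tau_k\rho_k$; (6) produce $\widetilde\lambda_{\rho_{k+1},\eta_k}(x^{k+1})\in\Lambda$ with $\mathbb E[\psi^{\mathrm P}_{\rho_{k+1}}(x^{k+1})-S_{\rho_{k+1}}(x^{k+1},\widetilde\lambda_{\rho_{k+1},\eta_k}(x^{k+1}))\mid\mathcal F_{k,2}]\le\eta_k\delta/(3K)$ a.s.; (7) $\lambda^{k+1}=\tau_k\lambda^k+(1-\tau_k)\widetilde\lambda_{\rho_{k+1},\eta_k}(x^{k+1})$. Here $\mathcal F_{0,0}$ is trivial, and $\mathcal F_{k,1}$, $\mathcal F_{k,2}$, $\mathcal F_{k+1,0}$ are obtained by successively adjoining $\widetilde\lambda_{\rho_k,\eta_k}(x^k)$, $\widetilde x_{\gamma_k}(\hat\lambda^k)$, $\widetilde\lambda_{\rho_{k+1},\eta_k}(x^{k+1})$ to $\mathcal F_{k,0}$. The output is $(x^K,\lambda^K)$. Sub-problem solver. Steps (1), (3), (6) use the randomized primal-dual gradient method (RPD). For $\min_{u\in\mathcal U}\Psi(u)=\phi_1(u)+\phi_2(u)$, $\mathcal U$ convex compact, $\phi_1=\frac1m\sum_{i=1}^m\varphi_i$ convex and $L'$-smooth with each $\varphi_i$ convex and smooth, $\Psi$ $\mu'$-strongly convex, $\phi_2$ convex with DGF $\pi$, $\kappa'=L'/\mu'$, minimizer $u^*$, its known guarantee is that, from $u^0\in\mathcal U\cap\mathrm{int}\,\mathrm{dom}\,\pi$, the expected error $\mathbb E[\Psi(\tilde u^N)-\Psi(u^*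 )]\le e$ holds after $N=2(m+\sqrt{8m\kappa'})\log\big(2(L'/\sqrt{\mu'}+\sqrt{\mu'})^2(m+\sqrt{8m\kappa'})D_{\mathcal U,\pi}(u^0)/e\big)$ (rounded up) iterations, with $O(N)$ component-gradient oracle calls, where $D_{\mathcal U,\pi}(u^0)=\max_{u\in\mathcal U}[\pi(u)-\pi(u^0)-\langle\nabla\pi(u^0),u-u^0\rangle]<\infty$. In steps (1), (6): $m=n$, $L'=L_{\lambda\lambda}$, $\mu'=\rho$ (dual oracle calls); in step (3): $m=n$, $L'=L+L_{xx}$, $\mu'=\mu$ (primal oracle calls). Each run uses a fixed starting point in $\Lambda^o$ (resp. $\mathcal X^o$) and this pre-determined number of iterations. $O(\cdot)$ convention: $\varepsilon\to0$, i.e. bounds hold for all sufficiently small $\varepsilon>0$ (threshold depending on the other data except $\delta$); implied constants may depend on $B_{\omega,\Lambda}$ and on $\Delta(x^0,\lambda^0)$ relative to $L_{\mathrm D}$, but not on $\varepsilon,\delta,n,\kappa_{\mathcal X}$. For the dual bound, $L_{\lambda\lambda}>0$ is understood. *)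

theory Defs
  imports "HOL-Probability.Probability"
begin

section \<open>Finite-dimensional normed spaces and gradients\<close>

text \<open>The norm is arbitrary, in particular it need not come from an inner product.\<close>

class finite_dim_normed = real_normed_vector +
  assumes finite_dim: "\<exists>B. finite B \<and> (\<forall>x. \<exists>c. x = (\<Sum>b\<in>B. c b *\<^sub>R b))"

instance euclidean_space \<subseteq> finite_dim_normed
proof
  show "\<exists>B. finite B \<and> (\<forall>x::'a. \<exists>c. x = (\<Sum>b\<in>B. c b *\<^sub>R b))"
    by (rule exI[of _ Basis]) (metis finite_Basis euclidean_representation)
qed

text \<open>The dual space is the type of bounded linear functionals; its norm is the dual norm, and
  the pairing is application.\<close>

definition grad :: "('u::real_normed_vector \<Rightarrow> real) \<Rightarrow> 'u \<Rightarrow> 'u \<Rightarrow>\<^sub>L real" where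
  "grad F x = Blinfun (frechet_derivative F (at x))"

lemma grad_eqI:
  assumes "(F has_derivative blinfun_apply G) (at x)"
  shows "grad F x = G"
  using frechet_derivative_at[OF assms] by (metis grad_def blinfun_apply_inverse)

lemma has_derivative_grad:
  assumes "F differentiable (at x)"
  shows "(F has_derivative blinfun_apply (grad F x)) (at x)"
proof -
  have *: "(F has_derivative frechet_derivative F (at x)) (at x)"
    using assms by (simp add: frechet_derivative_works)
  then show ?thesis
    using has_derivative_bounded_linear[OF *] by (simp add: grad_def bounded_linear_Blinfun_apply)
qed

section \<open>Extended-valued convex functions\<close>

abbreviation finval :: "('u \<Rightarrow> ereal) \<Rightarrow> 'u \<Rightarrow> real" where
  "finval F \<equiv> (\<lambda>x. real_of_ereal (F x))"

definition edom :: "('u \<Rightarrow> ereal) \<Rightarrow> 'u set" where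
  "edom F = {x. F x < \<infinity>}"

definition eepi :: "('u \<Rightarrow> ereal) \<Rightarrow> ('u \<times> real) set" where
  "eepi F = {(x, r). F x \<le> ereal r}"

definition closed_convex_proper :: "('u::real_normed_vector \<Rightarrow> ereal) \<Rightarrow> bool" where
  "closed_convex_proper F \<longleftrightarrow>
     convex (eepi F) \<and> closed (eepi F) \<and> (\<forall>x. F x \<noteq> -\<infinity>) \<and> edom F \<noteq> {}"

definition strongly_convex_on :: "real \<Rightarrow> 'u::real_normed_vector set \<Rightarrow> ('u \<Rightarrow> real) \<Rightarrow> bool" where
  "strongly_convex_on m U F \<longleftrightarrow>
     (\<forall>x\<in>U. \<forall>y\<in>U. \<forall>t\<in>{0..1}.
        F (t *\<^sub>R x + (1 - t) *\<^sub>R y)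
          \<le> t * F x + (1 - t) * F y - m / 2 * t * (1 - t) * (norm (x - y))\<^sup>2)"

definition essentially_smooth :: "('u::real_normed_vector \<Rightarrow> ereal) \<Rightarrow> bool" where
  "essentially_smooth F \<longleftrightarrow>
     interior (edom F) \<noteq> {} \<and>
     (\<forall>x\<in>interior (edom F). finval F differentiable (at x)) \<and>
     (\<forall>s y. range s \<subseteq> interior (edom F) \<and> s \<longlonglongrightarrow> y \<and> y \<in> frontier (interior (edom F)) \<longrightarrow>
        filterlim (\<lambda>j. norm (grad (finval F) (s j))) at_top sequentially)"

definition core :: "'u::real_normed_vector set \<Rightarrow> ('u \<Rightarrow> ereal) \<Rightarrow> 'u set" where
  "core U w = U \<inter> interior (edom w)"

text \<open>Distance generating functions with respect to \<open>(h, U)\<close>.  Continuity on \<open>U\<close> is understood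
  as continuity of a finite-valued function, so \<open>U\<close> lies in the domain.\<close>

definition dgf :: "('u::real_normed_vector \<Rightarrow> ereal) \<Rightarrow> 'u set \<Rightarrow> ('u \<Rightarrow> ereal) \<Rightarrow> bool" where
  "dgf h U w \<longleftrightarrow>
     closed_convex_proper w \<and> U \<subseteq> edom w \<and>
     strongly_convex_on 1 U (finval w) \<and> continuous_on U (finval w) \<and>
     essentially_smooth w \<and>
     (\<forall>\<alpha>>0. \<forall>v :: 'u \<Rightarrow>\<^sub>L real. \<exists>s\<in>core U w.
        {u. is_arg_min (\<lambda>u. h u + ereal (blinfun_apply v u) + ereal (inverse \<alpha>) * w u)
              (\<lambda>u. u \<in> U) u} = {s})"

definition bregman_diam :: "'u::real_normed_vector set \<Rightarrow> ('u \<Rightarrow> ereal) \<Rightarrow> 'u \<Rightarrow> real" where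
  "bregman_diam U w u0 =
     (SUP u\<in>U. finval w u - finval w u0 - blinfun_apply (grad (finval w) u0) (u - u0))"

section \<open>The saddle-point problem\<close>

text \<open>The last two fields are the fixed starting points of the runs of the sub-problem solver.\<close>

record ('a, 'b) spp =
  setX :: "'a set"
  setL :: "'b set"
  fun_f :: "'a \<Rightarrow> ereal"
  fun_g :: "'a \<Rightarrow> ereal"
  fun_h :: "'b \<Rightarrow> ereal"
  ncomp :: nat
  comp_Phi :: "nat \<Rightarrow> 'a \<Rightarrow> 'b \<Rightarrow> real"
  dgfL :: "'b \<Rightarrow> ereal"
  dgfX :: "'a \<Rightarrow> ereal"
  const_L :: real
  const_mu :: real
  const_Lxx :: real
  const_Llx :: real
  const_Lll :: real
  startX :: 'a
  startL :: 'b

definition Phi :: "('a, 'b) spp \<Rightarrow> 'a \<Rightarrow> 'b \<Rightarrow> real" where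
  "Phi P x l = (\<Sum>i=1..ncomp P. comp_Phi P i x l) / real (ncomp P)"

definition gradx :: "('a::real_normed_vector \<Rightarrow> 'b \<Rightarrow> real) \<Rightarrow> 'a \<Rightarrow> 'b \<Rightarrow> 'a \<Rightarrow>\<^sub>L real" where
  "gradx F x l = grad (\<lambda>x. F x l) x"

definition gradl :: "('a \<Rightarrow> 'b::real_normed_vector \<Rightarrow> real) \<Rightarrow> 'a \<Rightarrow> 'b \<Rightarrow> 'b \<Rightarrow>\<^sub>L real" where
  "gradl F x l = grad (F x) l"

definition Sfun :: "('a, 'b) spp \<Rightarrow> 'a \<Rightarrow> 'b \<Rightarrow> ereal" where
  "Sfun P x l = fun_f P x + fun_g P x + ereal (Phi P x l) - fun_h P l"

definition Srho :: "('a, 'b) spp \<Rightarrow> real \<Rightarrow> 'a \<Rightarrow> 'b \<Rightarrow> ereal" where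
  "Srho P \<rho> x l = Sfun P x l - ereal \<rho> * dgfL P l"

definition psiP :: "('a, 'b) spp \<Rightarrow> 'a \<Rightarrow> ereal" where
  "psiP P x = (SUP l\<in>setL P. Sfun P x l)"

definition psiD :: "('a, 'b) spp \<Rightarrow> 'b \<Rightarrow> ereal" where
  "psiD P l = (INF x\<in>setX P. Sfun P x l)"

definition psiPrho :: "('a, 'b) spp \<Rightarrow> real \<Rightarrow> 'a \<Rightarrow> ereal" where
  "psiPrho P \<rho> x = (SUP l\<in>setL P. Srho P \<rho> x l)"

definition gap :: "('a, 'b) spp \<Rightarrow> 'a \<Rightarrow> 'b \<Rightarrow> ereal" where
  "gap P x l = psiP P x - psiD P l"

definition LD :: "('a, 'b) spp \<Rightarrow> real" where
  "LD P = const_Lll P + (const_Llx P)\<^sup>2 / const_mu P"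

definition kappaX :: "('a, 'b) spp \<Rightarrow> real" where
  "kappaX P = (const_L P + const_Lxx P) / const_mu P"

definition Bomega :: "('a, 'b) spp \<Rightarrow> real" where
  "Bomega P = real_of_ereal (SUP l\<in>setL P. \<bar>dgfL P l\<bar>)"

definition valid_f :: "('a::real_normed_vector, 'b) spp \<Rightarrow> bool" where
  "valid_f P \<longleftrightarrow>
     closed_convex_proper (fun_f P) \<and>
     (\<exists>U. open U \<and> setX P \<subseteq> U \<and> U \<subseteq> edom (fun_f P) \<and>
        (\<forall>x\<in>U. finval (fun_f P) differentiable (at x))) \<and>
     0 < const_mu P \<and> const_mu P \<le> const_L P \<and>
     (\<forall>x\<in>setX P. \<forall>x'\<in>setX P.
        (let d = finval (fun_f P) x - finval (fun_f P) x'
                 - blinfun_apply (grad (finval (fun_f P)) x') (x - x')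
         in const_mu P / 2 * (norm (x - x'))\<^sup>2 \<le> d \<and> d \<le> const_L P / 2 * (norm (x - x'))\<^sup>2))"

text \<open>Only convexity-concavity on \<open>X \<times> Y\<close> is demanded, although the functions are defined
  everywhere; derivatives are taken in the ambient spaces.\<close>

definition valid_comp ::
  "'a::real_normed_vector set \<Rightarrow> 'b::real_normed_vector set \<Rightarrow> ('a \<Rightarrow> 'b \<Rightarrow> real) \<Rightarrow> bool" where
  "valid_comp X Y F \<longleftrightarrow>
     (\<forall>l\<in>Y. convex_on X (\<lambda>x. F x l)) \<and> (\<forall>x\<in>X. concave_on Y (F x)) \<and>
     (\<forall>x\<in>X. \<forall>l\<in>Y. (\<lambda>x. F x l) differentiable (at x) \<and> F x differentiable (at l)) \<and>
     (\<exists>c. \<forall>x\<in>X. \<forall>x'\<in>X. \<forall>l\<in>Y. \<forall>l'\<in>Y.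
        norm (gradx F x l - gradx F x' l') \<le> c * (norm (x - x') + norm (l - l')) \<and>
        norm (gradl F x l - gradl F x' l') \<le> c * (norm (x - x') + norm (l - l')))"

definition valid_Phi :: "('a::real_normed_vector, 'b::real_normed_vector) spp \<Rightarrow> bool" where
  "valid_Phi P \<longleftrightarrow>
     1 \<le> ncomp P \<and>
     (\<forall>i\<in>{1..ncomp P}. valid_comp (setX P) (setL P) (comp_Phi P i)) \<and>
     0 \<le> const_Lxx P \<and> 0 \<le> const_Llx P \<and> 0 \<le> const_Lll P \<and>
     (\<forall>x\<in>setX P. \<forall>x'\<in>setX P. \<forall>l\<in>setL P. \<forall>l'\<in>setL P.
        norm (gradx (Phi P) x l - gradx (Phi P) x' l) \<le> const_Lxx P * norm (x - x') \<and>
        norm (gradx (Phi P) x l - gradx (Phi P) x l') \<le> const_Llx P * norm (l - l') \<and>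
        norm (gradl (Phi P) x l - gradl (Phi P) x' l) \<le> const_Llx P * norm (x - x') \<and>
        norm (gradl (Phi P) x l - gradl (Phi P) x l') \<le> const_Lll P * norm (l - l'))"

definition has_saddle_point :: "('a, 'b) spp \<Rightarrow> bool" where
  "has_saddle_point P \<longleftrightarrow>
     (\<exists>xs\<in>setX P. \<exists>ls\<in>setL P. \<forall>x\<in>setX P. \<forall>l\<in>setL P.
        Sfun P xs l \<le> Sfun P xs ls \<and> Sfun P xs ls \<le> Sfun P x ls)"

text \<open>The last conjunct of \<open>valid_spp\<close> is the requirement \<open>\<rho>\<^sub>0 = 8 L\<^sub>D > 0\<close> on the
  algorithm parameters.\<close>

definition valid_spp :: "('a::real_normed_vector, 'b::real_normed_vector) spp \<Rightarrow> bool" where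
  "valid_spp P \<longleftrightarrow>
     setX P \<noteq> {} \<and> closed (setX P) \<and> convex (setX P) \<and> bounded (setX P) \<and>
     setL P \<noteq> {} \<and> closed (setL P) \<and> convex (setL P) \<and>
     valid_f P \<and>
     closed_convex_proper (fun_g P) \<and> setX P \<subseteq> edom (fun_g P) \<and>
     closed_convex_proper (fun_h P) \<and> setL P \<subseteq> edom (fun_h P) \<and>
     valid_Phi P \<and>
     has_saddle_point P \<and>
     dgf (fun_h P) (setL P) (dgfL P) \<and> dgf (fun_g P) (setX P) (dgfX P) \<and>
     startX P \<in> core (setX P) (dgfX P) \<and> startL P \<in> core (setL P) (dgfL P) \<and>
     0 < LD P"

section \<open>Oracles\<close>

datatype ('a, 'b) primal_query = Query_Phi 'a 'b nat | Query_f 'a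

datatype ('a, 'b) dual_query = Query_Phi_dual 'a 'b nat

fun primal_oracle ::
  "('a::real_normed_vector, 'b) spp \<Rightarrow> ('a, 'b) primal_query \<Rightarrow> 'a \<Rightarrow>\<^sub>L real" where
  "primal_oracle P (Query_Phi x l i) = gradx (comp_Phi P i) x l"
| "primal_oracle P (Query_f x) = grad (finval (fun_f P)) x"

fun dual_oracle ::
  "('a, 'b::real_normed_vector) spp \<Rightarrow> ('a, 'b) dual_query \<Rightarrow> 'b \<Rightarrow>\<^sub>L real" where
  "dual_oracle P (Query_Phi_dual x l i) = gradl (comp_Phi P i) x l"

text \<open>The sub-problem solver requests component gradients; a request \<open>(u, i)\<close> asks for the
  gradient of the \<open>i\<close>-th component at \<open>u\<close>.  For the sub-problem in \<open>x\<close> at a dual point \<open>l\<close> the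
  components are \<open>f + \<Phi>\<^sub>i(\<cdot>, l)\<close>, so that a request costs two calls to the primal oracle; for
  the sub-problem in \<open>\<lambda>\<close> at a primal point \<open>x\<close> they are \<open>- \<Phi>\<^sub>i(x, \<cdot>)\<close>.\<close>

definition primal_calls_of :: "'b \<Rightarrow> ('a \<times> nat) list \<Rightarrow> ('a, 'b) primal_query list" where
  "primal_calls_of l rs = concat (map (\<lambda>(u, i). [Query_f u, Query_Phi u l i]) rs)"

definition dual_calls_of :: "'a \<Rightarrow> ('b \<times> nat) list \<Rightarrow> ('a, 'b) dual_query list" where
  "dual_calls_of x rs = map (\<lambda>(u, i). Query_Phi_dual x u i) rs"

lemma primal_component_gradient:
  assumes "valid_spp P" "u \<in> setX P" "l \<in> setL P" "i \<in> {1..ncomp P}"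
  shows "grad (\<lambda>x. finval (fun_f P) x + comp_Phi P i x l) u
           = sum_list (map (primal_oracle P) (primal_calls_of l [(u, i)]))"
proof -
  have "finval (fun_f P) differentiable (at u)"
    using assms unfolding valid_spp_def valid_f_def by blast
  moreover have "(\<lambda>x. comp_Phi P i x l) differentiable (at u)"
    using assms unfolding valid_spp_def valid_Phi_def valid_comp_def by blast
  ultimately have "((\<lambda>x. finval (fun_f P) x + comp_Phi P i x l) has_derivative
      blinfun_apply (grad (finval (fun_f P)) u + gradx (comp_Phi P i) u l)) (at u)"
    unfolding gradx_def plus_blinfun.rep_eq by (intro has_derivative_add has_derivative_grad)
  from grad_eqI[OF this] show ?thesis
    by (simp add: primal_calls_of_def)
qed

lemma dual_component_gradient:
  assumes "valid_spp P" "x \<in> setX P" "u \<in> setL P" "i \<in> {1..ncomp P}"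
  shows "grad (\<lambda>l. - comp_Phi P i x l) u
           = - sum_list (map (dual_oracle P) (dual_calls_of x [(u, i)]))"
proof -
  have "comp_Phi P i x differentiable (at u)"
    using assms unfolding valid_spp_def valid_Phi_def valid_comp_def by blast
  then have "((\<lambda>l. - comp_Phi P i x l) has_derivative
      blinfun_apply (- gradl (comp_Phi P i) x u)) (at u)"
    unfolding gradl_def uminus_blinfun.rep_eq by (intro has_derivative_minus has_derivative_grad)
  from grad_eqI[OF this] show ?thesis
    by (simp add: dual_calls_of_def)
qed

section \<open>Runs of the sub-problem solver\<close>

definition rpd_iters :: "nat \<Rightarrow> real \<Rightarrow> real \<Rightarrow> real \<Rightarrow> real \<Rightarrow> nat" where
  "rpd_iters m L \<mu> D e =
     nat \<lceil>2 * (real m + sqrt (8 * real m * (L / \<mu>)))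
          * ln (2 * (L / sqrt \<mu> + sqrt \<mu>)\<^sup>2 * (real m + sqrt (8 * real m * (L / \<mu>))) * D / e)\<rceil>"

text \<open>\<open>rpd_run M F c m L \<mu> D e U err ut rs\<close>: a run with \<open>rpd_iters m L \<mu> D e\<close> iterations on an
  instance that is determined by the information in \<open>F\<close>, with random output \<open>ut\<close> and random list
  \<open>rs\<close> of component-gradient requests; \<open>err\<close> is the (nonnegative) optimality gap of the output,
  \<open>c\<close> is the constant in the linear bound on the number of requests.  Since \<open>nn_cond_exp\<close> is the
  conditional expectation of a nonnegative function, no integrability has to be presupposed.\<close>

definition rpd_run ::
  "'w measure \<Rightarrow> 'w measure \<Rightarrow> real \<Rightarrow> nat \<Rightarrow> real \<Rightarrow> real \<Rightarrow> real \<Rightarrow> real \<Rightarrow>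
   'u::real_normed_vector set \<Rightarrow> ('w \<Rightarrow> ereal) \<Rightarrow> ('w \<Rightarrow> 'u) \<Rightarrow> ('w \<Rightarrow> ('u \<times> nat) list) \<Rightarrow> bool" where
  "rpd_run M F c m L \<mu> D e U err ut rs \<longleftrightarrow>
     ut \<in> borel_measurable M \<and> (\<forall>w\<in>space M. ut w \<in> U) \<and>
     (AE w in M. nn_cond_exp M F (\<lambda>w. e2ennreal (err w)) w \<le> ennreal e) \<and>
     (\<forall>w\<in>space M. snd ` set (rs w) \<subseteq> {1..m} \<and>
        real (length (rs w)) \<le> c * real (rpd_iters m L \<mu> D e))"

section \<open>The modified randomized IPDS algorithm\<close>

definition tau :: "nat \<Rightarrow> real" where
  "tau k = (real k + 1) / (real k + 3)"

primrec rho :: "('a, 'b) spp \<Rightarrow> nat \<Rightarrow> real" where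
  "rho P 0 = 8 * LD P"
| "rho P (Suc k) = tau k * rho P k"

definition accuracy :: "real \<Rightarrow> nat \<Rightarrow> real" where
  "accuracy \<epsilon> k = \<epsilon> / (4 * (real k + 3))"

definition num_iters :: "('a, 'b) spp \<Rightarrow> real \<Rightarrow> 'a \<Rightarrow> 'b \<Rightarrow> nat" where
  "num_iters P \<epsilon> x0 l0 =
     nat \<lceil>2 * sqrt (16 * LD P * Bomega P + real_of_ereal (gap P x0 l0)) / sqrt \<epsilon>\<rceil> + 1"

text \<open>Everything that happens during an execution, as functions on the sample space: the iterates
  \<open>x\<^sup>k\<close>, \<open>\<lambda>\<^sup>k\<close>, and for the three solver runs of iteration \<open>k\<close> (in the order of execution:
  \<open>\<lambda>\<close> at \<open>\<rho>\<^sub>k\<close>, \<open>x\<close>, \<open>\<lambda>\<close> at \<open>\<rho>\<^bsub>k+1\<^esub>\<close>) the outputs and the requests.\<close>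

record ('w, 'a, 'b) exec =
  iterx :: "nat \<Rightarrow> 'w \<Rightarrow> 'a"
  iterl :: "nat \<Rightarrow> 'w \<Rightarrow> 'b"
  outl1 :: "nat \<Rightarrow> 'w \<Rightarrow> 'b"
  outx :: "nat \<Rightarrow> 'w \<Rightarrow> 'a"
  outl2 :: "nat \<Rightarrow> 'w \<Rightarrow> 'b"
  reql1 :: "nat \<Rightarrow> 'w \<Rightarrow> ('b \<times> nat) list"
  reqx :: "nat \<Rightarrow> 'w \<Rightarrow> ('a \<times> nat) list"
  reql2 :: "nat \<Rightarrow> 'w \<Rightarrow> ('b \<times> nat) list"

definition hatl :: "('w, 'a, 'b::real_vector) exec \<Rightarrow> nat \<Rightarrow> 'w \<Rightarrow> 'b" where
  "hatl E k w = tau k *\<^sub>R iterl E k w + (1 - tau k) *\<^sub>R outl1 E k w"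

definition adjoin :: "'w measure \<Rightarrow> ('w \<Rightarrow> 'u::topological_space) \<Rightarrow> 'w measure" where
  "adjoin F Z = sigma (space F) (sets F \<union> {Z -` A \<inter> space F | A. A \<in> sets borel})"

primrec filt0 ::
  "'w measure \<Rightarrow> ('w, 'a::topological_space, 'b::topological_space) exec \<Rightarrow> nat \<Rightarrow> 'w measure" where
  "filt0 M E 0 = sigma (space M) {}"
| "filt0 M E (Suc k) = adjoin (adjoin (adjoin (filt0 M E k) (outl1 E k)) (outx E k)) (outl2 E k)"

definition filt1 ::
  "'w measure \<Rightarrow> ('w, 'a::topological_space, 'b::topological_space) exec \<Rightarrow> nat \<Rightarrow> 'w measure" where
  "filt1 M E k = adjoin (filt0 M E k) (outl1 E k)"

definition filt2 ::
  "'w measure \<Rightarrow> ('w, 'a::topological_space, 'b::topological_space) exec \<Rightarrow> nat \<Rightarrow> 'w measure" where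
  "filt2 M E k = adjoin (filt1 M E k) (outx E k)"

definition ipds_exec ::
  "'w measure \<Rightarrow> real \<Rightarrow> ('a::real_normed_vector, 'b::real_normed_vector) spp \<Rightarrow>
   real \<Rightarrow> real \<Rightarrow> 'a \<Rightarrow> 'b \<Rightarrow> ('w, 'a, 'b) exec \<Rightarrow> bool" where
  "ipds_exec M c P \<epsilon> \<delta> x0 l0 E \<longleftrightarrow>
     prob_space M \<and>
     (\<forall>w\<in>space M. iterx E 0 w = x0 \<and> iterl E 0 w = l0) \<and>
     (\<forall>k < num_iters P \<epsilon> x0 l0.
        let e = accuracy \<epsilon> k * \<delta> / (3 * real (num_iters P \<epsilon> x0 l0));
            DL = bregman_diam (setL P) (dgfL P) (startL P);
            DX = bregman_diam (setX P) (dgfX P) (startX P)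
        in
          rpd_run M (filt0 M E k) c (ncomp P) (const_Lll P) (rho P k) DL e (setL P)
            (\<lambda>w. psiPrho P (rho P k) (iterx E k w) - Srho P (rho P k) (iterx E k w) (outl1 E k w))
            (outl1 E k) (reql1 E k) \<and>
          rpd_run M (filt1 M E k) c (ncomp P) (const_L P + const_Lxx P) (const_mu P) DX e (setX P)
            (\<lambda>w. Sfun P (outx E k w) (hatl E k w) - psiD P (hatl E k w))
            (outx E k) (reqx E k) \<and>
          (\<forall>w\<in>space M. iterx E (Suc k) w = tau k *\<^sub>R iterx E k w + (1 - tau k) *\<^sub>R outx E k w) \<and>
          rpd_run M (filt2 M E k) c (ncomp P) (const_Lll P) (rho P (Suc k)) DL e (setL P)
            (\<lambda>w. psiPrho P (rho P (Suc k)) (iterx E (Suc k) w)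
                 - Srho P (rho P (Suc k)) (iterx E (Suc k) w) (outl2 E k w))
            (outl2 E k) (reql2 E k) \<and>
          (\<forall>w\<in>space M. iterl E (Suc k) w = tau k *\<^sub>R iterl E k w + (1 - tau k) *\<^sub>R outl2 E k w))"

definition primal_complexity :: "('w, 'a, 'b::real_vector) exec \<Rightarrow> nat \<Rightarrow> 'w \<Rightarrow> nat" where
  "primal_complexity E K w = (\<Sum>k<K. length (primal_calls_of (hatl E k w) (reqx E k w)))"

definition dual_complexity :: "('w, 'a, 'b) exec \<Rightarrow> nat \<Rightarrow> 'w \<Rightarrow> nat" where
  "dual_complexity E K w =
     (\<Sum>k<K. length (dual_calls_of (iterx E k w) (reql1 E k w))
           + length (dual_calls_of (iterx E (Suc k) w) (reql2 E k w)))"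

section \<open>The complexity bounds\<close>

definition primal_bound :: "('a, 'b) spp \<Rightarrow> real \<Rightarrow> real \<Rightarrow> real" where
  "primal_bound P \<epsilon> \<delta> =
     (let n = real (ncomp P); \<kappa> = kappaX P in
      (n + sqrt (n * \<kappa>)) * sqrt (LD P / \<epsilon>) * ln (\<kappa> * LD P * (n + sqrt (n * \<kappa>)) / (\<epsilon> * \<delta>)))"

definition dual_bound :: "('a, 'b) spp \<Rightarrow> real \<Rightarrow> real \<Rightarrow> real" where
  "dual_bound P \<epsilon> \<delta> =
     (let n = real (ncomp P); l = const_Lll P in
      (n * sqrt (LD P / \<epsilon>) + sqrt (n * l * LD P) / \<epsilon>)
        * ln (l * LD P * (n + sqrt (n * l / LD P)) / (\<epsilon> * \<delta>)))"

end

theory Submission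
  imports Defs
begin

text \<open>The algorithm keeps an \<^emph>\<open>excessive gap\<close>: with \<open>S\<^sub>\<rho> = S - \<rho> \<omega>\<close> the iterates satisfy
\<open>\<psi>\<^sup>P\<^sub>\<rho>(x\<^sup>k) \<le> \<psi>\<^sup>D(\<lambda>\<^sup>k) + E\<^sub>k\<close> for \<open>\<rho> = \<rho>\<^sub>k\<close>, and since \<open>\<omega>\<close> is bounded by \<open>B\<close> on \<open>\<Lambda>\<close>, the duality gap is
at most \<open>E\<^sub>k + \<rho>\<^sub>k B\<close>.  One iteration multiplies both \<open>\<rho>\<close> and \<open>E\<close> by \<open>\<tau>\<^sub>k\<close>, up to solver errors
added to \<open>E\<close>.  Two opposing second-order terms have to balance for this.  Replacing the first dual output \<open>\<lambda>'\<close> by the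
second one \<open>\<lambda>''\<close> gains \<open>\<tau>\<^sub>k \<rho>\<^sub>k / 4 * \<parallel>\<lambda>'' - \<lambda>'\<parallel>\<^sup>2\<close>, because \<open>S\<^sub>\<rho>(x, \<cdot>)\<close> is \<open>\<rho>\<close>-strongly concave;
following \<open>\<psi>\<^sup>D\<close> from the intermediate dual point to \<open>\<lambda>\<^sup>k\<^sup>+\<^sup>1\<close> loses \<open>L\<^sub>D (1 - \<tau>\<^sub>k)\<^sup>2 * \<parallel>\<lambda>'' - \<lambda>'\<parallel>\<^sup>2\<close>, because strong convexity in
\<open>x\<close> makes the smooth part of \<open>\<psi>\<^sup>D\<close> have curvature of order \<open>L\<^sub>D = L\<^sub>\<lambda>\<^sub>\<lambda> + L\<^sub>\<lambda>\<^sub>x\<^sup>2 / \<mu>\<close>.  The choice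
\<open>\<rho>\<^sub>k = 16 L\<^sub>D / ((k+1)(k+2))\<close> makes the gain dominate (\<open>excessive_gap_step\<close>), and summing the
recursion gives \<open>E\<^sub>k\<close> explicitly (\<open>excessive_gap_trajectory\<close>).  Of the final \<open>\<epsilon>\<close>, half pays for the
initial gap and \<open>\<rho>\<^sub>K B\<close> through the size of \<open>K\<close>, the other half for the solver errors
(\<open>final_gap_numeric\<close>).

Inequalities between values of \<open>S\<close> at arbitrary comparison points \<open>x' \<in> X\<close>, \<open>\<lambda>' \<in> \<Lambda>\<close> stand for those
between suprema and infima.  Strong convexity enters through midpoints, because the midpoint of an
inexact minimizer and any other point yields quadratic growth around the inexact minimizer itself.

Each solver run has conditional expected error at most \<open>\<delta> / (3K)\<close> times the accuracy that the
recursion tolerates.  Markov's inequality bounds the probability of exceeding that accuracy by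
\<open>\<delta> / (3K)\<close>, and the union bound over the \<open>3K\<close> runs gives the probability \<open>1 - \<delta>\<close>
(\<open>measure_bad\<close>, \<open>gap_high_probability\<close>).  Markov's inequality requires the errors to be measurable.
They are because \<open>\<psi>\<^sup>P\<^sub>\<rho>\<close> and \<open>- \<psi>\<^sup>D\<close> have closed sublevel sets on the feasible sets and \<open>\<Phi>\<close> is jointly
continuous there.  The dimension of the spaces enters through compactness of the closed bounded
feasible sets, which makes all the values finite, and through second countability, which makes sums
of random vectors measurable.

For the complexity bounds, \<open>K\<close> is at most a constant times \<open>\<surd>(L\<^sub>D / \<epsilon>)\<close>, and each run costs its
number of iterations.  In the dual runs the condition number \<open>L\<^sub>\<lambda>\<^sub>\<lambda> / \<rho>\<^sub>j\<close> grows up to the order of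
\<open>K\<^sup>2 L\<^sub>\<lambda>\<^sub>\<lambda> / L\<^sub>D\<close>, that is of \<open>L\<^sub>\<lambda>\<^sub>\<lambda> / \<epsilon>\<close>, which produces the term of order \<open>1 / \<epsilon>\<close>.  The arguments of the
logarithms are at most \<open>Q / (\<epsilon>\<^sup>p \<delta>)\<close> with \<open>Q\<close> independent of \<open>\<epsilon>\<close> and \<open>\<delta>\<close>; for small \<open>\<epsilon>\<close> this is below the
\<open>(p+1)\<close>-st power of the argument in the claimed bound, so only a factor \<open>p + 1\<close> is lost
(\<open>logarithm_absorbs_power\<close>).\<close>

section \<open>Finite-dimensional normed spaces\<close>

lemma ex_finite_basis:
  "\<exists>B :: 'u::finite_dim_normed set. finite B \<and> (\<forall>x. \<exists>c. x = (\<Sum>b\<in>B. c b *\<^sub>R b)) \<and>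
    (\<forall>c. (\<Sum>b\<in>B. c b *\<^sub>R b) = 0 \<longrightarrow> (\<forall>b\<in>B. c b = 0))"
proof -
  obtain A :: "'u set" where A: "finite A" "\<And>x. \<exists>c. x = (\<Sum>b\<in>A. c b *\<^sub>R b)"
    using finite_dim by blast
  obtain B where B: "B \<subseteq> A" "independent B" "A \<subseteq> span B"
    by (rule maximal_independent_subset)
  have fin: "finite B" using A(1) B(1) by (rule finite_subset[rotated])
  have "\<exists>c. x = (\<Sum>b\<in>B. c b *\<^sub>R b)" for x
  proof -
    obtain c where x: "x = (\<Sum>b\<in>A. c b *\<^sub>R b)" using A(2) by blast
    have "x \<in> span B" unfolding x by (intro span_sum span_scale) (use B in auto)
    then show ?thesis unfolding span_finite[OF fin] by auto
  qed
  moreover have "\<forall>b\<in>B. c b = 0" if "(\<Sum>b\<in>B. c b *\<^sub>R b) = 0" for c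
    using B(2) fin that independentD[of B B c] by auto
  ultimately show ?thesis using fin by blast
qed

lemma compact_box_functions:
  fixes f :: "'i \<Rightarrow> real set"
  assumes "\<And>i. compact (f i)"
  shows "compact (PiE UNIV f)"
  using assms compactin_PiE[of "\<lambda>_. euclidean" UNIV f]
  by (simp add: euclidean_product_topology)

text \<open>Equivalence of norms: the norm is continuous and, by linear independence, positive on the compact
\<open>\<ell>\<^sub>1\<close> unit sphere of coefficient vectors, so it has a positive minimum \<open>m\<close> there.  The vectors are
functions on the whole type that vanish off \<open>B\<close>, which keeps the sphere inside a compact product.\<close>

lemma coefficients_bounded_by_norm:
  fixes B :: "'u::real_normed_vector set"
  assumes fin: "finite B" and ind: "\<And>c. (\<Sum>b\<in>B. c b *\<^sub>R b) = 0 \<Longrightarrow> \<forall>b\<in>B. c b = 0"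
  obtains m where "m > 0" "\<And>c. m * (\<Sum>b\<in>B. \<bar>c b\<bar>) \<le> norm (\<Sum>b\<in>B. c b *\<^sub>R b)"
proof -
  define box :: "('u \<Rightarrow> real) set" where "box = (PiE UNIV (\<lambda>b. if b \<in> B then {-1..1} else {0}))"
  define T where "T = box \<inter> {c. (\<Sum>b\<in>B. \<bar>c b\<bar>) = 1}"
  define N where "N = (\<lambda>c. norm (\<Sum>b\<in>B. c b *\<^sub>R b))"
  have coord: "continuous_on S (\<lambda>c. c b :: real)" for S and b :: 'u
    by (rule continuous_on_subset[OF continuous_on_product_coordinates]) simp
  have cont: "continuous_on T N"
    unfolding N_def by (intro continuous_intros coord)
  have "closed {c. (\<Sum>b\<in>B. \<bar>c b\<bar>) = (1::real)}"
    by (intro closed_Collect_eq continuous_intros coord)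
  moreover have "compact box" unfolding box_def by (rule compact_box_functions) auto
  ultimately have comp: "compact T" unfolding T_def by (rule compact_Int_closed[rotated])
  obtain m where m: "m > 0" "\<And>c. c \<in> T \<Longrightarrow> m \<le> N c"
  proof (cases "T = {}")
    case True
    then show thesis using that[of 1] by simp
  next
    case False
    obtain c0 where c0: "c0 \<in> T" "\<And>c. c \<in> T \<Longrightarrow> N c0 \<le> N c"
      using continuous_attains_inf[OF comp False cont] by blast
    have "N c0 \<noteq> 0"
    proof
      assume "N c0 = 0"
      then have "\<forall>b\<in>B. c0 b = 0" using ind unfolding N_def by simp
      then show False using c0(1) unfolding T_def by simp
    qed
    then have "N c0 > 0" unfolding N_def by simp
    then show thesis using that c0 by blast
  qed
  show thesis
  proof (rule that[OF m(1)])
    fix c :: "'u \<Rightarrow> real"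
    define s where "s = (\<Sum>b\<in>B. \<bar>c b\<bar>)"
    show "m * (\<Sum>b\<in>B. \<bar>c b\<bar>) \<le> norm (\<Sum>b\<in>B. c b *\<^sub>R b)"
    proof (cases "s = 0")
      case True
      then show ?thesis unfolding s_def by simp
    next
      case False
      then have s: "s > 0" unfolding s_def by (simp add: less_le sum_nonneg)
      define d where "d = (\<lambda>b. if b \<in> B then c b / s else 0)"
      have one: "(\<Sum>b\<in>B. \<bar>d b\<bar>) = 1"
        using s unfolding d_def by (simp add: sum_divide_distrib[symmetric] s_def[symmetric])
      have le: "\<bar>d b\<bar> \<le> 1" if "b \<in> B" for b
        using member_le_sum[OF that _ fin, of "\<lambda>b. \<bar>d b\<bar>"] one by simp
      have "d \<in> box" unfolding box_def using le
        by (auto simp: abs_le_iff minus_le_iff) (auto simp: d_def)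
      then have "m \<le> N d" using m(2) one unfolding T_def by simp
      moreover have "(\<Sum>b\<in>B. c b *\<^sub>R b) = s *\<^sub>R (\<Sum>b\<in>B. d b *\<^sub>R b)"
        unfolding scaleR_sum_right d_def using s by simp
      ultimately show ?thesis using s unfolding N_def s_def[symmetric] by (simp add: mult.commute)
    qed
  qed
qed

text \<open>The coefficients of vectors in a ball are bounded, so the ball is a closed subset of the
continuous image of a compact box of coefficients.\<close>

lemma compact_cball_finite_dim: "compact (cball (0::'u::finite_dim_normed) r)"
proof -
  obtain B :: "'u set" where "finite B \<and> (\<forall>x. \<exists>c. x = (\<Sum>b\<in>B. c b *\<^sub>R b)) \<and>
    (\<forall>c. (\<Sum>b\<in>B. c b *\<^sub>R b) = 0 \<longrightarrow> (\<forall>b\<in>B. c b = 0))"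
    using ex_finite_basis by (rule exE)
  then have B: "finite B" "\<And>x. \<exists>c. x = (\<Sum>b\<in>B. c b *\<^sub>R b)"
    "\<And>c. (\<Sum>b\<in>B. c b *\<^sub>R b) = 0 \<Longrightarrow> \<forall>b\<in>B. c b = 0" by auto
  obtain m where m: "m > 0" "\<And>c. m * (\<Sum>b\<in>B. \<bar>c b\<bar>) \<le> norm (\<Sum>b\<in>B. c b *\<^sub>R b)"
    using coefficients_bounded_by_norm[OF B(1,3)] by blast
  define box :: "('u \<Rightarrow> real) set"
    where "box = (PiE UNIV (\<lambda>b. if b \<in> B then {-(r/m)..r/m} else {0}))"
  have box: "compact box" unfolding box_def by (rule compact_box_functions) auto
  have coord: "continuous_on S (\<lambda>c. c b :: real)" for S and b :: 'u
    by (rule continuous_on_subset[OF continuous_on_product_coordinates]) simp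
  have img: "compact ((\<lambda>c. \<Sum>b\<in>B. c b *\<^sub>R b) ` box)"
    by (intro compact_continuous_image box continuous_intros coord)
  have "cball 0 r \<subseteq> (\<lambda>c. \<Sum>b\<in>B. c b *\<^sub>R b) ` box"
  proof
    fix x :: 'u assume x: "x \<in> cball 0 r"
    obtain c where c: "x = (\<Sum>b\<in>B. c b *\<^sub>R b)" using B(2) by blast
    define d where "d = (\<lambda>b. if b \<in> B then c b else 0)"
    have d: "x = (\<Sum>b\<in>B. d b *\<^sub>R b)" unfolding c d_def by simp
    have "\<bar>d b\<bar> \<le> r / m" if "b \<in> B" for b
    proof -
      have "m * \<bar>d b\<bar> \<le> m * (\<Sum>b\<in>B. \<bar>d b\<bar>)"
        using member_le_sum[OF that _ B(1), of "\<lambda>b. \<bar>d b\<bar>"] m(1) by simp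
      also have "\<dots> \<le> r" using m(2)[of d] x d by simp
      finally show ?thesis using m(1) by (simp add: field_simps)
    qed
    then have "d \<in> box" unfolding box_def by (auto simp: abs_le_iff d_def minus_le_iff)
    then show "x \<in> (\<lambda>c. \<Sum>b\<in>B. c b *\<^sub>R b) ` box" using d by blast
  qed
  then show ?thesis using compact_Int_closed[OF img closed_cball[of 0 r]] by (simp add: inf.absorb2)
qed

instance finite_dim_normed \<subseteq> heine_borel
proof
  fix f :: "nat \<Rightarrow> 'a"
  assume "bounded (range f)"
  then obtain r where "\<And>n. norm (f n) \<le> r" by (auto simp: bounded_iff)
  then have "\<forall>n. f n \<in> cball 0 r" by auto
  moreover have "seq_compact (cball (0::'a) r)"
    using compact_cball_finite_dim compact_eq_seq_compact_metric by blast
  ultimately show "\<exists>l r. strict_mono r \<and> (f \<circ> r) \<longlonglongrightarrow> l"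
    unfolding seq_compact_def by blast
qed

text \<open>Rational combinations of a finite spanning set.\<close>

lemma countable_dense_finite_dim:
  "\<exists>D::'u::finite_dim_normed set. countable D \<and> (\<forall>x. \<forall>e>0. \<exists>y\<in>D. dist x y < e)"
proof -
  obtain B :: "'u set" where B: "finite B" "\<And>x. \<exists>c. x = (\<Sum>b\<in>B. c b *\<^sub>R b)"
    using finite_dim by blast
  define D where "D = (\<lambda>c. \<Sum>b\<in>B. c b *\<^sub>R b) ` (PiE B (\<lambda>_. \<rat>::real set))"
  have "countable D"
    unfolding D_def by (intro countable_image countable_PiE B countable_rat)
  moreover have "\<exists>y\<in>D. dist x y < e" if "e > 0" for x :: 'u and e
  proof -
    obtain c where c: "x = (\<Sum>b\<in>B. c b *\<^sub>R b)" using B(2) by blast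
    define s where "s = 1 + (\<Sum>b\<in>B. norm b)"
    have s: "s > 0" unfolding s_def by (simp add: add_pos_nonneg sum_nonneg)
    have es: "e / s > 0" using that s by simp
    have "\<exists>q\<in>\<rat>. \<bar>q - c b\<bar> < e / s" for b
    proof -
      obtain q where "q \<in> \<rat>" "c b < q" "q < c b + e / s"
        using Rats_dense_in_real[of "c b" "c b + e / s"] es by auto
      then show ?thesis by (intro bexI[of _ q]) auto
    qed
    then have "\<forall>b. \<exists>q. q \<in> \<rat> \<and> \<bar>q - c b\<bar> < e / s" by auto
    then obtain q where q: "\<And>b. q b \<in> \<rat>" "\<And>b. \<bar>q b - c b\<bar> < e / s"
      using choice[of "\<lambda>b q. q \<in> \<rat> \<and> \<bar>q - c b\<bar> < e / s"] by auto
    define y where "y = (\<Sum>b\<in>B. restrict q B b *\<^sub>R b)"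
    have yD: "y \<in> D" unfolding D_def y_def by (rule imageI) (use q(1) in auto)
    have y: "y = (\<Sum>b\<in>B. q b *\<^sub>R b)" unfolding y_def by simp
    have bound: "\<bar>c b - q b\<bar> * norm b \<le> (e / s) * norm b" for b
      by (rule mult_right_mono) (use q(2)[of b] in auto)
    have "dist x y = norm (\<Sum>b\<in>B. (c b - q b) *\<^sub>R b)"
      unfolding dist_norm c y by (simp add: sum_subtractf scaleR_left_diff_distrib)
    also have "\<dots> \<le> (\<Sum>b\<in>B. (e / s) * norm b)"
      by (rule order.trans[OF norm_sum], rule sum_mono)
         (use bound in simp)
    also have "\<dots> = (e / s) * (s - 1)" unfolding s_def by (simp add: sum_distrib_left)
    also have "\<dots> < e" using s that by (simp add: field_simps)
    finally show ?thesis using yD by blast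
  qed
  ultimately show ?thesis by blast
qed

instance finite_dim_normed \<subseteq> second_countable_topology
proof
  obtain D :: "'a set" where D: "countable D" "\<And>x e. e > 0 \<Longrightarrow> \<exists>y\<in>D. dist x y < e"
    using countable_dense_finite_dim by metis
  define \<B> where "\<B> = (\<lambda>(y, n). ball y (1 / real (Suc n))) ` (D \<times> UNIV)"
  have "countable \<B>" unfolding \<B>_def by (intro countable_image countable_SIGMA D) auto
  moreover have "topological_basis \<B>"
  proof (rule topological_basisI)
    fix U :: "'a set" and x assume "open U" "x \<in> U"
    then obtain e where e: "e > 0" "ball x e \<subseteq> U" by (metis open_contains_ball)
    obtain n where n: "1 / real (Suc n) < e / 2"
      using nat_approx_posE[of "e/2"] e by auto
    obtain y where y: "y \<in> D" "dist x y < 1 / real (Suc n)"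
      using D(2)[of "1 / real (Suc n)" x] by auto
    show "\<exists>B'\<in>\<B>. x \<in> B' \<and> B' \<subseteq> U"
    proof (intro bexI conjI)
      show "ball y (1 / real (Suc n)) \<in> \<B>" unfolding \<B>_def using y by auto
      show "x \<in> ball y (1 / real (Suc n))" using y by (simp add: dist_commute)
      have "dist x z < e" if "dist y z < 1 / real (Suc n)" for z
        using dist_triangle[of x z y] y(2) n that by linarith
      then show "ball y (1 / real (Suc n)) \<subseteq> U" using e by (auto simp: subset_eq)
    qed
  qed (auto simp: \<B>_def)
  ultimately show "\<exists>B::'a set set. countable B \<and> open = generate_topology B"
    using topological_basis_imp_subbasis by blast
qed

section \<open>Gradients along segments\<close>

text \<open>The one-dimensional restriction to which the mean value theorem and the tangent inequality are
reduced.\<close>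

lemma segment_derivative:
  fixes F :: "'u::real_normed_vector \<Rightarrow> real"
  assumes "F differentiable (at (a + t *\<^sub>R (b - a)))"
  shows "((\<lambda>s. F (a + s *\<^sub>R (b - a))) has_derivative
           (\<lambda>s. s * blinfun_apply (grad F (a + t *\<^sub>R (b - a))) (b - a))) (at t within T)"
proof -
  have "((\<lambda>s. F (a + s *\<^sub>R (b - a))) has_derivative
           (\<lambda>s. blinfun_apply (grad F (a + t *\<^sub>R (b - a))) (s *\<^sub>R (b - a)))) (at t within T)"
    by (rule has_derivative_compose[of "\<lambda>s. a + s *\<^sub>R (b - a)", OF _ has_derivative_grad[OF assms]])
       (auto intro!: derivative_eq_intros)
  then show ?thesis by (simp add: blinfun.scaleR_right)
qed

lemma segment_in_convex:
  assumes "convex U" "a \<in> U" "b \<in> U" "0 \<le> t" "t \<le> 1"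
  shows "a + t *\<^sub>R (b - a) \<in> (U :: 'u::real_vector set)"
proof -
  have "a + t *\<^sub>R (b - a) = (1 - t) *\<^sub>R a + t *\<^sub>R b" by (simp add: algebra_simps)
  then show ?thesis using convexD_alt[OF assms] by simp
qed

lemma mean_value_segment:
  fixes F :: "'u::real_normed_vector \<Rightarrow> real"
  assumes "convex U" "a \<in> U" "b \<in> U" "\<And>u. u \<in> U \<Longrightarrow> F differentiable (at u)"
  obtains u t where "u \<in> U" "0 \<le> t" "t \<le> 1" "u = a + t *\<^sub>R (b - a)"
    "F b - F a = blinfun_apply (grad F u) (b - a)"
proof -
  have *: "\<exists>t\<in>{0<..<1}. F (a + 1 *\<^sub>R (b - a)) - F (a + 0 *\<^sub>R (b - a))
      = (1 - 0) * blinfun_apply (grad F (a + t *\<^sub>R (b - a))) (b - a)"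
    by (rule mvt_simple[of 0 1 "\<lambda>s. F (a + s *\<^sub>R (b - a))"])
       (use assms segment_in_convex[OF assms(1-3)] in \<open>auto intro!: segment_derivative\<close>)
  then obtain t where t: "0 < t" "t < 1" "F b - F a = blinfun_apply (grad F (a + t *\<^sub>R (b - a))) (b - a)"
    by auto
  show thesis
    by (rule that[OF segment_in_convex[OF assms(1-3), of t], of t]) (use t in auto)
qed

text \<open>By the mean value theorem the increment is the gradient at some point of the segment, which differs
from the gradient at \<open>a\<close> by at most \<open>L\<close> times the length of the segment.  Integrating along the
segment would give \<open>L / 2\<close>, but \<open>L\<close> is good enough: it is the contribution \<open>L\<^sub>\<lambda>\<^sub>\<lambda>\<close> to \<open>L\<^sub>D\<close>.\<close>

lemma lipschitz_gradient_lower_bound: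
  fixes F :: "'u::real_normed_vector \<Rightarrow> real"
  assumes "convex U" "a \<in> U" "b \<in> U" "\<And>u. u \<in> U \<Longrightarrow> F differentiable (at u)"
    and lip: "\<And>u. u \<in> U \<Longrightarrow> norm (grad F u - grad F a) \<le> L * norm (u - a)" and "0 \<le> L"
  shows "F a + blinfun_apply (grad F a) (b - a) - L * (norm (b - a))\<^sup>2 \<le> F b"
proof -
  obtain u t where u: "u \<in> U" "0 \<le> t" "t \<le> 1" "u = a + t *\<^sub>R (b - a)"
    and eq: "F b - F a = blinfun_apply (grad F u) (b - a)"
    using mean_value_segment[OF assms(1-4)] by metis
  have "\<bar>blinfun_apply (grad F u - grad F a) (b - a)\<bar> \<le> norm (grad F u - grad F a) * norm (b - a)"
    using norm_blinfun[of "grad F u - grad F a" "b - a"] by simp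
  also have "\<dots> \<le> (L * norm (u - a)) * norm (b - a)"
    by (rule mult_right_mono[OF lip[OF u(1)]]) simp
  also have "\<dots> \<le> (L * norm (b - a)) * norm (b - a)"
    using u(2-4) \<open>0 \<le> L\<close>
    by (intro mult_right_mono mult_left_mono) (auto simp: mult_le_cancel_right1 mult_left_le_one_le)
  finally show ?thesis
    using eq by (simp add: blinfun.diff_left power2_eq_square mult.assoc abs_le_iff)
qed

text \<open>The difference quotient towards \<open>b\<close> is at least \<open>F b - F a\<close> by concavity, and it tends to the
directional derivative.\<close>

lemma concave_below_tangent:
  fixes F :: "'u::real_normed_vector \<Rightarrow> real"
  assumes conc: "concave_on U F" and ab: "a \<in> U" "b \<in> U" and diff: "F differentiable (at a)"
  shows "F b \<le> F a + blinfun_apply (grad F a) (b - a)"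
proof -
  define g where "g = (\<lambda>s. F (a + s *\<^sub>R (b - a)))"
  have "((\<lambda>s. F (a + s *\<^sub>R (b - a))) has_derivative
           (\<lambda>s. s * blinfun_apply (grad F (a + 0 *\<^sub>R (b - a))) (b - a))) (at 0)"
    by (rule segment_derivative) (use diff in simp)
  then have "(g has_real_derivative blinfun_apply (grad F a) (b - a)) (at 0)"
    unfolding g_def has_field_derivative_def by (simp add: mult.commute[of _ "blinfun_apply _ _"] mult_commute_abs)
  then have "((\<lambda>s. (g s - g 0) / s) \<longlongrightarrow> blinfun_apply (grad F a) (b - a)) (at_right 0)"
    unfolding DERIV_def by (simp add: filterlim_at_split)
  moreover have "\<forall>\<^sub>F s in at_right (0::real). F b - F a \<le> (g s - g 0) / s"
  proof (rule eventually_at_rightI)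
    fix s :: real assume s: "s \<in> {0<..<1}"
    have "(1 - s) * F a + s * F b \<le> F ((1 - s) *\<^sub>R a + s *\<^sub>R b)"
      using concave_onD[OF conc, of s a b] s ab by simp
    also have "(1 - s) *\<^sub>R a + s *\<^sub>R b = a + s *\<^sub>R (b - a)" by (simp add: algebra_simps)
    finally have "s * (F b - F a) \<le> g s - g 0" unfolding g_def by (simp add: algebra_simps)
    then show "F b - F a \<le> (g s - g 0) / s" using s by (simp add: field_simps)
  qed simp
  ultimately have "F b - F a \<le> blinfun_apply (grad F a) (b - a)"
    by (rule tendsto_lowerbound) simp
  then show ?thesis by simp
qed

text \<open>Add the two gradient inequalities based at the midpoint: the linear terms are opposite and cancel.\<close>

lemma midpoint_strong_convexity:
  fixes F :: "'u::real_normed_vector \<Rightarrow> real"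
  assumes "convex U"
    and sc: "\<And>u u'. u \<in> U \<Longrightarrow> u' \<in> U \<Longrightarrow>
      m / 2 * (norm (u - u'))\<^sup>2 \<le> F u - F u' - blinfun_apply (grad F u') (u - u')"
    and ab: "a \<in> U" "b \<in> U"
  shows "F ((1/2) *\<^sub>R a + (1/2) *\<^sub>R b) \<le> (F a + F b) / 2 - m / 8 * (norm (a - b))\<^sup>2"
proof -
  define u where "u = (1/2) *\<^sub>R a + (1/2) *\<^sub>R b"
  have u: "u \<in> U" unfolding u_def by (rule convexD[OF assms(1) ab]) auto
  have a: "a - u = (1/2) *\<^sub>R (a - b)" and b: "b - u = - ((1/2) *\<^sub>R (a - b))"
    unfolding u_def by (simp_all add: algebra_simps flip: scaleR_left_distrib)
  define p where "p = blinfun_apply (grad F u) ((1/2) *\<^sub>R (a - b))"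
  define n where "n = (norm (a - b))\<^sup>2"
  have na: "(norm (a - u))\<^sup>2 = n / 4" and nb: "(norm (b - u))\<^sup>2 = n / 4"
    unfolding a b norm_minus_cancel n_def norm_scaleR by (simp_all add: power_mult_distrib power2_eq_square)
  have pb: "blinfun_apply (grad F u) (b - u) = - p" unfolding b p_def blinfun.minus_right ..
  have pa: "blinfun_apply (grad F u) (a - u) = p" unfolding a p_def ..
  have "m / 2 * (n / 4) \<le> F a - F u - p" using sc[OF ab(1) u] unfolding na pa .
  moreover have "m / 2 * (n / 4) \<le> F b - F u - (- p)" using sc[OF ab(2) u] unfolding nb pb .
  ultimately show ?thesis unfolding u_def[symmetric] n_def[symmetric] by (simp add: field_simps)
qed

section \<open>The saddle function\<close>

text \<open>Properness gives real values on the effective domain, so the extended-valued problem can be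
handled with real functions on the feasible sets.\<close>

lemma edom_realE:
  assumes "closed_convex_proper F" "U \<subseteq> edom F" "x \<in> U"
  obtains r where "F x = ereal r"
proof (cases "F x")
  case PInf
  then show thesis using assms(2,3) unfolding edom_def by auto
next
  case MInf
  then show thesis using assms(1) unfolding closed_convex_proper_def by simp
qed (rule that)

lemma convex_on_finval:
  assumes F: "closed_convex_proper F" and U: "U \<subseteq> edom F" "convex U"
  shows "convex_on U (finval F)"
proof (rule convex_onI)
  fix t x y assume t: "0 < t" "t < (1::real)" and xy: "x \<in> U" "y \<in> U"
  have m: "(1 - t) *\<^sub>R x + t *\<^sub>R y \<in> U" using U(2) xy t by (simp add: convexD_alt)
  have epi: "(z, finval F z) \<in> eepi F" if z: "z \<in> U" for z
  proof -
    obtain r where "F z = ereal r" by (rule edom_realE[OF F U(1) z])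
    then show ?thesis unfolding eepi_def by simp
  qed
  have "(1 - t) *\<^sub>R (x, finval F x) + t *\<^sub>R (y, finval F y) \<in> eepi F"
    using F epi[OF xy(1)] epi[OF xy(2)] t unfolding closed_convex_proper_def
    by (intro convexD_alt) auto
  then have "F ((1 - t) *\<^sub>R x + t *\<^sub>R y) \<le> ereal ((1 - t) * finval F x + t * finval F y)"
    unfolding eepi_def by simp
  moreover obtain r where "F ((1 - t) *\<^sub>R x + t *\<^sub>R y) = ereal r"
    by (rule edom_realE[OF F U(1) m])
  ultimately show "finval F ((1 - t) *\<^sub>R x + t *\<^sub>R y) \<le> (1 - t) * finval F x + t * finval F y"
    by simp
qed (use U in auto)

lemma convex_on_half:
  assumes "convex_on U F" "a \<in> U" "b \<in> U"
  shows "F ((1/2) *\<^sub>R a + (1/2) *\<^sub>R b) \<le> (F a + F b) / (2::real)"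
  using convex_onD[OF assms(1), of "1/2" a b] assms(2,3) by (simp add: field_simps)

lemma convex_on_finite_sum:
  assumes "finite I" "convex U" "\<And>i. i \<in> I \<Longrightarrow> convex_on U (F i)"
  shows "convex_on U (\<lambda>x. \<Sum>i\<in>I. F i x :: real)"
  using assms(1,3) by (induction I) (auto intro!: convex_on_add simp: convex_on_const assms(2))

text \<open>How strong convexity is used with an inexact minimizer \<open>b\<close>: comparing \<open>b\<close> with the midpoint of
\<open>a\<close> and \<open>b\<close> gives the quadratic growth of \<open>G\<close> away from \<open>b\<close>, up to twice the error and with \<open>m / 4\<close>
in place of \<open>m / 2\<close>.\<close>

lemma two_points_minimizer:
  fixes G :: "'u::real_normed_vector \<Rightarrow> real"
  assumes mid: "G ((1/2) *\<^sub>R a + (1/2) *\<^sub>R b) \<le> (G a + G b) / 2 - m / 8 * (norm (a - b))\<^sup>2"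
    and min: "G b \<le> G ((1/2) *\<^sub>R a + (1/2) *\<^sub>R b) + e"
  shows "G b - 2 * e + m / 4 * (norm (a - b))\<^sup>2 \<le> G a"
  using assms by argo

locale bounded_saddle_problem =
  fixes P :: "('a::finite_dim_normed, 'b::finite_dim_normed) spp"
  assumes valid: "valid_spp P" and bounded_setL: "bounded (setL P)"
begin

abbreviation "X \<equiv> setX P"
abbreviation "Y \<equiv> setL P"
abbreviation "f \<equiv> finval (fun_f P)"
abbreviation "g \<equiv> finval (fun_g P)"
abbreviation "h \<equiv> finval (fun_h P)"
abbreviation "\<omega> \<equiv> finval (dgfL P)"

definition S :: "'a \<Rightarrow> 'b \<Rightarrow> real" where
  "S x l = f x + g x + Phi P x l - h l"

lemma
  shows convex_X: "convex X" and closed_X: "closed X" and bounded_X: "bounded X" and X_ne: "X \<noteq> {}"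
    and convex_Y: "convex Y" and closed_Y: "closed Y" and Y_ne: "Y \<noteq> {}" and LD_pos: "0 < LD P"
    and mu_pos: "0 < const_mu P" and mu_le_L: "const_mu P \<le> const_L P"
    and Lxx: "0 \<le> const_Lxx P" and Llx: "0 \<le> const_Llx P" and Lll: "0 \<le> const_Lll P"
    and ncomp: "1 \<le> ncomp P"
  using valid unfolding valid_spp_def valid_f_def valid_Phi_def by auto

lemma
  shows ccp_f: "closed_convex_proper (fun_f P)" and ccp_g: "closed_convex_proper (fun_g P)"
    and ccp_h: "closed_convex_proper (fun_h P)" and ccp_w: "closed_convex_proper (dgfL P)"
    and dom_f: "X \<subseteq> edom (fun_f P)" and dom_g: "X \<subseteq> edom (fun_g P)"
    and dom_h: "Y \<subseteq> edom (fun_h P)" and dom_w: "Y \<subseteq> edom (dgfL P)"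
  using valid unfolding valid_spp_def valid_f_def dgf_def by auto

lemma Sfun_real:
  assumes "x \<in> X" "l \<in> Y"
  shows "Sfun P x l = ereal (S x l)"
proof -
  obtain a where "fun_f P x = ereal a" by (rule edom_realE[OF ccp_f dom_f assms(1)])
  moreover obtain b where "fun_g P x = ereal b" by (rule edom_realE[OF ccp_g dom_g assms(1)])
  moreover obtain c where "fun_h P l = ereal c" by (rule edom_realE[OF ccp_h dom_h assms(2)])
  ultimately show ?thesis unfolding Sfun_def S_def by simp
qed

lemma Srho_real:
  assumes "x \<in> X" "l \<in> Y"
  shows "Srho P r x l = ereal (S x l - r * \<omega> l)"
proof -
  obtain a where "dgfL P l = ereal a" by (rule edom_realE[OF ccp_w dom_w assms(2)])
  then show ?thesis unfolding Srho_def Sfun_real[OF assms] by simp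
qed

lemma valid_f_P: "valid_f P" and valid_Phi_P: "valid_Phi P"
    and dgf_w: "dgf (fun_h P) Y (dgfL P)" and dgf_wX: "dgf (fun_g P) X (dgfX P)"
  using valid unfolding valid_spp_def by simp_all

lemma f_differentiable: assumes "x \<in> X" shows "f differentiable (at x)"
proof -
  from valid_f_P obtain U where "X \<subseteq> U" "\<forall>x\<in>U. f differentiable (at x)"
    unfolding valid_f_def by (elim conjE exE)
  then show ?thesis using assms by auto
qed

lemma comp_Phi_valid: "i \<in> {1..ncomp P} \<Longrightarrow> valid_comp X Y (comp_Phi P i)"
  using valid_Phi_P unfolding valid_Phi_def by simp

lemma Phi_differentiable_x:
  assumes "x \<in> X" "l \<in> Y" shows "(\<lambda>x. Phi P x l) differentiable (at x)"
proof -
  have "(\<lambda>x. \<Sum>i=1..ncomp P. comp_Phi P i x l) differentiable (at x)"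
    by (rule differentiable_sum) (use comp_Phi_valid assms in \<open>auto simp: valid_comp_def\<close>)
  then show ?thesis
    unfolding Phi_def divide_inverse by (intro differentiable_mult differentiable_const)
qed

lemma Phi_differentiable_l:
  assumes "x \<in> X" "l \<in> Y" shows "Phi P x differentiable (at l)"
proof -
  have "(\<lambda>l. \<Sum>i=1..ncomp P. comp_Phi P i x l) differentiable (at l)"
    by (rule differentiable_sum) (use comp_Phi_valid assms in \<open>auto simp: valid_comp_def\<close>)
  then show ?thesis
    unfolding Phi_def divide_inverse by (intro differentiable_mult differentiable_const)
qed

lemma Phi_convex: assumes "l \<in> Y" shows "convex_on X (\<lambda>x. Phi P x l)"
proof -
  have "convex_on X (\<lambda>x. \<Sum>i=1..ncomp P. comp_Phi P i x l)"
    by (rule convex_on_finite_sum) (use comp_Phi_valid assms convex_X in \<open>auto simp: valid_comp_def\<close>)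
  from convex_on_cmul[OF _ this, of "1 / real (ncomp P)"] show ?thesis unfolding Phi_def by simp
qed

lemma Phi_concave: assumes "x \<in> X" shows "concave_on Y (Phi P x)"
proof -
  have "convex_on Y (\<lambda>l. \<Sum>i=1..ncomp P. - comp_Phi P i x l)"
    by (rule convex_on_finite_sum)
       (use comp_Phi_valid assms convex_Y in \<open>auto simp: valid_comp_def concave_on_def\<close>)
  from convex_on_cmul[OF _ this, of "1 / real (ncomp P)"] show ?thesis
    unfolding Phi_def concave_on_def by (simp add: sum_negf)
qed

lemma gradl_lipschitz_x:
  "x \<in> X \<Longrightarrow> x' \<in> X \<Longrightarrow> l \<in> Y \<Longrightarrow>
    norm (grad (Phi P x) l - grad (Phi P x') l) \<le> const_Llx P * norm (x - x')"
  using valid_Phi_P unfolding valid_Phi_def gradl_def by simp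

lemma gradl_lipschitz_l:
  "x \<in> X \<Longrightarrow> l \<in> Y \<Longrightarrow> l' \<in> Y \<Longrightarrow>
    norm (grad (Phi P x) l - grad (Phi P x) l') \<le> const_Lll P * norm (l - l')"
  using valid_Phi_P unfolding valid_Phi_def gradl_def by simp

lemma S_convex_x: assumes "l \<in> Y" shows "convex_on X (\<lambda>x. S x l)"
proof -
  have "convex_on X (\<lambda>x. f x + g x + Phi P x l)"
    by (intro convex_on_add convex_on_finval Phi_convex ccp_f ccp_g dom_f dom_g convex_X assms)
  from convex_on_add[OF this, of "\<lambda>_. - h l"] show ?thesis
    unfolding S_def by (simp add: convex_on_const convex_X)
qed

text \<open>The strong convexity comes from \<open>f\<close> alone; \<open>g\<close> and \<open>\<Phi>\<close> are just convex.\<close>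

lemma S_midpoint_x:
  assumes "l \<in> Y" "a \<in> X" "b \<in> X"
  shows "S ((1/2) *\<^sub>R a + (1/2) *\<^sub>R b) l \<le> (S a l + S b l) / 2 - const_mu P / 8 * (norm (a - b))\<^sup>2"
proof -
  define m where "m = (1/2) *\<^sub>R a + (1/2) *\<^sub>R b"
  have "const_mu P / 2 * (norm (u - u'))\<^sup>2 \<le> f u - f u' - blinfun_apply (grad f u') (u - u')"
    if "u \<in> X" "u' \<in> X" for u u'
    using valid_f_P that unfolding valid_f_def Let_def by simp
  from midpoint_strong_convexity[OF convex_X this assms(2,3)]
  have "f m \<le> (f a + f b) / 2 - const_mu P / 8 * (norm (a - b))\<^sup>2" unfolding m_def .
  moreover have "g m \<le> (g a + g b) / 2"
    unfolding m_def by (rule convex_on_half[OF convex_on_finval[OF ccp_g dom_g convex_X] assms(2,3)])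
  moreover have "Phi P m l \<le> (Phi P a l + Phi P b l) / 2"
    unfolding m_def by (rule convex_on_half[OF Phi_convex[OF assms(1)] assms(2,3)])
  ultimately show ?thesis unfolding S_def m_def[symmetric] by argo
qed

text \<open>The strong concavity comes from the smoothing term \<open>- r \<omega>\<close> alone.\<close>

lemma S_midpoint_l:
  assumes "x \<in> X" "a \<in> Y" "b \<in> Y" "0 \<le> r"
  defines "m \<equiv> (1/2) *\<^sub>R a + (1/2) *\<^sub>R b"
  shows "(S x a - r * \<omega> a + (S x b - r * \<omega> b)) / 2 + r / 8 * (norm (a - b))\<^sup>2 \<le> S x m - r * \<omega> m"
proof -
  have sc: "strongly_convex_on 1 Y \<omega>" using dgf_w unfolding dgf_def by simp
  have "\<omega> ((1/2) *\<^sub>R a + (1 - 1/2) *\<^sub>R b)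
      \<le> (1/2) * \<omega> a + (1 - 1/2) * \<omega> b - 1 / 2 * (1/2) * (1 - 1/2) * (norm (a - b))\<^sup>2"
    by (rule sc[unfolded strongly_convex_on_def, rule_format]) (use assms in auto)
  then have "\<omega> m \<le> (\<omega> a + \<omega> b) / 2 - 1 / 8 * (norm (a - b))\<^sup>2"
    unfolding m_def by (simp add: add_divide_distrib)
  from mult_left_mono[OF this \<open>0 \<le> r\<close>]
  have "r * \<omega> m \<le> r * \<omega> a / 2 + r * \<omega> b / 2 - r / 8 * (norm (a - b))\<^sup>2"
    by (simp add: distrib_left right_diff_distrib add_divide_distrib)
  moreover have "h m \<le> (h a + h b) / 2"
    unfolding m_def by (rule convex_on_half[OF convex_on_finval[OF ccp_h dom_h convex_Y] assms(2,3)])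
  moreover have "- Phi P x m \<le> (- Phi P x a + - Phi P x b) / 2"
    unfolding m_def using Phi_concave[OF assms(1)] assms(2,3) unfolding concave_on_def
    by (intro convex_on_half[of Y "\<lambda>l. - Phi P x l"]) auto
  ultimately show ?thesis unfolding S_def by argo
qed


end

section \<open>The excessive gap recursion\<close>

context bounded_saddle_problem
begin

text \<open>The substitute for smoothness of \<open>\<psi>\<^sup>D\<close>: a model that is linear in \<open>\<lambda>\<close> apart from \<open>h\<close>, built at an
inexact minimizer \<open>x\<close> of \<open>S(\<cdot>, l)\<close>, bounds \<open>S(x', l')\<close> from below for every \<open>x'\<close>.  Linearizing \<open>\<Phi>\<close> in
\<open>\<lambda>\<close> at \<open>x'\<close> instead of \<open>x\<close> changes the slope by at most \<open>L\<^sub>\<lambda>\<^sub>x \<parallel>x' - x\<parallel>\<close>.  The growth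
\<open>\<mu> / 4 * \<parallel>x' - x\<parallel>\<^sup>2\<close> of \<open>S(\<cdot>, l)\<close> away from \<open>x\<close> absorbs this by completing the square, at the price
\<open>L\<^sub>\<lambda>\<^sub>x\<^sup>2 / \<mu> * \<parallel>l' - l\<parallel>\<^sup>2\<close>.\<close>

lemma value_after_dual_step:
  assumes x: "x \<in> X" "x' \<in> X" and l: "l \<in> Y" "l' \<in> Y"
    and min: "\<And>u. u \<in> X \<Longrightarrow> S x l \<le> S u l + e"
  shows "f x + g x + Phi P x l + blinfun_apply (grad (Phi P x) l) (l' - l) - h l'
           - 2 * e - LD P * (norm (l' - l))\<^sup>2 \<le> S x' l'"
proof -
  define s where "s = norm (x' - x)"
  define d where "d = norm (l' - l)"
  have "(1/2) *\<^sub>R x' + (1/2) *\<^sub>R x \<in> X" by (rule convexD[OF convex_X]) (use x in auto)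
  from two_points_minimizer[of "\<lambda>u. S u l", OF S_midpoint_x[OF l(1) x(2,1)] min[OF this]]
  have "S x l - 2 * e + const_mu P / 4 * s\<^sup>2 \<le> S x' l" unfolding s_def .
  moreover have "Phi P x' l + blinfun_apply (grad (Phi P x') l) (l' - l) - const_Lll P * d\<^sup>2
      \<le> Phi P x' l'"
    unfolding d_def
    by (rule lipschitz_gradient_lower_bound[OF convex_Y l Phi_differentiable_l gradl_lipschitz_l])
       (use x l Lll in auto)
  moreover have "blinfun_apply (grad (Phi P x) l) (l' - l) - const_Llx P * s * d
      \<le> blinfun_apply (grad (Phi P x') l) (l' - l)"
  proof -
    have "\<bar>blinfun_apply (grad (Phi P x') l - grad (Phi P x) l) (l' - l)\<bar>
        \<le> norm (grad (Phi P x') l - grad (Phi P x) l) * d"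
      using norm_blinfun[of "grad (Phi P x') l - grad (Phi P x) l" "l' - l"] unfolding d_def by simp
    also have "\<dots> \<le> (const_Llx P * s) * d"
      unfolding s_def d_def by (rule mult_right_mono[OF gradl_lipschitz_x]) (use x l in auto)
    finally show ?thesis by (simp add: blinfun.diff_left abs_le_iff)
  qed
  moreover have "0 \<le> const_mu P / 4 * s\<^sup>2 - const_Llx P * s * d + (const_Llx P)\<^sup>2 / const_mu P * d\<^sup>2"
  proof -
    have "const_mu P / 4 * s\<^sup>2 - const_Llx P * s * d + (const_Llx P)\<^sup>2 / const_mu P * d\<^sup>2
        = (const_mu P * s / 2 - const_Llx P * d)\<^sup>2 / const_mu P"
      using mu_pos by (simp add: field_simps power2_eq_square)
    then show ?thesis using mu_pos by simp
  qed
  moreover have "LD P * d\<^sup>2 = const_Lll P * d\<^sup>2 + (const_Llx P)\<^sup>2 / const_mu P * d\<^sup>2"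
    unfolding LD_def by (simp add: distrib_right)
  ultimately show ?thesis unfolding S_def d_def[symmetric] by linarith
qed

text \<open>One iteration.  Here \<open>lt\<close> and \<open>lu\<close> are the two dual outputs and \<open>xt\<close> is the primal output; the
premise \<open>gap\<close> says \<open>\<psi>\<^sup>P\<^sub>r(x) \<le> \<psi>\<^sup>D(l) + E\<close> without mentioning suprema.

Up to the solver errors, \<open>\<psi>\<^sup>P(x1)\<close> with smoothing \<open>t r\<close> is the value at \<open>lu\<close>, which by convexity splits
into \<open>t S\<^sub>r(x, lu) + (1 - t) S(xt, lu)\<close>.  The first part is bounded by the old gap with a gain
\<open>r / 4 * \<parallel>lu - lt\<parallel>\<^sup>2\<close> (fact \<open>A\<close>).  On the dual side, \<open>\<psi>\<^sup>D(l1)\<close> is bounded below by the model at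
\<open>lh\<close>; as the model is affine and lies above \<open>\<Phi>(xt, \<cdot>)\<close>, its value at \<open>l1\<close> dominates the matching
convex combination, with a loss \<open>L\<^sub>D \<parallel>l1 - lh\<parallel>\<^sup>2\<close> (fact \<open>C\<close>).  Since \<open>l1 - lh = (1 - t) (lu - lt)\<close>, the
premise \<open>cond\<close> is exactly what lets the gain pay for the loss.\<close>

lemma excessive_gap_step:
  fixes x xt :: 'a and l lt lu :: 'b
  assumes tau: "0 < t" "t < 1" and r: "0 \<le> r" and cond: "LD P * (1 - t)\<^sup>2 \<le> t * r / 4"
    and mem: "x \<in> X" "xt \<in> X" "l \<in> Y" "lt \<in> Y" "lu \<in> Y"
  defines "lh \<equiv> t *\<^sub>R l + (1 - t) *\<^sub>R lt" and "x1 \<equiv> t *\<^sub>R x + (1 - t) *\<^sub>R xt"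
    and "l1 \<equiv> t *\<^sub>R l + (1 - t) *\<^sub>R lu"
  assumes gap: "\<And>x' l'. x' \<in> X \<Longrightarrow> l' \<in> Y \<Longrightarrow> S x l' - r * \<omega> l' \<le> S x' l + E"
    and lt: "\<And>l'. l' \<in> Y \<Longrightarrow> S x l' - r * \<omega> l' \<le> S x lt - r * \<omega> lt + e"
    and xt: "\<And>x'. x' \<in> X \<Longrightarrow> S xt lh \<le> S x' lh + e'"
    and lu: "\<And>l'. l' \<in> Y \<Longrightarrow> S x1 l' - t * r * \<omega> l' \<le> S x1 lu - t * r * \<omega> lu + e"
    and x': "x' \<in> X" and l': "l' \<in> Y"
  shows "S x1 l' - t * r * \<omega> l' \<le> S x' l1 + (t * E + (1 + t) * e + 2 * e')"
proof -
  define n where "n = (norm (lu - lt))\<^sup>2"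
  have lhY: "lh \<in> Y" and l1Y: "l1 \<in> Y"
    unfolding lh_def l1_def by (rule convexD[OF convex_Y]; use mem tau in simp)+
  have d: "l1 - lh = (1 - t) *\<^sub>R (lu - lt)"
    unfolding l1_def lh_def by (simp add: algebra_simps)
  have nd: "(norm (l1 - lh))\<^sup>2 = (1 - t)\<^sup>2 * n"
    unfolding d norm_scaleR n_def by (simp add: power_mult_distrib)

  have "(1/2) *\<^sub>R lu + (1/2) *\<^sub>R lt \<in> Y" by (rule convexD[OF convex_Y]) (use mem in auto)
  from gap[OF mem(2) this] lt[OF this] S_midpoint_l[OF mem(1,5,4) r]
  have A: "S x lu - r * \<omega> lu \<le> S xt l + E + e - r / 4 * n" unfolding n_def by argo

  have B: "S x1 lu \<le> t * S x lu + (1 - t) * S xt lu"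
    using convex_onD[OF S_convex_x[OF mem(5)], of "1 - t" x xt] tau mem unfolding x1_def by simp

  \<comment> \<open>the linearization of \<open>\<Phi>\<close> at \<open>lh\<close>, a common upper bound at \<open>l\<close> and \<open>lu\<close>\<close>
  define p where "p = (\<lambda>v. Phi P xt lh + blinfun_apply (grad (Phi P xt) lh) (v - lh))"
  have p_above: "Phi P xt v \<le> p v" if "v \<in> Y" for v
    unfolding p_def
    by (rule concave_below_tangent[OF Phi_concave[OF mem(2)] lhY that Phi_differentiable_l[OF mem(2) lhY]])
  have p_affine: "p l1 = t * p l + (1 - t) * p lu"
  proof -
    have "l1 - lh = t *\<^sub>R (l - lh) + (1 - t) *\<^sub>R (lu - lh)"
      unfolding l1_def by (simp add: algebra_simps)
    then have "blinfun_apply (grad (Phi P xt) lh) (l1 - lh)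
        = t * blinfun_apply (grad (Phi P xt) lh) (l - lh)
          + (1 - t) * blinfun_apply (grad (Phi P xt) lh) (lu - lh)"
      by (simp only: blinfun.add_right blinfun.scaleR_right real_scaleR_def)
    then show ?thesis unfolding p_def by (simp only: algebra_simps)
  qed
  have "t * Phi P xt l + (1 - t) * Phi P xt lu \<le> p l1"
    unfolding p_affine using p_above mem tau by (intro add_mono mult_left_mono) auto
  moreover have "h l1 \<le> t * h l + (1 - t) * h lu"
    using convex_onD[OF convex_on_finval[OF ccp_h dom_h convex_Y], of "1 - t" l lu] tau mem
    unfolding l1_def by simp
  moreover have "f xt + g xt + p l1 - h l1 - 2 * e' - LD P * ((1 - t)\<^sup>2 * n) \<le> S x' l1"
    using value_after_dual_step[OF mem(2) x' lhY l1Y xt] unfolding nd p_def by (simp add: algebra_simps)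
  moreover have "t * S xt l + (1 - t) * S xt lu
      = f xt + g xt + (t * Phi P xt l + (1 - t) * Phi P xt lu) - (t * h l + (1 - t) * h lu)"
    unfolding S_def by (simp add: algebra_simps)
  ultimately have C: "t * S xt l + (1 - t) * S xt lu - 2 * e' - LD P * ((1 - t)\<^sup>2 * n) \<le> S x' l1"
    by linarith
  have D: "LD P * ((1 - t)\<^sup>2 * n) \<le> t * r / 4 * n"
    using mult_right_mono[OF cond, of n] unfolding n_def by (simp add: mult.assoc)
  have A': "t * S x lu - t * r * \<omega> lu \<le> t * S xt l + t * E + t * e - t * r / 4 * n"
    using mult_left_mono[OF A, of t] tau by (simp add: algebra_simps)
  have "S x1 l' - t * r * \<omega> l' \<le> S x1 lu - t * r * \<omega> lu + e" by (rule lu[OF l'])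
  also have "\<dots> \<le> t * S x lu - t * r * \<omega> lu + (1 - t) * S xt lu + e" using B by linarith
  also have "\<dots> \<le> t * S xt l + t * E + t * e - t * r / 4 * n + (1 - t) * S xt lu + e"
    using A' by linarith
  also have "\<dots> \<le> S x' l1 + 2 * e' + t * E + t * e + e" using C D by linarith
  finally show ?thesis by (simp add: distrib_right)
qed

end

text \<open>The product of the factors \<open>(k + 1) / (k + 3)\<close> telescopes.\<close>

lemma rho_eq: "rho P k = 16 * LD P / ((real k + 1) * (real k + 2))"
proof (induction k)
  case (Suc k)
  have "rho P (Suc k) = (real k + 1) / (real k + 3) * (16 * LD P / ((real k + 1) * (real k + 2)))"
    using Suc by (simp add: tau_def)
  also have "\<dots> = 16 * LD P / ((real (Suc k) + 1) * (real (Suc k) + 2))"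
    by (simp add: divide_simps) (simp add: algebra_simps)
  finally show ?case .
qed simp

context bounded_saddle_problem
begin

text \<open>Multiplying the recursion \<open>E\<^sub>k\<^sub>+\<^sub>1 \<le> \<tau>\<^sub>k E\<^sub>k + \<epsilon> / (k + 3)\<close> by \<open>(k + 2) (k + 3)\<close> makes it telescope:
the increments are \<open>\<epsilon> (k + 2)\<close>, which sum to \<open>\<epsilon> N (N + 3) / 2\<close>.  At the start, smoothing by
\<open>\<rho>\<^sub>0 = 8 L\<^sub>D\<close> raises the gap by at most \<open>8 L\<^sub>D B\<close>.\<close>

lemma excessive_gap_trajectory:
  assumes eps: "0 < \<epsilon>" and x0: "xs 0 \<in> X" and l0: "ls 0 \<in> Y"
    and init: "\<And>x' l'. x' \<in> X \<Longrightarrow> l' \<in> Y \<Longrightarrow> S (xs 0) l' \<le> S x' (ls 0) + D"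
    and B: "\<And>l. l \<in> Y \<Longrightarrow> \<bar>\<omega> l\<bar> \<le> B"
    and l1: "\<And>k. k < K \<Longrightarrow> l1 k \<in> Y" and xo: "\<And>k. k < K \<Longrightarrow> xo k \<in> X"
    and l2: "\<And>k. k < K \<Longrightarrow> l2 k \<in> Y"
    and xs_Suc: "\<And>k. k < K \<Longrightarrow> xs (Suc k) = tau k *\<^sub>R xs k + (1 - tau k) *\<^sub>R xo k"
    and ls_Suc: "\<And>k. k < K \<Longrightarrow> ls (Suc k) = tau k *\<^sub>R ls k + (1 - tau k) *\<^sub>R l2 k"
    and e1: "\<And>k l'. k < K \<Longrightarrow> l' \<in> Y \<Longrightarrow>
      S (xs k) l' - rho P k * \<omega> l' \<le> S (xs k) (l1 k) - rho P k * \<omega> (l1 k) + accuracy \<epsilon> k"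
    and e2: "\<And>k x'. k < K \<Longrightarrow> x' \<in> X \<Longrightarrow>
      S (xo k) (tau k *\<^sub>R ls k + (1 - tau k) *\<^sub>R l1 k)
        \<le> S x' (tau k *\<^sub>R ls k + (1 - tau k) *\<^sub>R l1 k) + accuracy \<epsilon> k"
    and e3: "\<And>k l'. k < K \<Longrightarrow> l' \<in> Y \<Longrightarrow>
      S (xs (Suc k)) l' - rho P (Suc k) * \<omega> l'
        \<le> S (xs (Suc k)) (l2 k) - rho P (Suc k) * \<omega> (l2 k) + accuracy \<epsilon> k"
  shows "N \<le> K \<Longrightarrow> xs N \<in> X \<and> ls N \<in> Y \<and> (\<forall>x'\<in>X. \<forall>l'\<in>Y. S (xs N) l' - rho P N * \<omega> l' \<le> S x' (ls N) +
      (2 * (D + 8 * LD P * B) + \<epsilon> * real N * (real N + 3) / 2) / ((real N + 1) * (real N + 2)))"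
proof (induction N)
  case 0
  have "S (xs 0) l' - rho P 0 * \<omega> l' \<le> S x' (ls 0) + (D + 8 * LD P * B)" if "x' \<in> X" "l' \<in> Y" for x' l'
  proof -
    have "8 * LD P * (- \<omega> l') \<le> 8 * LD P * B"
      by (rule mult_left_mono[OF abs_le_D2[OF B[OF that(2)]]]) (use LD_pos in simp)
    then show ?thesis using init[OF that] unfolding rho.simps by argo
  qed
  moreover have "(2 * (D + 8 * LD P * B) + \<epsilon> * real 0 * (real 0 + 3) / 2) / ((real 0 + 1) * (real 0 + 2))
      = D + 8 * LD P * B" by simp
  ultimately show ?case using x0 l0 by (simp only: ball_simps simp_thms) blast
next
  case (Suc k)
  define E where "E = (2 * (D + 8 * LD P * B) + \<epsilon> * real k * (real k + 3) / 2) / ((real k + 1) * (real k + 2))"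
  have k: "k < K" using Suc.prems by simp
  have IH: "xs k \<in> X" "ls k \<in> Y"
    "\<And>x' l'. x' \<in> X \<Longrightarrow> l' \<in> Y \<Longrightarrow> S (xs k) l' - rho P k * \<omega> l' \<le> S x' (ls k) + E"
    using Suc unfolding E_def by auto
  have t: "0 < tau k" "tau k < 1" unfolding tau_def by auto
  have rho_nonneg: "0 \<le> rho P k" unfolding rho_eq using LD_pos by simp
  have cond: "LD P * (1 - tau k)\<^sup>2 \<le> tau k * rho P k / 4"
  proof -
    have "1 - tau k = 2 / (real k + 3)" unfolding tau_def by (simp add: field_simps)
    then have "LD P * (1 - tau k)\<^sup>2 = 4 * LD P / ((real k + 3) * (real k + 3))"
      by (simp add: power2_eq_square)
    also have "\<dots> \<le> 4 * LD P / ((real k + 2) * (real k + 3))"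
      using LD_pos by (intro divide_left_mono mult_right_mono) auto
    also have "\<dots> = tau k * rho P k / 4"
      unfolding tau_def rho_eq by (simp add: divide_simps)
    finally show ?thesis .
  qed
  have mem: "xs (Suc k) \<in> X" "ls (Suc k) \<in> Y"
    unfolding xs_Suc[OF k] ls_Suc[OF k]
    by (rule convexD[OF convex_X] convexD[OF convex_Y]; use IH t xo[OF k] l2[OF k] in simp)+
  have "tau k * E + (1 + tau k) * accuracy \<epsilon> k + 2 * accuracy \<epsilon> k \<le> tau k * E + \<epsilon> / (real k + 3)"
  proof -
    have "0 \<le> accuracy \<epsilon> k" using eps unfolding accuracy_def by simp
    then have "(1 + tau k) * accuracy \<epsilon> k \<le> 2 * accuracy \<epsilon> k" using t by (intro mult_right_mono) auto
    moreover have "\<epsilon> / (real k + 3) = 4 * accuracy \<epsilon> k" unfolding accuracy_def by (simp add: field_simps)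
    ultimately show ?thesis by linarith
  qed
  also have "tau k * E + \<epsilon> / (real k + 3)
      = (2 * (D + 8 * LD P * B) + \<epsilon> * real (Suc k) * (real (Suc k) + 3) / 2)
        / ((real (Suc k) + 1) * (real (Suc k) + 2))"
  proof -
    define N where "N = 2 * (D + 8 * LD P * B)"
    have "tau k * E = (N + \<epsilon> * real k * (real k + 3) / 2) / ((real k + 2) * (real k + 3))"
      unfolding E_def tau_def N_def by (simp add: divide_simps)
    moreover have "\<epsilon> / (real k + 3) = \<epsilon> * (real k + 2) / ((real k + 2) * (real k + 3))"
      by (simp add: divide_simps)
    ultimately have "tau k * E + \<epsilon> / (real k + 3)
        = (N + \<epsilon> * real k * (real k + 3) / 2 + \<epsilon> * (real k + 2)) / ((real k + 2) * (real k + 3))"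
      by (simp only: add_divide_distrib)
    also have "N + \<epsilon> * real k * (real k + 3) / 2 + \<epsilon> * (real k + 2)
        = N + \<epsilon> * real (Suc k) * (real (Suc k) + 3) / 2" by (simp add: algebra_simps)
    also have "(real k + 2) * (real k + 3) = (real (Suc k) + 1) * (real (Suc k) + 2)"
      by (simp add: algebra_simps)
    finally show ?thesis unfolding N_def .
  qed
  finally have E: "tau k * E + (1 + tau k) * accuracy \<epsilon> k + 2 * accuracy \<epsilon> k \<le> \<dots>" .
  have "S (xs (Suc k)) l' - rho P (Suc k) * \<omega> l'
      \<le> S x' (ls (Suc k)) + (tau k * E + (1 + tau k) * accuracy \<epsilon> k + 2 * accuracy \<epsilon> k)"
    if x': "x' \<in> X" and l': "l' \<in> Y" for x' l'
    using excessive_gap_step[OF t rho_nonneg cond IH(1) xo[OF k] IH(2) l1[OF k] l2[OF k] IH(3) e1[OF k] e2[OF k] _ x' l']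
      e3[OF k] unfolding xs_Suc[OF k] ls_Suc[OF k] by simp
  from order.trans[OF this add_left_mono[OF E]] show ?case using mem by blast
qed

end

section \<open>Finite values, the duality gap and continuity\<close>

text \<open>The existence of a minimizer of \<open>F + w\<close> on \<open>U\<close> is part of the definition of a distance generating
function, and \<open>w\<close> is continuous, hence bounded, on the compact set \<open>U\<close>.\<close>

lemma dgf_bounded_below:
  fixes F :: "'u::real_normed_vector \<Rightarrow> ereal"
  assumes "compact U" and F: "closed_convex_proper F" "U \<subseteq> edom F" and d: "dgf F U w"
  shows "\<exists>c. \<forall>u\<in>U. c \<le> finval F u"
proof -
  have w: "closed_convex_proper w" "U \<subseteq> edom w" "continuous_on U (finval w)"
    using d unfolding dgf_def by auto
  define G where "G = (\<lambda>u. F u + ereal (blinfun_apply 0 u) + ereal (inverse 1) * w u)"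
  have "\<forall>\<alpha>>0. \<forall>v :: 'u \<Rightarrow>\<^sub>L real. \<exists>s\<in>core U w.
        {u. is_arg_min (\<lambda>u. F u + ereal (blinfun_apply v u) + ereal (inverse \<alpha>) * w u)
              (\<lambda>u. u \<in> U) u} = {s}"
    using d unfolding dgf_def by (elim conjE)
  from this[rule_format, of 1 0, OF zero_less_one]
  have "\<exists>s\<in>core U w. {u. is_arg_min G (\<lambda>u. u \<in> U) u} = {s}" unfolding G_def .
  then obtain s where "{u. is_arg_min G (\<lambda>u. u \<in> U) u} = {s}" by (rule bexE) (rule that)
  then have "s \<in> {u. is_arg_min G (\<lambda>u. u \<in> U) u}" by simp
  moreover have "G = (\<lambda>u. F u + w u)"
    unfolding G_def by (simp add: one_ereal_def[symmetric] zero_ereal_def[symmetric])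
  ultimately have s: "s \<in> U" "\<And>u. u \<in> U \<Longrightarrow> F s + w s \<le> F u + w u"
    unfolding is_arg_min_def by (auto simp: not_less)
  have "bounded (finval w ` U)"
    by (rule compact_imp_bounded[OF compact_continuous_image[OF w(3) \<open>compact U\<close>]])
  then obtain b where b: "\<And>u. u \<in> U \<Longrightarrow> \<bar>finval w u\<bar> \<le> b" unfolding bounded_iff by auto
  have "finval F s + finval w s - b \<le> finval F u" if u: "u \<in> U" for u
  proof -
    obtain a1 where a1: "F s = ereal a1" by (rule edom_realE[OF F s(1)])
    obtain a2 where a2: "w s = ereal a2" by (rule edom_realE[OF w(1,2) s(1)])
    obtain a3 where a3: "F u = ereal a3" by (rule edom_realE[OF F u])
    obtain a4 where a4: "w u = ereal a4" by (rule edom_realE[OF w(1,2) u])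
    show ?thesis using s(2)[OF u] b[OF u] unfolding a1 a2 a3 a4 by simp
  qed
  then show ?thesis by (intro exI ballI)
qed

context bounded_saddle_problem
begin

lemma compact_X: "compact X"
  using closed_X bounded_X by (simp add: compact_eq_bounded_closed)

lemma compact_Y: "compact Y"
  using closed_Y bounded_setL by (simp add: compact_eq_bounded_closed)

lemma continuous_on_f: "continuous_on X f"
  by (intro continuous_at_imp_continuous_on ballI differentiable_imp_continuous_within f_differentiable)

lemma continuous_on_Phi_x: "l \<in> Y \<Longrightarrow> continuous_on X (\<lambda>x. Phi P x l)"
  by (intro continuous_at_imp_continuous_on ballI differentiable_imp_continuous_within Phi_differentiable_x)

lemma continuous_on_Phi_l: "x \<in> X \<Longrightarrow> continuous_on Y (Phi P x)"
  by (intro continuous_at_imp_continuous_on ballI differentiable_imp_continuous_within Phi_differentiable_l)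

text \<open>On the bounded feasible sets the Lipschitz partial gradient is bounded.\<close>

lemma Phi_lipschitz_l:
  "\<exists>G. \<forall>x\<in>X. \<forall>l\<in>Y. \<forall>l'\<in>Y. \<bar>Phi P x l - Phi P x l'\<bar> \<le> G * norm (l - l')"
proof -
  obtain x0 l0 where x0: "x0 \<in> X" and l0: "l0 \<in> Y" using X_ne Y_ne by blast
  obtain r where r0: "\<forall>x\<in>X. dist x0 x \<le> r"
    using bounded_X[unfolded bounded_any_center[of X x0]] by (rule exE)
  have r: "norm (x - x0) \<le> r" if "x \<in> X" for x
    using bspec[OF r0 that] unfolding dist_commute[of x0 x] unfolding dist_norm .
  obtain q where q0: "\<forall>l\<in>Y. dist l0 l \<le> q"
    using bounded_setL[unfolded bounded_any_center[of Y l0]] by (rule exE)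
  have q: "norm (l - l0) \<le> q" if "l \<in> Y" for l
    using bspec[OF q0 that] unfolding dist_commute[of l0 l] unfolding dist_norm .
  define G where "G = norm (grad (Phi P x0) l0) + const_Llx P * r + const_Lll P * q"
  have G: "norm (grad (Phi P x) u) \<le> G" if x: "x \<in> X" and u: "u \<in> Y" for x u
  proof -
    have "norm (grad (Phi P x) u - grad (Phi P x) l0) \<le> const_Lll P * norm (u - l0)"
      by (rule gradl_lipschitz_l[OF x u l0])
    also have "\<dots> \<le> const_Lll P * q" by (rule mult_left_mono[OF q[OF u] Lll])
    finally have 1: "norm (grad (Phi P x) u - grad (Phi P x) l0) \<le> const_Lll P * q" .
    have "norm (grad (Phi P x) l0 - grad (Phi P x0) l0) \<le> const_Llx P * norm (x - x0)"
      by (rule gradl_lipschitz_x[OF x x0 l0])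
    also have "\<dots> \<le> const_Llx P * r" by (rule mult_left_mono[OF r[OF x] Llx])
    finally have 2: "norm (grad (Phi P x) l0 - grad (Phi P x0) l0) \<le> const_Llx P * r" .
    have tri: "norm (a + b + c) \<le> norm a + norm b + norm c" for a b c :: "'b \<Rightarrow>\<^sub>L real"
      using norm_triangle_ineq[of "a + b" c] norm_triangle_ineq[of a b] by linarith
    have "norm (grad (Phi P x) u) = norm ((grad (Phi P x) u - grad (Phi P x) l0)
        + (grad (Phi P x) l0 - grad (Phi P x0) l0) + grad (Phi P x0) l0)" by simp
    also have "\<dots> \<le> norm (grad (Phi P x) u - grad (Phi P x) l0)
        + norm (grad (Phi P x) l0 - grad (Phi P x0) l0) + norm (grad (Phi P x0) l0)"
      by (rule tri)
    finally have "norm (grad (Phi P x) u) \<le> norm (grad (Phi P x) u - grad (Phi P x) l0)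
        + norm (grad (Phi P x) l0 - grad (Phi P x0) l0) + norm (grad (Phi P x0) l0)" .
    then show ?thesis using 1 2 unfolding G_def by linarith
  qed
  have "\<bar>Phi P x l - Phi P x l'\<bar> \<le> G * norm (l - l')" if x: "x \<in> X" and l: "l \<in> Y" "l' \<in> Y" for x l l'
  proof -
    obtain u where u: "u \<in> Y" "Phi P x l - Phi P x l' = blinfun_apply (grad (Phi P x) u) (l - l')"
      by (rule mean_value_segment[OF convex_Y l(2,1) Phi_differentiable_l[OF x]])
    have "\<bar>Phi P x l - Phi P x l'\<bar> \<le> norm (grad (Phi P x) u) * norm (l - l')"
      unfolding u(2) using norm_blinfun[of "grad (Phi P x) u" "l - l'"] by simp
    also have "\<dots> \<le> G * norm (l - l')" by (rule mult_right_mono[OF G[OF x u(1)]]) simp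
    finally show ?thesis .
  qed
  then show ?thesis by (intro exI[of _ G] ballI)
qed

text \<open>Joint continuity from separate continuity in \<open>x\<close> and a Lipschitz constant in \<open>\<lambda>\<close> that does not
depend on \<open>x\<close>.\<close>

lemma continuous_on_Phi: "continuous_on (X \<times> Y) (\<lambda>p. Phi P (fst p) (snd p))"
  unfolding continuous_on_def
proof
  fix p assume p: "p \<in> X \<times> Y"
  obtain x0 l0 where p_eq: "p = (x0, l0)" by (cases p)
  have x0: "x0 \<in> X" and l0: "l0 \<in> Y" using p p_eq by auto
  obtain G where G: "\<And>x l l'. x \<in> X \<Longrightarrow> l \<in> Y \<Longrightarrow> l' \<in> Y \<Longrightarrow> \<bar>Phi P x l - Phi P x l'\<bar> \<le> G * norm (l - l')"
    using Phi_lipschitz_l by (elim exE) auto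
  let ?F = "at (x0, l0) within X \<times> Y"
  have "((\<lambda>p. G * norm (snd p - l0)) \<longlongrightarrow> G * norm (snd (x0, l0) - l0)) ?F"
    by (intro tendsto_intros)
  then have "((\<lambda>p. G * norm (snd p - l0)) \<longlongrightarrow> 0) ?F" by simp
  moreover have "\<forall>\<^sub>F p in ?F. norm (Phi P (fst p) (snd p) - Phi P (fst p) l0) \<le> G * norm (snd p - l0)"
    unfolding eventually_at_filter by (rule always_eventually) (auto intro: G l0)
  ultimately have 1: "((\<lambda>p. Phi P (fst p) (snd p) - Phi P (fst p) l0) \<longlongrightarrow> 0) ?F"
    by (rule Lim_null_comparison[rotated])
  have "continuous_on (X \<times> Y) (\<lambda>p. Phi P (fst p) l0)"
    by (rule continuous_on_compose2[OF continuous_on_Phi_x[OF l0]]) (auto intro!: continuous_intros)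
  then have 2: "((\<lambda>p. Phi P (fst p) l0) \<longlongrightarrow> Phi P (fst (x0, l0)) l0) ?F"
    using p unfolding continuous_on_def p_eq by blast
  from tendsto_add[OF 1 2] show "((\<lambda>p. Phi P (fst p) (snd p)) \<longlongrightarrow> Phi P (fst p) (snd p)) (at p within X \<times> Y)"
    unfolding p_eq by simp
qed

lemma omega_le_Bomega: assumes "l \<in> Y" shows "\<bar>\<omega> l\<bar> \<le> Bomega P"
proof -
  have "continuous_on Y \<omega>" using dgf_w unfolding dgf_def by simp
  then have "bounded (\<omega> ` Y)"
    by (rule compact_imp_bounded[OF compact_continuous_image[OF _ compact_Y]])
  then obtain b where b: "\<And>l. l \<in> Y \<Longrightarrow> \<bar>\<omega> l\<bar> \<le> b" unfolding bounded_iff by auto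
  have abs_w: "\<bar>dgfL P l\<bar> = ereal \<bar>\<omega> l\<bar>" if l: "l \<in> Y" for l
  proof -
    obtain a where "dgfL P l = ereal a" by (rule edom_realE[OF ccp_w dom_w l])
    then show ?thesis by simp
  qed
  define s where "s = (SUP l\<in>Y. \<bar>dgfL P l\<bar>)"
  have "s \<le> ereal b"
    unfolding s_def by (rule SUP_least) (simp only: abs_w ereal_less_eq b)
  then have "a \<le> real_of_ereal s" if "ereal a \<le> s" for a
    using that by (cases s) auto
  moreover have "ereal \<bar>\<omega> l\<bar> \<le> s"
    unfolding s_def by (rule SUP_upper2[OF assms]) (simp only: abs_w[OF assms] order_refl)
  ultimately show ?thesis unfolding Bomega_def s_def[symmetric] by this
qed

lemma Bomega_nonneg: "0 \<le> Bomega P"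
proof -
  obtain l where "l \<in> Y" using Y_ne by auto
  from order.trans[OF abs_ge_zero omega_le_Bomega[OF this]] show ?thesis .
qed

lemma S_bounded_above: assumes "x \<in> X" shows "\<exists>b. \<forall>l\<in>Y. S x l \<le> b"
proof -
  obtain c where c: "\<And>l. l \<in> Y \<Longrightarrow> c \<le> h l"
    using dgf_bounded_below[OF compact_Y ccp_h dom_h dgf_w] by (elim exE) auto
  have "bounded (Phi P x ` Y)"
    by (rule compact_imp_bounded[OF compact_continuous_image[OF continuous_on_Phi_l[OF assms] compact_Y]])
  then obtain b where b: "\<And>l. l \<in> Y \<Longrightarrow> \<bar>Phi P x l\<bar> \<le> b" unfolding bounded_iff by auto
  have "S x l \<le> f x + g x + b - c" if "l \<in> Y" for l
    using c[OF that] b[OF that] unfolding S_def by linarith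
  then show ?thesis by blast
qed

lemma S_bounded_below: assumes "l \<in> Y" shows "\<exists>b. \<forall>x\<in>X. b \<le> S x l"
proof -
  obtain c where c: "\<And>x. x \<in> X \<Longrightarrow> c \<le> g x"
    using dgf_bounded_below[OF compact_X ccp_g dom_g dgf_wX] by (elim exE) auto
  have "continuous_on X (\<lambda>x. f x + Phi P x l)"
    by (intro continuous_on_add continuous_on_f continuous_on_Phi_x assms)
  then have "bounded ((\<lambda>x. f x + Phi P x l) ` X)"
    by (rule compact_imp_bounded[OF compact_continuous_image[OF _ compact_X]])
  then obtain b where b: "\<And>x. x \<in> X \<Longrightarrow> \<bar>f x + Phi P x l\<bar> \<le> b" unfolding bounded_iff by auto
  have "c - b - h l \<le> S x l" if "x \<in> X" for x
    using c[OF that] b[OF that] unfolding S_def by linarith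
  then show ?thesis by blast
qed

lemma S_le_psiP: "x \<in> X \<Longrightarrow> l \<in> Y \<Longrightarrow> ereal (S x l) \<le> psiP P x"
  unfolding psiP_def by (rule SUP_upper2[of l]) (simp_all add: Sfun_real)

lemma psiD_le_S: "x \<in> X \<Longrightarrow> l \<in> Y \<Longrightarrow> psiD P l \<le> ereal (S x l)"
  unfolding psiD_def by (rule INF_lower2[of x]) (simp_all add: Sfun_real)

lemma psiP_real: assumes "x \<in> X" shows "\<exists>p. psiP P x = ereal p"
proof -
  obtain b where b: "\<And>l. l \<in> Y \<Longrightarrow> S x l \<le> b" using S_bounded_above[OF assms] by blast
  obtain l where l: "l \<in> Y" using Y_ne by auto
  have "psiP P x \<le> ereal b"
    unfolding psiP_def by (rule SUP_least) (simp add: Sfun_real[OF assms] b)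
  then show ?thesis using S_le_psiP[OF assms l] by (cases "psiP P x") auto
qed

lemma psiD_real: assumes "l \<in> Y" shows "\<exists>d. psiD P l = ereal d"
proof -
  obtain b where b: "\<And>x. x \<in> X \<Longrightarrow> b \<le> S x l" using S_bounded_below[OF assms] by blast
  obtain x where x: "x \<in> X" using X_ne by auto
  have "ereal b \<le> psiD P l"
    unfolding psiD_def by (rule INF_greatest) (simp add: Sfun_real[OF _ assms] b)
  then show ?thesis using psiD_le_S[OF x assms] by (cases "psiD P l") auto
qed

text \<open>Both values are finite, so the passage from the extended-valued gap to a real number loses nothing.\<close>

lemma gap_bounds_S_differences:
  assumes "x \<in> X" "l \<in> Y" "x' \<in> X" "l' \<in> Y"
  shows "S x l' \<le> S x' l + real_of_ereal (gap P x l)"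
proof -
  obtain p where p: "psiP P x = ereal p" using psiP_real[OF assms(1)] by (rule exE)
  obtain d where d: "psiD P l = ereal d" using psiD_real[OF assms(2)] by (rule exE)
  show ?thesis
    using S_le_psiP[OF assms(1,4)] psiD_le_S[OF assms(3,2)] unfolding gap_def p d by simp
qed

lemma gap_nonneg: "x \<in> X \<Longrightarrow> l \<in> Y \<Longrightarrow> 0 \<le> real_of_ereal (gap P x l)"
  using gap_bounds_S_differences[of x l x l] by simp

lemma gap_leI:
  assumes x: "x \<in> X" and l: "l \<in> Y"
    and le: "\<And>x' l'. x' \<in> X \<Longrightarrow> l' \<in> Y \<Longrightarrow> S x l' \<le> S x' l + e"
  shows "gap P x l \<le> ereal e"
proof -
  obtain p where p: "psiP P x = ereal p" using psiP_real[OF x] by (rule exE)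
  obtain d where d: "psiD P l = ereal d" using psiD_real[OF l] by (rule exE)
  have "ereal p \<le> ereal (S x' l + e)" if x': "x' \<in> X" for x'
    unfolding p[symmetric] psiP_def
    by (rule SUP_least) (use le[OF x'] in \<open>simp add: Sfun_real[OF x]\<close>)
  then have "ereal (p - e) \<le> psiD P l"
    unfolding psiD_def by (intro INF_greatest) (simp add: Sfun_real[OF _ l] diff_le_eq)
  then show ?thesis unfolding gap_def p d by simp
qed

text \<open>Translates the error of a dual solver run into inequalities at all comparison points.\<close>

lemma psiPrho_error:
  assumes x: "x \<in> X" and lt: "lt \<in> Y" and l': "l' \<in> Y"
    and err: "psiPrho P r x - Srho P r x lt \<le> ereal e"
  shows "S x l' - r * \<omega> l' \<le> S x lt - r * \<omega> lt + e"
proof -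
  have "ereal (S x l' - r * \<omega> l') \<le> psiPrho P r x"
    unfolding psiPrho_def by (rule SUP_upper2[OF l']) (simp add: Srho_real[OF x l'])
  then show ?thesis using err unfolding Srho_real[OF x lt]
    by (cases "psiPrho P r x") auto
qed

lemma psiD_error:
  assumes x: "x \<in> X" "x' \<in> X" and l: "l \<in> Y"
    and err: "Sfun P x l - psiD P l \<le> ereal e"
  shows "S x l \<le> S x' l + e"
proof -
  have "psiD P l \<le> ereal (S x' l)" by (rule psiD_le_S[OF x(2) l])
  then show ?thesis using err unfolding Sfun_real[OF x(1) l]
    by (cases "psiD P l") auto
qed

end

text \<open>The choice of \<open>K\<close> gives \<open>4 A \<le> \<epsilon> K\<^sup>2\<close>, so the first summand contributes at most \<open>\<epsilon> / 2\<close>, and the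
second one at most \<open>\<epsilon> / 2\<close> because \<open>K (K + 3) \<le> (K + 1) (K + 2)\<close>.\<close>

lemma final_gap_numeric:
  fixes A \<epsilon> :: real
  assumes "0 < \<epsilon>" "0 \<le> A" and K: "2 * sqrt A / sqrt \<epsilon> + 1 \<le> real K"
  shows "(2 * A + \<epsilon> * real K * (real K + 3) / 2) / ((real K + 1) * (real K + 2)) \<le> \<epsilon>"
proof -
  have "0 \<le> 2 * sqrt A / sqrt \<epsilon>" using assms by simp
  then have "2 * sqrt A / sqrt \<epsilon> \<le> real K" using K by linarith
  then have "2 * sqrt A \<le> real K * sqrt \<epsilon>" using assms(1) by (simp add: field_simps)
  then have "(2 * sqrt A)\<^sup>2 \<le> (real K * sqrt \<epsilon>)\<^sup>2" by (rule power_mono) (use assms in auto)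
  moreover have "(2 * sqrt A)\<^sup>2 = 4 * A" using assms by (simp add: power_mult_distrib)
  moreover have "(real K * sqrt \<epsilon>)\<^sup>2 = \<epsilon> * (real K * real K)"
    using assms by (simp add: power_mult_distrib) (simp add: power2_eq_square)
  ultimately have "4 * A \<le> \<epsilon> * (real K * real K)" by simp
  moreover have "0 \<le> \<epsilon> * real K" "0 < \<epsilon>" using assms by auto
  moreover define p q where "p = \<epsilon> * (real K * real K)" and "q = \<epsilon> * real K"
  ultimately have "2 * A + p / 2 + 3 * q / 2 \<le> p + 3 * q + 2 * \<epsilon>" by linarith
  then have "2 * A + \<epsilon> * real K * (real K + 3) / 2 \<le> \<epsilon> * ((real K + 1) * (real K + 2))"
    unfolding p_def q_def by (simp add: algebra_simps add_divide_distrib)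
  then show ?thesis by (simp add: pos_divide_le_eq)
qed

section \<open>Measurability of the errors and of the gap\<close>

text \<open>A preimage of the closed epigraph.  Allowing a continuous bound \<open>c\<close> in place of a constant is what
makes sums of a closed function and a continuous one tractable.\<close>

lemma closed_sublevel:
  fixes F :: "'u::real_normed_vector \<Rightarrow> ereal"
  assumes F: "closed_convex_proper F" and U: "closed U" and c: "continuous_on U c"
  shows "closed {x \<in> U. F x \<le> ereal (c x)}"
proof -
  have "closed (U \<inter> (\<lambda>x. (x, c x)) -` eepi F)"
    by (rule continuous_closed_preimage[OF _ U])
       (use F c in \<open>auto intro!: continuous_intros simp: closed_convex_proper_def\<close>)
  also have "U \<inter> (\<lambda>x. (x, c x)) -` eepi F = {x \<in> U. F x \<le> ereal (c x)}"
    unfolding eepi_def by auto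
  finally show ?thesis .
qed

lemma le_MInf_iff_reals: "(y::ereal) \<le> - \<infinity> \<longleftrightarrow> (\<forall>n::nat. y \<le> ereal (- real n))"
proof (cases y)
  case (real r)
  obtain n :: nat where "- r < real n" using reals_Archimedean2 by blast
  then have "\<not> y \<le> ereal (- real n)" using real by simp
  moreover have "\<not> y \<le> - \<infinity>" using real by simp
  ultimately show ?thesis by metis
qed auto

text \<open>Lower semicontinuity on \<open>U\<close> suffices for measurability of the composition with a random variable
that stays in \<open>U\<close>; nothing is known about \<open>p\<close> elsewhere.\<close>

lemma measurable_of_closed_sublevels:
  fixes p :: "'u::topological_space \<Rightarrow> ereal"
  assumes cl: "\<And>r. closed {x \<in> U. p x \<le> ereal r}"
    and z: "z \<in> borel_measurable M" "\<And>w. w \<in> space M \<Longrightarrow> z w \<in> U"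
  shows "(\<lambda>w. p (z w)) \<in> borel_measurable M"
proof -
  have fin: "(\<lambda>w. p (z w)) -` {..ereal r} \<inter> space M \<in> sets M" for r
  proof -
    have "z -` {x \<in> U. p x \<le> ereal r} \<inter> space M \<in> sets M"
      by (rule measurable_sets[OF z(1)]) (use cl in simp)
    also have "z -` {x \<in> U. p x \<le> ereal r} \<inter> space M = (\<lambda>w. p (z w)) -` {..ereal r} \<inter> space M"
      using z(2) by auto
    finally show ?thesis .
  qed
  show ?thesis unfolding borel_measurable_iff_Iic_ereal
  proof
    fix a
    show "(\<lambda>w. p (z w)) -` {..a} \<inter> space M \<in> sets M"
    proof (cases a)
      case (real r) then show ?thesis using fin by simp
    next
      case PInf
      then have "{..a} = UNIV" by auto
      then show ?thesis by simp
    next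
      case MInf
      have "(\<lambda>w. p (z w)) -` {..a} \<inter> space M
          = (\<Inter>n::nat. (\<lambda>w. p (z w)) -` {..ereal (- real n)} \<inter> space M)"
        unfolding MInf using le_MInf_iff_reals by auto
      also have "\<dots> \<in> sets M" by (rule sets.countable_INT) (use fin in auto)
      finally show ?thesis .
    qed
  qed
qed

lemma measurable_closed_convex_proper:
  assumes "closed_convex_proper F" "z \<in> borel_measurable M"
  shows "(\<lambda>w. F (z w)) \<in> borel_measurable M"
  by (rule measurable_of_closed_sublevels[of UNIV, OF _ assms(2)])
     (use closed_sublevel[OF assms(1), of UNIV] in auto)

context bounded_saddle_problem
begin

text \<open>An intersection of sublevel sets, one for each dual point.  As \<open>f\<close> and \<open>\<Phi>\<close> are continuous on \<open>X\<close>,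
everything but \<open>g\<close> can be moved into the bound.\<close>

lemma closed_sublevel_psiPrho: "closed {x \<in> X. psiPrho P r x \<le> ereal a}"
proof -
  have "{x \<in> X. psiPrho P r x \<le> ereal a}
      = (\<Inter>l\<in>Y. {x \<in> X. fun_g P x \<le> ereal (a - f x - Phi P x l + h l + r * \<omega> l)})"
    (is "_ = (\<Inter>l\<in>Y. ?A l)")
  proof -
    have "psiPrho P r x \<le> ereal a \<longleftrightarrow> (\<forall>l\<in>Y. x \<in> ?A l)" if x: "x \<in> X" for x
    proof -
      have "Srho P r x l \<le> ereal a \<longleftrightarrow> x \<in> ?A l" if l: "l \<in> Y" for l
      proof -
        obtain b where b: "fun_g P x = ereal b" by (rule edom_realE[OF ccp_g dom_g x])
        show ?thesis unfolding Srho_real[OF x l] S_def using x by (auto simp: b)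
      qed
      then show ?thesis unfolding psiPrho_def SUP_le_iff by simp
    qed
    then show ?thesis using Y_ne by auto
  qed
  also have "closed \<dots>"
    by (intro closed_INT ballI closed_sublevel ccp_g closed_X continuous_intros
        continuous_on_f continuous_on_Phi_x)
  finally show ?thesis .
qed

lemma closed_superlevel_psiD: "closed {l \<in> Y. - psiD P l \<le> ereal a}"
proof -
  have "{l \<in> Y. - psiD P l \<le> ereal a}
      = (\<Inter>x\<in>X. {l \<in> Y. fun_h P l \<le> ereal (f x + g x + Phi P x l + a)})"
    (is "_ = (\<Inter>x\<in>X. ?A x)")
  proof -
    have "- psiD P l \<le> ereal a \<longleftrightarrow> (\<forall>x\<in>X. l \<in> ?A x)" if l: "l \<in> Y" for l
    proof -
      have "ereal (- a) \<le> Sfun P x l \<longleftrightarrow> l \<in> ?A x" if x: "x \<in> X" for x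
      proof -
        obtain b where b: "fun_h P l = ereal b" by (rule edom_realE[OF ccp_h dom_h l])
        show ?thesis unfolding Sfun_real[OF x l] S_def using l by (auto simp: b)
      qed
      then have "ereal (- a) \<le> psiD P l \<longleftrightarrow> (\<forall>x\<in>X. l \<in> ?A x)"
        unfolding psiD_def le_INF_iff by simp
      moreover have "- psiD P l \<le> ereal a \<longleftrightarrow> ereal (- a) \<le> psiD P l"
        by (cases "psiD P l") auto
      ultimately show ?thesis by simp
    qed
    then show ?thesis using X_ne by auto
  qed
  also have "closed \<dots>"
    by (intro closed_INT ballI closed_sublevel ccp_h closed_Y continuous_intros continuous_on_Phi_l)
  finally show ?thesis .
qed

lemma measurable_psiPrho:
  "z \<in> borel_measurable M \<Longrightarrow> (\<And>w. w \<in> space M \<Longrightarrow> z w \<in> X) \<Longrightarrow>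
    (\<lambda>w. psiPrho P r (z w)) \<in> borel_measurable M"
  by (rule measurable_of_closed_sublevels[OF closed_sublevel_psiPrho])

lemma measurable_psiP:
  assumes "z \<in> borel_measurable M" "\<And>w. w \<in> space M \<Longrightarrow> z w \<in> X"
  shows "(\<lambda>w. psiP P (z w)) \<in> borel_measurable M"
proof -
  have "psiP P x = psiPrho P 0 x" if "x \<in> X" for x
    unfolding psiP_def psiPrho_def
    by (rule SUP_cong) (simp_all add: Sfun_real Srho_real that)
  then show ?thesis
    using measurable_cong[of M "\<lambda>w. psiP P (z w)" "\<lambda>w. psiPrho P 0 (z w)"] measurable_psiPrho[OF assms] assms(2)
    by simp
qed

lemma measurable_psiD:
  assumes "z \<in> borel_measurable M" "\<And>w. w \<in> space M \<Longrightarrow> z w \<in> Y"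
  shows "(\<lambda>w. psiD P (z w)) \<in> borel_measurable M"
proof -
  have "(\<lambda>w. - psiD P (z w)) \<in> borel_measurable M"
    by (rule measurable_of_closed_sublevels[OF closed_superlevel_psiD assms])
  then have "(\<lambda>w. - (- psiD P (z w))) \<in> borel_measurable M"
    by (rule borel_measurable_uminus_ereal)
  then show ?thesis by simp
qed

lemma measurable_Phi:
  assumes "zx \<in> borel_measurable M" "\<And>w. w \<in> space M \<Longrightarrow> zx w \<in> X"
    and "zl \<in> borel_measurable M" "\<And>w. w \<in> space M \<Longrightarrow> zl w \<in> Y"
  shows "(\<lambda>w. Phi P (zx w) (zl w)) \<in> borel_measurable M"
proof -
  have "X \<times> Y \<in> sets borel" by (intro borel_closed closed_Times closed_X closed_Y)
  from borel_measurable_continuous_on_indicator[OF this continuous_on_Phi]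
  have "(\<lambda>p. indicator (X \<times> Y) p *\<^sub>R Phi P (fst p) (snd p)) \<in> borel_measurable borel" .
  from measurable_compose[OF borel_measurable_Pair[OF assms(1,3)] this]
  show ?thesis
    by (rule measurable_cong[THEN iffD1, rotated]) (use assms in simp)
qed

lemma measurable_Sfun:
  assumes "zx \<in> borel_measurable M" "\<And>w. w \<in> space M \<Longrightarrow> zx w \<in> X"
    and "zl \<in> borel_measurable M" "\<And>w. w \<in> space M \<Longrightarrow> zl w \<in> Y"
  shows "(\<lambda>w. Sfun P (zx w) (zl w)) \<in> borel_measurable M"
  unfolding Sfun_def
  by (intro borel_measurable_ereal_add borel_measurable_ereal_diff borel_measurable_ereal measurable_Phi
      measurable_closed_convex_proper ccp_f ccp_g ccp_h assms)

lemma measurable_Srho: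
  assumes "zx \<in> borel_measurable M" "\<And>w. w \<in> space M \<Longrightarrow> zx w \<in> X"
    and "zl \<in> borel_measurable M" "\<And>w. w \<in> space M \<Longrightarrow> zl w \<in> Y"
  shows "(\<lambda>w. Srho P r (zx w) (zl w)) \<in> borel_measurable M"
  unfolding Srho_def
  by (intro borel_measurable_ereal_diff borel_measurable_ereal_times measurable_Sfun
      measurable_closed_convex_proper ccp_w assms borel_measurable_const)

end

section \<open>From conditional expectations to probabilities\<close>

lemma subalgebra_adjoin:
  assumes "subalgebra M F" "Z \<in> borel_measurable M"
  shows "subalgebra M (adjoin F Z)"
proof -
  let ?G = "sets F \<union> {Z -` A \<inter> space F | A. A \<in> sets borel}"
  have sp: "space F = space M" and F: "sets F \<subseteq> sets M" using assms(1) unfolding subalgebra_def by auto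
  have pow: "?G \<subseteq> Pow (space F)" using sets.space_closed by auto
  have "?G \<subseteq> sets M" using F measurable_sets[OF assms(2)] unfolding sp by auto
  then have "sigma_sets (space M) ?G \<subseteq> sets M" by (rule sets.sigma_sets_subset)
  then show ?thesis unfolding subalgebra_def adjoin_def using pow sp by (simp add: sets_measure_of)
qed

text \<open>The conditional expectation has the same integral as the error itself, so the bound passes to the
unconditional expectation.  Measurability of \<open>err\<close> is essential: \<open>nn_cond_exp\<close> is zero, and the
premise \<open>le\<close> void, for a function that is not measurable.\<close>

lemma markov_nn_cond_exp:
  assumes "prob_space M" and sub: "subalgebra M F" and err: "err \<in> borel_measurable M"
    and le: "AE w in M. nn_cond_exp M F (\<lambda>w. e2ennreal (err w)) w \<le> ennreal e"
    and pos: "0 \<le> e" "0 < \<eta>"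
  shows "measure M {w \<in> space M. ereal \<eta> < err w} \<le> e / \<eta>"
proof -
  interpret prob_space M by fact
  interpret finite_measure_subalgebra M F by unfold_locales (rule sub)
  define u where "u = (\<lambda>w. e2ennreal (err w))"
  have u: "u \<in> borel_measurable M" unfolding u_def using err by simp
  have "(\<integral>\<^sup>+ w. u w \<partial>M) = (\<integral>\<^sup>+ w. nn_cond_exp M F u w \<partial>M)"
    using nn_cond_exp_intg[of "\<lambda>_. 1" u] u by simp
  also have "\<dots> \<le> (\<integral>\<^sup>+ w. ennreal e \<partial>M)"
    by (rule nn_integral_mono_AE) (use le in \<open>simp add: u_def\<close>)
  also have "\<dots> = ennreal e" by (simp add: emeasure_space_1)
  finally have int: "(\<integral>\<^sup>+ w. u w \<partial>M) \<le> ennreal e" .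
  have "{w \<in> space M. ereal \<eta> < err w} \<subseteq> {w \<in> space M. 1 \<le> ennreal (1 / \<eta>) * u w}"
  proof clarify
    fix w assume "ereal \<eta> < err w"
    then have "ennreal \<eta> \<le> u w" unfolding u_def using e2ennreal_mono[of "ereal \<eta>" "err w"] by simp
    then have "ennreal (1 / \<eta>) * ennreal \<eta> \<le> ennreal (1 / \<eta>) * u w" by (rule mult_left_mono) simp
    then show "1 \<le> ennreal (1 / \<eta>) * u w" using pos by (simp add: ennreal_mult[symmetric])
  qed
  then have "emeasure M {w \<in> space M. ereal \<eta> < err w} \<le> emeasure M {w \<in> space M. 1 \<le> ennreal (1 / \<eta>) * u w}"
    by (rule emeasure_mono) (use u in measurable)
  also have "\<dots> \<le> ennreal (1 / \<eta>) * (\<integral>\<^sup>+ w. u w * indicator (space M) w \<partial>M)"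
    by (rule nn_integral_Markov_inequality) (use u in simp_all)
  also have "(\<integral>\<^sup>+ w. u w * indicator (space M) w \<partial>M) = (\<integral>\<^sup>+ w. u w \<partial>M)"
    by (rule nn_integral_cong) simp
  also have "ennreal (1 / \<eta>) * (\<integral>\<^sup>+ w. u w \<partial>M) \<le> ennreal (1 / \<eta>) * ennreal e"
    by (rule mult_left_mono[OF int]) simp
  also have "\<dots> = ennreal (e / \<eta>)" using pos by (simp add: ennreal_mult[symmetric])
  finally show ?thesis using pos by (simp add: emeasure_eq_measure)
qed

section \<open>The gap of a run\<close>

lemma num_iters_pos: "1 \<le> num_iters P \<epsilon> x0 l0"
  unfolding num_iters_def by simp

locale ipds_run = bounded_saddle_problem P
  for P :: "('a::finite_dim_normed, 'b::finite_dim_normed) spp" +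
  fixes M :: "'w measure" and c \<epsilon> \<delta> :: real and x0 :: 'a and l0 :: 'b and E :: "('w, 'a, 'b) exec"
  assumes exec: "ipds_exec M c P \<epsilon> \<delta> x0 l0 E"
    and x0: "x0 \<in> X" and l0: "l0 \<in> Y" and eps: "0 < \<epsilon>" and delta: "0 < \<delta>"
begin

abbreviation "K \<equiv> num_iters P \<epsilon> x0 l0"

definition tol :: "nat \<Rightarrow> real" where "tol k = accuracy \<epsilon> k * \<delta> / (3 * real K)"

definition err1 where
  "err1 k w = psiPrho P (rho P k) (iterx E k w) - Srho P (rho P k) (iterx E k w) (outl1 E k w)"
definition err2 where
  "err2 k w = Sfun P (outx E k w) (hatl E k w) - psiD P (hatl E k w)"
definition err3 where
  "err3 k w = psiPrho P (rho P (Suc k)) (iterx E (Suc k) w)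
     - Srho P (rho P (Suc k)) (iterx E (Suc k) w) (outl2 E k w)"

lemma prob: "prob_space M"
  and start: "w \<in> space M \<Longrightarrow> iterx E 0 w = x0" "w \<in> space M \<Longrightarrow> iterl E 0 w = l0"
  using exec unfolding ipds_exec_def by auto

lemma exec_step:
  assumes "k < K"
  shows run1: "rpd_run M (filt0 M E k) c (ncomp P) (const_Lll P) (rho P k)
        (bregman_diam Y (dgfL P) (startL P)) (tol k) Y (err1 k) (outl1 E k) (reql1 E k)"
    and run2: "rpd_run M (filt1 M E k) c (ncomp P) (const_L P + const_Lxx P) (const_mu P)
        (bregman_diam X (dgfX P) (startX P)) (tol k) X (err2 k) (outx E k) (reqx E k)"
    and run3: "rpd_run M (filt2 M E k) c (ncomp P) (const_Lll P) (rho P (Suc k))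
        (bregman_diam Y (dgfL P) (startL P)) (tol k) Y (err3 k) (outl2 E k) (reql2 E k)"
    and x_Suc: "w \<in> space M \<Longrightarrow> iterx E (Suc k) w = tau k *\<^sub>R iterx E k w + (1 - tau k) *\<^sub>R outx E k w"
    and l_Suc: "w \<in> space M \<Longrightarrow> iterl E (Suc k) w = tau k *\<^sub>R iterl E k w + (1 - tau k) *\<^sub>R outl2 E k w"
  using exec assms unfolding ipds_exec_def Let_def tol_def err1_def[abs_def] err2_def[abs_def] err3_def[abs_def]
  by simp_all

lemma outputs:
  assumes "k < K"
  shows "outl1 E k \<in> borel_measurable M" "outx E k \<in> borel_measurable M" "outl2 E k \<in> borel_measurable M"
    and "w \<in> space M \<Longrightarrow> outl1 E k w \<in> Y" "w \<in> space M \<Longrightarrow> outx E k w \<in> X"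
    and "w \<in> space M \<Longrightarrow> outl2 E k w \<in> Y"
  using run1[OF assms] run2[OF assms] run3[OF assms] unfolding rpd_run_def by simp_all

lemma tau_range: "0 < tau k" "tau k < 1" unfolding tau_def by auto

lemma iterates:
  "k \<le> K \<Longrightarrow> iterx E k \<in> borel_measurable M \<and> iterl E k \<in> borel_measurable M \<and>
    (\<forall>w\<in>space M. iterx E k w \<in> X \<and> iterl E k w \<in> Y)"
proof (induction k)
  case 0
  have "iterx E 0 \<in> borel_measurable M"
    by (rule measurable_cong[THEN iffD2, OF start(1)]) auto
  moreover have "iterl E 0 \<in> borel_measurable M"
    by (rule measurable_cong[THEN iffD2, OF start(2)]) auto
  ultimately show ?case using start x0 l0 by simp
next
  case (Suc k)
  then have k: "k < K" and IH: "iterx E k \<in> borel_measurable M" "iterl E k \<in> borel_measurable M"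
    "\<And>w. w \<in> space M \<Longrightarrow> iterx E k w \<in> X" "\<And>w. w \<in> space M \<Longrightarrow> iterl E k w \<in> Y" by auto
  have "iterx E (Suc k) \<in> borel_measurable M"
    by (rule measurable_cong[THEN iffD2, OF x_Suc[OF k]])
       (auto intro!: borel_measurable_add borel_measurable_scaleR IH outputs[OF k])
  moreover have "iterl E (Suc k) \<in> borel_measurable M"
    by (rule measurable_cong[THEN iffD2, OF l_Suc[OF k]])
       (auto intro!: borel_measurable_add borel_measurable_scaleR IH outputs[OF k])
  moreover have "iterx E (Suc k) w \<in> X" if w: "w \<in> space M" for w
    unfolding x_Suc[OF k w]
    by (rule convexD[OF convex_X IH(3)[OF w] outputs(5)[OF k w]]) (use tau_range[of k] in auto)
  moreover have "iterl E (Suc k) w \<in> Y" if w: "w \<in> space M" for w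
    unfolding l_Suc[OF k w]
    by (rule convexD[OF convex_Y IH(4)[OF w] outputs(6)[OF k w]]) (use tau_range[of k] in auto)
  ultimately show ?case by simp
qed

lemma hatl:
  assumes k: "k < K"
  shows "hatl E k \<in> borel_measurable M" "w \<in> space M \<Longrightarrow> hatl E k w \<in> Y"
proof -
  have I: "iterl E k \<in> borel_measurable M" "\<And>w. w \<in> space M \<Longrightarrow> iterl E k w \<in> Y"
    using iterates[of k] k by auto
  show "hatl E k \<in> borel_measurable M"
    unfolding hatl_def[abs_def]
    by (intro borel_measurable_add borel_measurable_scaleR I outputs[OF k] borel_measurable_const)
  show "hatl E k w \<in> Y" if w: "w \<in> space M"
    unfolding hatl_def
    by (rule convexD[OF convex_Y I(2)[OF w] outputs(4)[OF k w]]) (use tau_range[of k] in auto)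
qed

lemma measurable_errors:
  assumes k: "k < K"
  shows "err1 k \<in> borel_measurable M" "err2 k \<in> borel_measurable M" "err3 k \<in> borel_measurable M"
proof -
  have I: "iterx E j \<in> borel_measurable M" "\<And>w. w \<in> space M \<Longrightarrow> iterx E j w \<in> X" if "j \<le> K" for j
    using iterates[OF that] by auto
  have k': "k \<le> K" "Suc k \<le> K" using k by auto
  show "err1 k \<in> borel_measurable M"
    unfolding err1_def[abs_def]
    by (intro borel_measurable_ereal_diff measurable_psiPrho measurable_Srho I[OF k'(1)] outputs[OF k])
  show "err2 k \<in> borel_measurable M"
    unfolding err2_def[abs_def]
    by (intro borel_measurable_ereal_diff measurable_psiD measurable_Sfun hatl[OF k] outputs[OF k])
  show "err3 k \<in> borel_measurable M"
    unfolding err3_def[abs_def]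
    by (intro borel_measurable_ereal_diff measurable_psiPrho measurable_Srho I[OF k'(2)] outputs[OF k])
qed

lemma filtration:
  "k \<le> K \<Longrightarrow> subalgebra M (filt0 M E k)"
proof (induction k)
  case 0
  have "sigma_sets (space M) {} \<subseteq> sets M" by (rule sets.sigma_sets_subset) simp
  then show ?case unfolding subalgebra_def by (simp add: sets_measure_of)
next
  case (Suc k)
  then show ?case by (simp add: subalgebra_adjoin outputs)
qed

lemma filtration1: "k < K \<Longrightarrow> subalgebra M (filt1 M E k)"
  unfolding filt1_def by (intro subalgebra_adjoin filtration outputs) simp_all

lemma filtration2: "k < K \<Longrightarrow> subalgebra M (filt2 M E k)"
  unfolding filt2_def by (intro subalgebra_adjoin filtration1 outputs)

lemma accuracy_pos: "0 < accuracy \<epsilon> k"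
  unfolding accuracy_def using eps by simp

text \<open>One of the three runs of iteration \<open>k\<close> misses the accuracy that the recursion tolerates.\<close>

definition bad :: "nat \<Rightarrow> 'w set" where
  "bad k = {w \<in> space M. ereal (accuracy \<epsilon> k) < err1 k w}
     \<union> {w \<in> space M. ereal (accuracy \<epsilon> k) < err2 k w}
     \<union> {w \<in> space M. ereal (accuracy \<epsilon> k) < err3 k w}"

lemma bad_sets: assumes k: "k < K" shows "bad k \<in> sets M"
  unfolding bad_def using measurable_errors[OF k] by measurable

lemma measure_bad: assumes k: "k < K" shows "measure M (bad k) \<le> \<delta> / real K"
proof -
  interpret prob_space M by (rule prob)
  note [measurable] = measurable_errors[OF k]
  have tol: "0 \<le> tol k" "tol k / accuracy \<epsilon> k = \<delta> / (3 * real K)"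
    unfolding tol_def using accuracy_pos[of k] delta by auto
  have 1: "measure M {w \<in> space M. ereal (accuracy \<epsilon> k) < err1 k w} \<le> \<delta> / (3 * real K)"
    unfolding tol(2)[symmetric]
    by (rule markov_nn_cond_exp[OF prob filtration[OF less_imp_le[OF k]] _ _ tol(1) accuracy_pos])
       (use run1[OF k] k in \<open>auto simp: rpd_run_def\<close>)
  have 2: "measure M {w \<in> space M. ereal (accuracy \<epsilon> k) < err2 k w} \<le> \<delta> / (3 * real K)"
    unfolding tol(2)[symmetric]
    by (rule markov_nn_cond_exp[OF prob filtration1[OF k] _ _ tol(1) accuracy_pos])
       (use run2[OF k] in \<open>auto simp: rpd_run_def\<close>)
  have 3: "measure M {w \<in> space M. ereal (accuracy \<epsilon> k) < err3 k w} \<le> \<delta> / (3 * real K)"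
    unfolding tol(2)[symmetric]
    by (rule markov_nn_cond_exp[OF prob filtration2[OF k] _ _ tol(1) accuracy_pos])
       (use run3[OF k] in \<open>auto simp: rpd_run_def\<close>)
  have "measure M (bad k) \<le> measure M ({w \<in> space M. ereal (accuracy \<epsilon> k) < err1 k w}
      \<union> {w \<in> space M. ereal (accuracy \<epsilon> k) < err2 k w})
      + measure M {w \<in> space M. ereal (accuracy \<epsilon> k) < err3 k w}"
    unfolding bad_def by (rule measure_Un_le) measurable
  also have "measure M ({w \<in> space M. ereal (accuracy \<epsilon> k) < err1 k w}
      \<union> {w \<in> space M. ereal (accuracy \<epsilon> k) < err2 k w})
      \<le> measure M {w \<in> space M. ereal (accuracy \<epsilon> k) < err1 k w}
        + measure M {w \<in> space M. ereal (accuracy \<epsilon> k) < err2 k w}"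
    by (rule measure_Un_le) measurable
  finally have "measure M (bad k) \<le> 3 * (\<delta> / (3 * real K))" using 1 2 3 by linarith
  then show ?thesis by simp
qed

text \<open>Along a sample point where every run is accurate the iteration is deterministic, and the two
sources of error add up: the excessive gap and the bias \<open>\<rho>\<^sub>K B\<close> of the smoothing.  Together they are
governed by \<open>A = \<Delta> + 16 L\<^sub>D B\<close>, the quantity in the definition of the number of iterations.\<close>

lemma gap_on_good_event:
  assumes w: "w \<in> space M" and good: "\<And>k. k < K \<Longrightarrow> w \<notin> bad k"
  shows "gap P (iterx E K w) (iterl E K w) \<le> ereal \<epsilon>"
proof -
  define D where "D = real_of_ereal (gap P x0 l0)"
  define A where "A = D + 16 * LD P * Bomega P"
  have I: "iterx E j w \<in> X" "iterl E j w \<in> Y" if "j \<le> K" for j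
    using iterates[OF that] w by auto
  have small: "err1 k w \<le> ereal (accuracy \<epsilon> k)" "err2 k w \<le> ereal (accuracy \<epsilon> k)"
    "err3 k w \<le> ereal (accuracy \<epsilon> k)" if "k < K" for k
    using good[OF that] w unfolding bad_def by (auto simp: not_less)
  have traj: "\<forall>x'\<in>X. \<forall>l'\<in>Y. S (iterx E K w) l' - rho P K * \<omega> l' \<le> S x' (iterl E K w)
      + (2 * (D + 8 * LD P * Bomega P) + \<epsilon> * real K * (real K + 3) / 2) / ((real K + 1) * (real K + 2))"
  proof (rule excessive_gap_trajectory[where xs = "\<lambda>k. iterx E k w" and ls = "\<lambda>k. iterl E k w"
        and ?l1.0 = "\<lambda>k. outl1 E k w" and xo = "\<lambda>k. outx E k w" and ?l2.0 = "\<lambda>k. outl2 E k w" and K = K,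
        THEN conjunct2, THEN conjunct2])
    show "0 < \<epsilon>" by (rule eps)
    show "iterx E 0 w \<in> X" "iterl E 0 w \<in> Y" using I by simp_all
    show "S (iterx E 0 w) l' \<le> S x' (iterl E 0 w) + D" if "x' \<in> X" "l' \<in> Y" for x' l'
      unfolding start[OF w] D_def by (rule gap_bounds_S_differences[OF x0 l0 that])
    show "\<bar>\<omega> l\<bar> \<le> Bomega P" if "l \<in> Y" for l by (rule omega_le_Bomega[OF that])
    show "outl1 E k w \<in> Y" "outx E k w \<in> X" "outl2 E k w \<in> Y" if "k < K" for k
      using outputs(4-6)[OF that w] by auto
    show "iterx E (Suc k) w = tau k *\<^sub>R iterx E k w + (1 - tau k) *\<^sub>R outx E k w" if "k < K" for k
      by (rule x_Suc[OF that w])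
    show "iterl E (Suc k) w = tau k *\<^sub>R iterl E k w + (1 - tau k) *\<^sub>R outl2 E k w" if "k < K" for k
      by (rule l_Suc[OF that w])
    show "S (iterx E k w) l' - rho P k * \<omega> l'
        \<le> S (iterx E k w) (outl1 E k w) - rho P k * \<omega> (outl1 E k w) + accuracy \<epsilon> k"
      if k: "k < K" and l': "l' \<in> Y" for k l'
      by (rule psiPrho_error[OF I(1) outputs(4)[OF k w] l' small(1)[OF k, unfolded err1_def]]) (use k in simp)
    show "S (outx E k w) (tau k *\<^sub>R iterl E k w + (1 - tau k) *\<^sub>R outl1 E k w)
        \<le> S x' (tau k *\<^sub>R iterl E k w + (1 - tau k) *\<^sub>R outl1 E k w) + accuracy \<epsilon> k"
      if k: "k < K" and x': "x' \<in> X" for k x'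
      using psiD_error[OF outputs(5)[OF k w] x' hatl(2)[OF k w] small(2)[OF k, unfolded err2_def]]
      unfolding hatl_def .
    show "S (iterx E (Suc k) w) l' - rho P (Suc k) * \<omega> l'
        \<le> S (iterx E (Suc k) w) (outl2 E k w) - rho P (Suc k) * \<omega> (outl2 E k w) + accuracy \<epsilon> k"
      if k: "k < K" and l': "l' \<in> Y" for k l'
      by (rule psiPrho_error[OF I(1) outputs(6)[OF k w] l' small(3)[OF k, unfolded err3_def]]) (use k in simp)
    show "K \<le> K" by simp
  qed
  show ?thesis
  proof (rule gap_leI[OF I[OF order_refl]])
    fix x' l' assume x': "x' \<in> X" and l': "l' \<in> Y"
    have rho_nonneg: "0 \<le> rho P K" unfolding rho_eq using LD_pos by simp
    have "rho P K * \<omega> l' \<le> rho P K * Bomega P"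
      by (rule mult_left_mono[OF abs_le_D1[OF omega_le_Bomega[OF l']] rho_nonneg])
    also have "\<dots> = (16 * LD P * Bomega P) / ((real K + 1) * (real K + 2))"
      unfolding rho_eq by simp
    finally have "S (iterx E K w) l' \<le> S x' (iterl E K w)
      + ((16 * LD P * Bomega P) / ((real K + 1) * (real K + 2))
      + (2 * (D + 8 * LD P * Bomega P) + \<epsilon> * real K * (real K + 3) / 2) / ((real K + 1) * (real K + 2)))"
      using bspec[OF bspec[OF traj x'] l'] by linarith
    also have "(16 * LD P * Bomega P) / ((real K + 1) * (real K + 2))
      + (2 * (D + 8 * LD P * Bomega P) + \<epsilon> * real K * (real K + 3) / 2) / ((real K + 1) * (real K + 2))
      = (2 * A + \<epsilon> * real K * (real K + 3) / 2) / ((real K + 1) * (real K + 2))"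
      unfolding add_divide_distrib[symmetric] A_def by (simp add: distrib_left add.commute add.left_commute)
    also have "\<dots> \<le> \<epsilon>"
    proof (rule final_gap_numeric[OF eps])
      show "0 \<le> A"
        unfolding A_def D_def using gap_nonneg[OF x0 l0] Bomega_nonneg LD_pos by simp
      show "2 * sqrt A / sqrt \<epsilon> + 1 \<le> real K"
        unfolding num_iters_def A_def D_def by (simp add: add.commute) linarith
    qed
    finally show "S (iterx E K w) l' \<le> S x' (iterl E K w) + \<epsilon>" by simp
  qed
qed

lemma gap_high_probability:
  "1 - \<delta> \<le> measure M {w \<in> space M. gap P (iterx E K w) (iterl E K w) \<le> ereal \<epsilon>}"
proof -
  interpret prob_space M by (rule prob)
  let ?B = "\<Union>k<K. bad k"
  let ?G = "{w \<in> space M. gap P (iterx E K w) (iterl E K w) \<le> ereal \<epsilon>}"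
  have I: "iterx E K \<in> borel_measurable M" "iterl E K \<in> borel_measurable M"
    "\<And>w. w \<in> space M \<Longrightarrow> iterx E K w \<in> X" "\<And>w. w \<in> space M \<Longrightarrow> iterl E K w \<in> Y"
    using iterates[OF order_refl] by auto
  have [measurable]: "(\<lambda>w. gap P (iterx E K w) (iterl E K w)) \<in> borel_measurable M"
    unfolding gap_def by (intro borel_measurable_ereal_diff measurable_psiP measurable_psiD I)
  have G: "?G \<in> sets M" by measurable
  have B: "?B \<in> sets M" by (intro sets.finite_UN) (auto intro: bad_sets)
  have "measure M ?B \<le> (\<Sum>k<K. measure M (bad k))"
    by (rule finite_measure_subadditive_finite) (auto intro: bad_sets)
  also have "\<dots> \<le> (\<Sum>k<K. \<delta> / real K)" by (rule sum_mono) (simp add: measure_bad)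
  also have "\<dots> = \<delta>" using num_iters_pos[of P \<epsilon> x0 l0] by simp
  finally have "1 - \<delta> \<le> measure M (space M - ?B)" using prob_compl[OF B] by simp
  also have "\<dots> \<le> measure M ?G"
    by (rule finite_measure_mono[OF _ G]) (auto intro: gap_on_good_event)
  finally show ?thesis .
qed

end

section \<open>Counting oracle calls\<close>

text \<open>\<open>Z\<close> bounds the absolute value because the Bregman diameter \<open>D\<close> is an arbitrary real number here; this
suffices since the real \<open>ln\<close> is an even function with value \<open>0\<close> at \<open>0\<close>.  Rounding up costs at most
\<open>1 \<le> N \<Lambda>\<close>.\<close>

lemma rpd_iters_le:
  assumes "1 \<le> m" and N: "real m + sqrt (8 * real m * (L / \<mu>)) \<le> N"
    and q: "0 \<le> L / \<mu>"
    and Z: "\<bar>2 * (L / sqrt \<mu> + sqrt \<mu>)\<^sup>2 * (real m + sqrt (8 * real m * (L / \<mu>))) * D / e\<bar> \<le> Z"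
    and lnZ: "ln Z \<le> p * \<Lambda>" and p: "0 \<le> p" "1 \<le> \<Lambda>"
  shows "real (rpd_iters m L \<mu> D e) \<le> (2 * p + 1) * (N * \<Lambda>)"
proof -
  define N0 where "N0 = real m + sqrt (8 * real m * (L / \<mu>))"
  define a where "a = 2 * (L / sqrt \<mu> + sqrt \<mu>)\<^sup>2 * N0 * D / e"
  have "0 \<le> sqrt (8 * real m * (L / \<mu>))" by (intro real_sqrt_ge_zero mult_nonneg_nonneg q) auto
  then have N0: "1 \<le> N0" "N0 \<le> N" using assms(1) N unfolding N0_def by linarith+
  have "ln a \<le> p * \<Lambda>"
  proof (cases "a = 0")
    case True
    then show ?thesis using p by simp
  next
    case False
    have "ln a = ln \<bar>a\<bar>" by (cases "0 \<le> a") (auto simp: ln_minus)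
    also have "\<dots> \<le> ln Z"
      by (rule ln_mono) (use False Z[folded N0_def, folded a_def] in auto)
    finally show ?thesis using lnZ by simp
  qed
  then have "2 * N0 * ln a \<le> 2 * N0 * (p * \<Lambda>)" using N0 by (intro mult_left_mono) auto
  also have "\<dots> \<le> 2 * N * (p * \<Lambda>)" using N0 p by (intro mult_right_mono) auto
  finally have "2 * N0 * ln a \<le> 2 * p * (N * \<Lambda>)" by (simp add: mult_ac)
  moreover have one: "1 \<le> N * \<Lambda>"
    using mult_mono[of 1 N 1 \<Lambda>] N0 p by simp
  ultimately have le: "2 * N0 * ln a + 1 \<le> (2 * p + 1) * (N * \<Lambda>)" by (simp add: distrib_right)
  have nat_le: "real (nat z) \<le> r" if "real_of_int z \<le> r" "0 \<le> r" for z r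
    using that by (cases "0 \<le> z") auto
  have "rpd_iters m L \<mu> D e = nat \<lceil>2 * N0 * ln a\<rceil>"
    unfolding rpd_iters_def a_def N0_def by simp
  moreover have "real_of_int \<lceil>2 * N0 * ln a\<rceil> \<le> (2 * p + 1) * (N * \<Lambda>)" using le by linarith
  moreover have "0 \<le> (2 * p + 1) * (N * \<Lambda>)" using p one by simp
  ultimately show ?thesis using nat_le by simp
qed

text \<open>For small \<open>\<epsilon>\<close> the number \<open>Q / (\<epsilon>\<^sup>p \<delta>)\<close> is at most \<open>(G / (\<epsilon> \<delta>))\<^sup>p\<^sup>+\<^sup>1\<close>, since the quotient of the two is
\<open>Q \<epsilon> \<delta>\<^sup>p / G\<^sup>p\<^sup>+\<^sup>1\<close>.  The threshold depends on neither \<open>\<delta>\<close> nor the run.\<close>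

lemma logarithm_absorbs_power:
  assumes G: "0 < (G::real)" and Q: "0 < Q"
  shows "\<exists>\<epsilon>0>0. \<forall>\<epsilon> \<delta>. 0 < \<epsilon> \<and> \<epsilon> < \<epsilon>0 \<and> 0 < \<delta> \<and> \<delta> < 1 \<longrightarrow>
    1 \<le> ln (G / (\<epsilon> * \<delta>)) \<and> ln (Q / (\<epsilon> ^ p * \<delta>)) \<le> real (p + 1) * ln (G / (\<epsilon> * \<delta>))"
proof -
  define \<epsilon>0 where "\<epsilon>0 = min (G / exp 1) (G ^ (p + 1) / Q)"
  have "1 \<le> ln (G / (\<epsilon> * \<delta>)) \<and> ln (Q / (\<epsilon> ^ p * \<delta>)) \<le> real (p + 1) * ln (G / (\<epsilon> * \<delta>))"
    if "0 < \<epsilon>" "\<epsilon> < \<epsilon>0" "0 < \<delta>" "\<delta> < 1" for \<epsilon> \<delta>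
  proof
    have G1: "exp 1 * \<epsilon> \<le> G" and G2: "Q * \<epsilon> \<le> G ^ (p + 1)"
      using that Q unfolding \<epsilon>0_def by (auto simp: field_simps)
    have "exp 1 * (\<epsilon> * \<delta>) \<le> exp 1 * \<epsilon>" using that by simp
    from order.trans[OF this G1] have "exp 1 \<le> G / (\<epsilon> * \<delta>)" using that by (simp add: pos_le_divide_eq)
    then have "ln (exp 1) \<le> ln (G / (\<epsilon> * \<delta>))" by (intro ln_mono) auto
    then show "1 \<le> ln (G / (\<epsilon> * \<delta>))" by simp
    have "Q / (\<epsilon> ^ p * \<delta>) = Q * \<epsilon> / (\<epsilon> ^ (p + 1) * \<delta>)" using that by simp
    also have "\<dots> \<le> G ^ (p + 1) / (\<epsilon> ^ (p + 1) * \<delta>)"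
      using G2 that by (intro divide_right_mono) auto
    also have "\<dots> \<le> G ^ (p + 1) / (\<epsilon> ^ (p + 1) * \<delta> ^ (p + 1))"
      using G that power_decreasing[of 1 "p + 1" \<delta>] by (intro divide_left_mono mult_left_mono) auto
    also have "\<dots> = (G / (\<epsilon> * \<delta>)) ^ (p + 1)" by (simp only: power_divide power_mult_distrib)
    finally have "ln (Q / (\<epsilon> ^ p * \<delta>)) \<le> ln ((G / (\<epsilon> * \<delta>)) ^ (p + 1))"
      using Q that by (intro ln_mono) auto
    also have "\<dots> = real (p + 1) * ln (G / (\<epsilon> * \<delta>))"
      by (rule ln_realpow)
    finally show "ln (Q / (\<epsilon> ^ p * \<delta>)) \<le> real (p + 1) * ln (G / (\<epsilon> * \<delta>))" .
  qed
  moreover have "0 < \<epsilon>0" using G Q unfolding \<epsilon>0_def by simp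
  ultimately show ?thesis by blast
qed

text \<open>The tolerance is of order \<open>\<epsilon> \<delta> / (k K)\<close>, and \<open>K\<^sup>2\<close> is of order \<open>1 / \<epsilon>\<close>.\<close>

lemma solver_tolerance_bound:
  assumes "k < K" and K: "real K \<le> q * sqrt (LDv / \<epsilon>)" and pos: "0 < \<epsilon>" "0 < \<delta>" "0 < LDv" "0 < q"
  shows "\<bar>D\<bar> / (accuracy \<epsilon> k * \<delta> / (3 * real K)) \<le> 36 * \<bar>D\<bar> * q\<^sup>2 * LDv / (\<epsilon>\<^sup>2 * \<delta>)"
proof -
  have k: "real k + 3 \<le> 3 * real K" using assms(1) by simp
  have K2: "real K * real K \<le> q\<^sup>2 * LDv / \<epsilon>"
  proof -
    have "real K * real K \<le> (q * sqrt (LDv / \<epsilon>)) * (q * sqrt (LDv / \<epsilon>))"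
      by (rule mult_mono[OF K K]) (use pos in auto)
    also have "\<dots> = q\<^sup>2 * (sqrt (LDv / \<epsilon>) * sqrt (LDv / \<epsilon>))" by (simp add: power2_eq_square mult_ac)
    also have "sqrt (LDv / \<epsilon>) * sqrt (LDv / \<epsilon>) = LDv / \<epsilon>"
      using pos by (intro real_sqrt_mult_self[THEN trans]) simp
    finally show ?thesis by simp
  qed
  have "\<bar>D\<bar> / (accuracy \<epsilon> k * \<delta> / (3 * real K)) = 12 * \<bar>D\<bar> / (\<epsilon> * \<delta>) * ((real k + 3) * real K)"
    unfolding accuracy_def by (simp add: field_simps)
  also have "\<dots> \<le> 12 * \<bar>D\<bar> / (\<epsilon> * \<delta>) * (3 * (real K * real K))"
  proof (rule mult_left_mono)
    show "(real k + 3) * real K \<le> 3 * (real K * real K)"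
      using mult_right_mono[OF k, of "real K"] by simp
    show "0 \<le> 12 * \<bar>D\<bar> / (\<epsilon> * \<delta>)" using pos by simp
  qed
  also have "\<dots> \<le> 12 * \<bar>D\<bar> / (\<epsilon> * \<delta>) * (3 * (q\<^sup>2 * LDv / \<epsilon>))"
    using K2 pos by (intro mult_left_mono) auto
  also have "\<dots> = 36 * \<bar>D\<bar> * q\<^sup>2 * LDv / (\<epsilon>\<^sup>2 * \<delta>)" by (simp add: power2_eq_square field_simps)
  finally show ?thesis .
qed

context bounded_saddle_problem
begin

text \<open>The constant in \<open>K = O(\<surd>(L\<^sub>D / \<epsilon>))\<close>; it depends only on \<open>B\<close> and on \<open>\<Delta> / L\<^sub>D\<close>, the two arguments
that the constant of the complexity theorem may have.\<close>

definition iters_factor :: "'a \<Rightarrow> 'b \<Rightarrow> real" where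
  "iters_factor x0 l0 = 2 * sqrt (16 * Bomega P + real_of_ereal (gap P x0 l0) / LD P) + 2"

lemma iters_factor_ge_2:
  assumes "x0 \<in> X" "l0 \<in> Y" shows "2 \<le> iters_factor x0 l0"
  unfolding iters_factor_def using gap_nonneg[OF assms] Bomega_nonneg LD_pos by simp

lemma num_iters_le:
  assumes "x0 \<in> X" "l0 \<in> Y" "0 < \<epsilon>" "\<epsilon> \<le> LD P"
  shows "real (num_iters P \<epsilon> x0 l0) \<le> iters_factor x0 l0 * sqrt (LD P / \<epsilon>)"
proof -
  define s where "s = sqrt (16 * Bomega P + real_of_ereal (gap P x0 l0) / LD P)"
  have nn: "0 \<le> 16 * Bomega P + real_of_ereal (gap P x0 l0) / LD P"
    using gap_nonneg[OF assms(1,2)] Bomega_nonneg LD_pos by simp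
  have one: "1 \<le> sqrt (LD P / \<epsilon>)" using assms by simp
  have "16 * LD P * Bomega P + real_of_ereal (gap P x0 l0)
      = (16 * Bomega P + real_of_ereal (gap P x0 l0) / LD P) * LD P"
    using LD_pos by (simp add: field_simps)
  then have eq: "2 * sqrt (16 * LD P * Bomega P + real_of_ereal (gap P x0 l0)) / sqrt \<epsilon>
      = 2 * s * sqrt (LD P / \<epsilon>)"
    unfolding s_def by (simp add: real_sqrt_mult real_sqrt_divide)
  have "0 \<le> 2 * s * sqrt (LD P / \<epsilon>)" using nn one unfolding s_def by simp
  then have "real (num_iters P \<epsilon> x0 l0) \<le> 2 * s * sqrt (LD P / \<epsilon>) + 2"
    unfolding num_iters_def eq by (simp add: ceiling_le_iff) linarith
  also have "\<dots> \<le> 2 * s * sqrt (LD P / \<epsilon>) + 2 * sqrt (LD P / \<epsilon>)" using one by simp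
  also have "\<dots> = iters_factor x0 l0 * sqrt (LD P / \<epsilon>)"
    unfolding iters_factor_def s_def by (simp add: distrib_right)
  finally show ?thesis .
qed

lemma kappaX_pos: "0 < kappaX P"
  unfolding kappaX_def using mu_pos mu_le_L Lxx by simp

text \<open>The argument of the logarithm is of order \<open>1 / (\<epsilon>\<^sup>2 \<delta>)\<close>, all of it due to the tolerance, so
\<open>logarithm_absorbs_power\<close> applies with \<open>p = 2\<close>.\<close>

lemma primal_run_cost:
  assumes x0: "x0 \<in> X" and l0: "l0 \<in> Y"
  defines "N \<equiv> real (ncomp P) + sqrt (real (ncomp P) * kappaX P)"
  shows "\<exists>\<epsilon>0>0. \<forall>\<epsilon> \<delta> k. 0 < \<epsilon> \<and> \<epsilon> < \<epsilon>0 \<and> 0 < \<delta> \<and> \<delta> < 1 \<and> k < num_iters P \<epsilon> x0 l0 \<longrightarrow>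
    1 \<le> ln (kappaX P * LD P * N / (\<epsilon> * \<delta>)) \<and>
    real (rpd_iters (ncomp P) (const_L P + const_Lxx P) (const_mu P) D
        (accuracy \<epsilon> k * \<delta> / (3 * real (num_iters P \<epsilon> x0 l0))))
      \<le> 7 * ((3 * N) * ln (kappaX P * LD P * N / (\<epsilon> * \<delta>)))"
proof -
  define q where "q = iters_factor x0 l0"
  define a where "a = 2 * ((const_L P + const_Lxx P) / sqrt (const_mu P) + sqrt (const_mu P))\<^sup>2"
  define N0 where "N0 = real (ncomp P) + sqrt (8 * real (ncomp P) * kappaX P)"
  \<comment> \<open>the summand \<open>1\<close> keeps \<open>Q\<close> positive when \<open>D = 0\<close>\<close>
  define Q where "Q = a * N0 * (36 * \<bar>D\<bar> * q\<^sup>2 * LD P) + 1"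
  have q: "0 < q" unfolding q_def using iters_factor_ge_2[OF x0 l0] by linarith
  have n: "1 \<le> real (ncomp P)" using ncomp by simp
  have N: "0 < N" unfolding N_def using n kappaX_pos by (intro add_pos_nonneg) auto
  have N0: "0 \<le> N0" "N0 \<le> 3 * N"
  proof -
    show "0 \<le> N0" unfolding N0_def using kappaX_pos by simp
    have "sqrt (8 * real (ncomp P) * kappaX P) \<le> sqrt (9 * (real (ncomp P) * kappaX P))"
      using kappaX_pos by simp
    also have "\<dots> = 3 * sqrt (real (ncomp P) * kappaX P)" by (simp only: real_sqrt_mult) simp
    finally show "N0 \<le> 3 * N" unfolding N0_def N_def by simp
  qed
  have a: "0 \<le> a" unfolding a_def by simp
  have Q: "0 < Q" unfolding Q_def using a N0(1) LD_pos by (intro add_nonneg_pos mult_nonneg_nonneg) auto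
  have G: "0 < kappaX P * LD P * N" using kappaX_pos LD_pos N by simp
  obtain \<epsilon>1 where \<epsilon>1: "\<epsilon>1 > 0" "\<And>\<epsilon> \<delta>. 0 < \<epsilon> \<and> \<epsilon> < \<epsilon>1 \<and> 0 < \<delta> \<and> \<delta> < 1 \<Longrightarrow>
      1 \<le> ln (kappaX P * LD P * N / (\<epsilon> * \<delta>)) \<and>
      ln (Q / (\<epsilon> ^ 2 * \<delta>)) \<le> real (2 + 1) * ln (kappaX P * LD P * N / (\<epsilon> * \<delta>))"
    using logarithm_absorbs_power[OF G Q, of 2] by (elim exE conjE) auto
  have "1 \<le> ln (kappaX P * LD P * N / (\<epsilon> * \<delta>)) \<and>
    real (rpd_iters (ncomp P) (const_L P + const_Lxx P) (const_mu P) D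
        (accuracy \<epsilon> k * \<delta> / (3 * real (num_iters P \<epsilon> x0 l0))))
      \<le> 7 * ((3 * N) * ln (kappaX P * LD P * N / (\<epsilon> * \<delta>)))"
    if e: "0 < \<epsilon>" "\<epsilon> < min \<epsilon>1 (LD P)" and d: "0 < \<delta>" "\<delta> < 1" and k: "k < num_iters P \<epsilon> x0 l0" for \<epsilon> \<delta> k
  proof -
    define K where "K = num_iters P \<epsilon> x0 l0"
    define tol where "tol = accuracy \<epsilon> k * \<delta> / (3 * real K)"
    have K: "real K \<le> q * sqrt (LD P / \<epsilon>)"
      unfolding K_def q_def by (rule num_iters_le[OF x0 l0]) (use e in auto)
    have tol: "0 < tol" unfolding tol_def accuracy_def using e d k K_def by simp
    have "\<bar>a * N0 * D / tol\<bar> = a * N0 * (\<bar>D\<bar> / tol)"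
      using a N0 tol by (simp add: abs_mult)
    also have "\<dots> \<le> a * N0 * (36 * \<bar>D\<bar> * q\<^sup>2 * LD P / (\<epsilon>\<^sup>2 * \<delta>))"
      unfolding tol_def
      by (intro mult_left_mono solver_tolerance_bound K) (use e d k K_def LD_pos q a N0 in auto)
    also have "\<dots> \<le> Q / (\<epsilon> ^ 2 * \<delta>)"
      unfolding Q_def using e d by (simp add: divide_right_mono)
    finally have Z: "\<bar>a * N0 * D / tol\<bar> \<le> Q / (\<epsilon> ^ 2 * \<delta>)" .
    have ln: "1 \<le> ln (kappaX P * LD P * N / (\<epsilon> * \<delta>))"
      "ln (Q / (\<epsilon> ^ 2 * \<delta>)) \<le> 3 * ln (kappaX P * LD P * N / (\<epsilon> * \<delta>))"
      using \<epsilon>1(2)[of \<epsilon> \<delta>] e d by auto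
    have "real (rpd_iters (ncomp P) (const_L P + const_Lxx P) (const_mu P) D tol)
        \<le> (2 * 3 + 1) * ((3 * N) * ln (kappaX P * LD P * N / (\<epsilon> * \<delta>)))"
    proof (rule rpd_iters_le[OF ncomp _ _ _ ln(2) _ ln(1)])
      show "real (ncomp P) + sqrt (8 * real (ncomp P) * ((const_L P + const_Lxx P) / const_mu P)) \<le> 3 * N"
        using N0(2) unfolding N0_def kappaX_def .
      show "0 \<le> (const_L P + const_Lxx P) / const_mu P" using kappaX_pos unfolding kappaX_def by simp
      show "\<bar>2 * ((const_L P + const_Lxx P) / sqrt (const_mu P) + sqrt (const_mu P))\<^sup>2 *
         (real (ncomp P) + sqrt (8 * real (ncomp P) * ((const_L P + const_Lxx P) / const_mu P))) * D / tol\<bar>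
        \<le> Q / (\<epsilon> ^ 2 * \<delta>)"
        using Z unfolding a_def N0_def kappaX_def .
    qed simp
    then show ?thesis using ln(1) unfolding tol_def K_def by simp
  qed
  then show ?thesis using \<epsilon>1(1) LD_pos by (intro exI[of _ "min \<epsilon>1 (LD P)"]) auto
qed

text \<open>The strong concavity modulus \<open>\<rho>\<^sub>j\<close> decays to the order of \<open>\<epsilon>\<close>.  Hence \<open>(L / \<surd>\<rho> + \<surd>\<rho>)\<^sup>2\<close> is of
order \<open>1 / \<epsilon>\<close>, the factor \<open>N0\<close> of order \<open>1 / \<surd>\<epsilon>\<close>, bounded here by \<open>1 / \<epsilon>\<close>, and the inverse
tolerance of order \<open>1 / (\<epsilon>\<^sup>2 \<delta>)\<close>, so \<open>logarithm_absorbs_power\<close> applies with \<open>p = 4\<close>.\<close>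

lemma dual_run_cost:
  assumes x0: "x0 \<in> X" and l0: "l0 \<in> Y" and l: "0 < const_Lll P"
  defines "q \<equiv> iters_factor x0 l0" and "n \<equiv> real (ncomp P)"
  defines "G \<equiv> const_Lll P * LD P * (n + sqrt (n * const_Lll P / LD P))"
  shows "\<exists>\<epsilon>0>0. \<forall>\<epsilon> \<delta> k j. 0 < \<epsilon> \<and> \<epsilon> < \<epsilon>0 \<and> 0 < \<delta> \<and> \<delta> < 1 \<and> k < num_iters P \<epsilon> x0 l0 \<and>
    j \<le> num_iters P \<epsilon> x0 l0 \<longrightarrow>
    1 \<le> ln (G / (\<epsilon> * \<delta>)) \<and>
    real (rpd_iters (ncomp P) (const_Lll P) (rho P j) D
        (accuracy \<epsilon> k * \<delta> / (3 * real (num_iters P \<epsilon> x0 l0))))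
      \<le> 11 * ((n + 3 * q * sqrt (n * const_Lll P / \<epsilon>)) * ln (G / (\<epsilon> * \<delta>)))"
proof -
  define L where "L = const_Lll P"
  define a where "a = 2 * (L + 8 * LD P)\<^sup>2 * q\<^sup>2"
  define b where "b = n + 3 * q * sqrt (n * L)"
  \<comment> \<open>the summand \<open>1\<close> keeps \<open>Q\<close> positive when \<open>D = 0\<close>\<close>
  define Q where "Q = a * b * (36 * \<bar>D\<bar> * q\<^sup>2 * LD P) + 1"
  have L: "0 < L" using l unfolding L_def .
  have q: "2 \<le> q" unfolding q_def using iters_factor_ge_2[OF x0 l0] .
  have n: "1 \<le> n" unfolding n_def using ncomp by simp
  have G: "0 < G" unfolding G_def using l LD_pos n by (intro mult_pos_pos add_pos_nonneg) auto
  have a: "0 \<le> a" unfolding a_def by simp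
  have b: "0 \<le> b" unfolding b_def using n q L by simp
  have Q: "0 < Q" unfolding Q_def using a b LD_pos by (intro add_nonneg_pos mult_nonneg_nonneg) auto
  obtain \<epsilon>1 where \<epsilon>1: "\<epsilon>1 > 0" "\<And>\<epsilon> \<delta>. 0 < \<epsilon> \<and> \<epsilon> < \<epsilon>1 \<and> 0 < \<delta> \<and> \<delta> < 1 \<Longrightarrow>
      1 \<le> ln (G / (\<epsilon> * \<delta>)) \<and> ln (Q / (\<epsilon> ^ 4 * \<delta>)) \<le> real (4 + 1) * ln (G / (\<epsilon> * \<delta>))"
    using logarithm_absorbs_power[OF G Q, of 4] by (elim exE conjE) auto
  have "1 \<le> ln (G / (\<epsilon> * \<delta>)) \<and>
    real (rpd_iters (ncomp P) (const_Lll P) (rho P j) D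
        (accuracy \<epsilon> k * \<delta> / (3 * real (num_iters P \<epsilon> x0 l0))))
      \<le> 11 * ((n + 3 * q * sqrt (n * const_Lll P / \<epsilon>)) * ln (G / (\<epsilon> * \<delta>)))"
    if e: "0 < \<epsilon>" "\<epsilon> < min \<epsilon>1 (min 1 (LD P))" and d: "0 < \<delta>" "\<delta> < 1"
      and k: "k < num_iters P \<epsilon> x0 l0" and j: "j \<le> num_iters P \<epsilon> x0 l0" for \<epsilon> \<delta> k j
  proof -
    define K where "K = num_iters P \<epsilon> x0 l0"
    define tol where "tol = accuracy \<epsilon> k * \<delta> / (3 * real K)"
    define r where "r = rho P j"
    define N0 where "N0 = n + sqrt (8 * n * (L / r))"
    define N where "N = n + 3 * q * sqrt (n * L / \<epsilon>)"
    have K1: "1 \<le> real K" unfolding K_def using num_iters_pos[of P \<epsilon> x0 l0] by simp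
    have K: "real K \<le> q * sqrt (LD P / \<epsilon>)"
      unfolding K_def q_def by (rule num_iters_le[OF x0 l0]) (use e in auto)
    have tol: "0 < tol" unfolding tol_def accuracy_def using e d k K_def by simp
    have r: "0 < r" unfolding r_def rho_eq using LD_pos by simp
    have r_le: "r \<le> 8 * LD P"
    proof -
      have "1 * 2 \<le> (real j + 1) * (real j + 2)" by (rule mult_mono) auto
      then have "16 * LD P / ((real j + 1) * (real j + 2)) \<le> 16 * LD P / 2"
        using LD_pos by (intro divide_left_mono) auto
      then show ?thesis unfolding r_def rho_eq by simp
    qed
    have inv_r: "1 / r \<le> (3 * q)\<^sup>2 / (16 * \<epsilon>)"
    proof -
      have "(real j + 1) * (real j + 2) \<le> (3 * real K) * (3 * real K)"
        by (rule mult_mono) (use j K1 K_def in auto)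
      also have "\<dots> \<le> (3 * (q * sqrt (LD P / \<epsilon>))) * (3 * (q * sqrt (LD P / \<epsilon>)))"
        by (rule mult_mono) (use K q e LD_pos in auto)
      also have "\<dots> = (3 * q)\<^sup>2 * (sqrt (LD P / \<epsilon>) * sqrt (LD P / \<epsilon>))"
        by (simp add: power2_eq_square mult_ac)
      also have "sqrt (LD P / \<epsilon>) * sqrt (LD P / \<epsilon>) = LD P / \<epsilon>"
        using LD_pos e by (intro real_sqrt_mult_self[THEN trans]) simp
      finally have "(real j + 1) * (real j + 2) / (16 * LD P) \<le> (3 * q)\<^sup>2 * (LD P / \<epsilon>) / (16 * LD P)"
        using LD_pos by (intro divide_right_mono) auto
      then show ?thesis unfolding r_def rho_eq using LD_pos by (simp add: field_simps)
    qed
    have N0: "1 \<le> N0" "N0 \<le> N"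
    proof -
      show "1 \<le> N0" unfolding N0_def using n r L by (intro add_increasing2) auto
      have "8 * n * (L / r) = 8 * n * L * (1 / r)" by simp
      also have "\<dots> \<le> 8 * n * L * ((3 * q)\<^sup>2 / (16 * \<epsilon>))"
        using n L by (intro mult_left_mono[OF inv_r]) auto
      also have "\<dots> = (3 * q)\<^sup>2 * (n * L / \<epsilon>) / 2" by (simp add: field_simps)
      also have "\<dots> \<le> (3 * q)\<^sup>2 * (n * L / \<epsilon>)"
      proof -
        have half: "x / 2 \<le> x" if "0 \<le> x" for x :: real using that by simp
        show ?thesis by (rule half, intro mult_nonneg_nonneg) (use n L e in auto)
      qed
      finally have "sqrt (8 * n * (L / r)) \<le> sqrt ((3 * q)\<^sup>2 * (n * L / \<epsilon>))" by simp
      also have "\<dots> = sqrt ((3 * q)\<^sup>2) * sqrt (n * L / \<epsilon>)" by (rule real_sqrt_mult)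
      also have "\<dots> = 3 * q * sqrt (n * L / \<epsilon>)" using q by (simp only: real_sqrt_abs abs_of_nonneg)
      finally show "N0 \<le> N" unfolding N0_def N_def by simp
    qed
    have N_b: "N \<le> b / \<epsilon>"
    proof -
      have "sqrt (n * L / \<epsilon>) \<le> sqrt (n * L / \<epsilon>\<^sup>2)"
        using n L e by (intro real_sqrt_le_mono divide_left_mono) (auto simp: power2_eq_square mult_le_cancel_left2)
      also have "\<dots> = sqrt (n * L) / \<epsilon>" using e by (simp add: real_sqrt_divide)
      finally have "3 * q * sqrt (n * L / \<epsilon>) \<le> 3 * q * (sqrt (n * L) / \<epsilon>)"
        using q by (intro mult_left_mono) auto
      moreover have "n \<le> n / \<epsilon>" using n e by (simp add: pos_le_divide_eq)
      ultimately show ?thesis unfolding N_def b_def by (simp add: add_divide_distrib)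
    qed
    have quad: "2 * (L / sqrt r + sqrt r)\<^sup>2 \<le> a / \<epsilon>"
    proof -
      have "L / sqrt r + sqrt r = (L + r) / sqrt r" using r by (simp add: field_simps)
      then have "2 * (L / sqrt r + sqrt r)\<^sup>2 = 2 * (L + r)\<^sup>2 * (1 / r)"
        using r by (simp add: power_divide)
      also have "\<dots> \<le> 2 * (L + 8 * LD P)\<^sup>2 * ((3 * q)\<^sup>2 / (16 * \<epsilon>))"
        by (intro mult_mono power_mono inv_r) (use L r r_le in auto)
      also have "\<dots> = (9 / 16) * (a / \<epsilon>)" unfolding a_def by (simp add: power_mult_distrib field_simps)
      also have "\<dots> \<le> a / \<epsilon>" by (rule mult_left_le_one_le) (use a e in auto)
      finally show ?thesis .
    qed
    have "\<bar>2 * (L / sqrt r + sqrt r)\<^sup>2 * N0 * D / tol\<bar> = 2 * (L / sqrt r + sqrt r)\<^sup>2 * N0 * (\<bar>D\<bar> / tol)"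
      using N0 tol by (simp add: abs_mult)
    also have "\<dots> \<le> (a / \<epsilon>) * (b / \<epsilon>) * (36 * \<bar>D\<bar> * q\<^sup>2 * LD P / (\<epsilon>\<^sup>2 * \<delta>))"
    proof (intro mult_mono quad)
      show "N0 \<le> b / \<epsilon>" using N0 N_b by simp
      show "\<bar>D\<bar> / tol \<le> 36 * \<bar>D\<bar> * q\<^sup>2 * LD P / (\<epsilon>\<^sup>2 * \<delta>)"
        unfolding tol_def by (rule solver_tolerance_bound[OF _ K]) (use e d k K_def LD_pos q in auto)
    qed (use a b e N0 tol in auto)
    also have "\<dots> = a * b * (36 * \<bar>D\<bar> * q\<^sup>2 * LD P) / (\<epsilon> ^ 4 * \<delta>)"
      by (simp add: power2_eq_square power4_eq_xxxx mult_ac)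
    also have "\<dots> \<le> Q / (\<epsilon> ^ 4 * \<delta>)"
      unfolding Q_def using e d by (intro divide_right_mono) auto
    finally have Z: "\<bar>2 * (L / sqrt r + sqrt r)\<^sup>2 * N0 * D / tol\<bar> \<le> Q / (\<epsilon> ^ 4 * \<delta>)" .
    have ln: "1 \<le> ln (G / (\<epsilon> * \<delta>))" "ln (Q / (\<epsilon> ^ 4 * \<delta>)) \<le> 5 * ln (G / (\<epsilon> * \<delta>))"
      using \<epsilon>1(2)[of \<epsilon> \<delta>] e d by auto
    have "real (rpd_iters (ncomp P) L r D tol) \<le> (2 * 5 + 1) * (N * ln (G / (\<epsilon> * \<delta>)))"
      by (rule rpd_iters_le[OF ncomp _ _ _ ln(2) _ ln(1)])
         (use N0(2) Z L r in \<open>simp_all add: N0_def n_def\<close>)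
    then show ?thesis using ln(1) unfolding tol_def K_def r_def N_def L_def by simp
  qed
  then show ?thesis using \<epsilon>1(1) LD_pos by (intro exI[of _ "min \<epsilon>1 (min 1 (LD P))"]) auto
qed

end

context ipds_run
begin

lemma primal_complexity_le:
  assumes w: "w \<in> space M" and c: "0 \<le> c"
    and T: "\<And>k. k < K \<Longrightarrow> real (rpd_iters (ncomp P) (const_L P + const_Lxx P) (const_mu P)
      (bregman_diam X (dgfX P) (startX P)) (tol k)) \<le> T"
  shows "real (primal_complexity E K w) \<le> real K * (2 * (c * T))"
proof -
  have "real (length (primal_calls_of (hatl E k w) (reqx E k w))) \<le> 2 * (c * T)" if k: "k < K" for k
  proof -
    have "length (primal_calls_of l rs) = 2 * length rs" for l :: 'b and rs :: "('a \<times> nat) list"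
      unfolding primal_calls_of_def by (induction rs) auto
    moreover have "real (length (reqx E k w)) \<le> c * T"
      by (rule order.trans[OF _ mult_left_mono[OF T[OF k] c]])
         (use run2[OF k] w in \<open>simp add: rpd_run_def\<close>)
    ultimately show ?thesis by simp
  qed
  then have "(\<Sum>k<K. real (length (primal_calls_of (hatl E k w) (reqx E k w)))) \<le> (\<Sum>k<K. 2 * (c * T))"
    by (intro sum_mono) simp
  then show ?thesis unfolding primal_complexity_def by simp
qed

lemma dual_complexity_le:
  assumes w: "w \<in> space M" and c: "0 \<le> c"
    and T: "\<And>k j. k < K \<Longrightarrow> j \<le> K \<Longrightarrow> real (rpd_iters (ncomp P) (const_Lll P) (rho P j)
      (bregman_diam Y (dgfL P) (startL P)) (tol k)) \<le> T"
  shows "real (dual_complexity E K w) \<le> real K * (2 * (c * T))"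
proof -
  have "real (length (dual_calls_of (iterx E k w) (reql1 E k w))
      + length (dual_calls_of (iterx E (Suc k) w) (reql2 E k w))) \<le> 2 * (c * T)" if k: "k < K" for k
  proof -
    have "k \<le> K" "Suc k \<le> K" using k by auto
    note T' = order.trans[OF _ mult_left_mono[OF T[OF k] c]]
    have "real (length (reql1 E k w)) \<le> c * T"
      by (rule T'[OF _ \<open>k \<le> K\<close>]) (use run1[OF k] w in \<open>simp add: rpd_run_def\<close>)
    moreover have "real (length (reql2 E k w)) \<le> c * T"
      by (rule T'[OF _ \<open>Suc k \<le> K\<close>]) (use run3[OF k] w in \<open>simp add: rpd_run_def del: rho.simps\<close>)
    ultimately show ?thesis unfolding dual_calls_of_def by simp
  qed
  then have "(\<Sum>k<K. real (length (dual_calls_of (iterx E k w) (reql1 E k w))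
      + length (dual_calls_of (iterx E (Suc k) w) (reql2 E k w)))) \<le> (\<Sum>k<K. 2 * (c * T))"
    by (intro sum_mono) simp
  then show ?thesis unfolding dual_complexity_def by simp
qed

end

section \<open>The complexity theorem\<close>

theorem theorem4p5:
  fixes c :: real
  assumes "0 < c"
  shows "\<exists>C :: real \<Rightarrow> real \<Rightarrow> real.
    \<forall>(P :: ('a::finite_dim_normed, 'b::finite_dim_normed) spp) x0 l0.
      valid_spp P \<and> bounded (setL P) \<and> x0 \<in> setX P \<and> l0 \<in> setL P \<longrightarrow>
      (\<exists>\<epsilon>0>0. \<forall>\<epsilon>>0. \<forall>\<delta>\<in>{0<..<1}. \<forall>(M :: 'w measure) E.
         ipds_exec M c P \<epsilon> \<delta> x0 l0 E \<longrightarrow>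
         (let K = num_iters P \<epsilon> x0 l0;
              A = C (Bomega P) (real_of_ereal (gap P x0 l0) / LD P)
          in
            \<P>(w in M. gap P (iterx E K w) (iterl E K w) \<le> ereal \<epsilon>) \<ge> 1 - \<delta> \<and>
            (\<epsilon> < \<epsilon>0 \<longrightarrow> (\<forall>w\<in>space M.
               real (primal_complexity E K w) \<le> A * primal_bound P \<epsilon> \<delta> \<and>
               (0 < const_Lll P \<longrightarrow>
                  real (dual_complexity E K w) \<le> A * dual_bound P \<epsilon> \<delta>)))))"
  \<comment> \<open>The inner square root term is \<open>iters_factor\<close>, called \<open>q\<close> below.  The dual cost is
    \<open>K\<close> iterations with \<open>2\<close> runs of \<open>11\<close> times a factor that contains \<open>3 q\<close>, which makes
    \<open>66 c q\<^sup>2\<close>; the primal cost makes only \<open>42 c q\<close>.\<close>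
proof (intro exI[of _ "\<lambda>b r. 66 * c * (2 * sqrt (16 * b + r) + 2)\<^sup>2"] allI impI)
  fix P :: "('a, 'b) spp" and x0 l0
  assume asm: "valid_spp P \<and> bounded (setL P) \<and> x0 \<in> setX P \<and> l0 \<in> setL P"
  then interpret bounded_saddle_problem P by unfold_locales auto
  have x0: "x0 \<in> setX P" and l0: "l0 \<in> setL P" using asm by auto
  define q where "q = iters_factor x0 l0"
  have q: "2 \<le> q" unfolding q_def by (rule iters_factor_ge_2[OF x0 l0])
  define DX where "DX = bregman_diam (setX P) (dgfX P) (startX P)"
  define DL where "DL = bregman_diam (setL P) (dgfL P) (startL P)"
  define n where "n = real (ncomp P)"
  define N where "N = n + sqrt (n * kappaX P)"
  define GX where "GX = kappaX P * LD P * N"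
  define GL where "GL = const_Lll P * LD P * (n + sqrt (n * const_Lll P / LD P))"
  have n: "1 \<le> n" using ncomp unfolding n_def by simp
  have N: "0 \<le> N" unfolding N_def using n kappaX_pos by simp
  obtain \<epsilon>1 where \<epsilon>1: "0 < \<epsilon>1" "\<forall>\<epsilon> \<delta> k. 0 < \<epsilon> \<and> \<epsilon> < \<epsilon>1 \<and> 0 < \<delta> \<and> \<delta> < 1 \<and> k < num_iters P \<epsilon> x0 l0 \<longrightarrow>
      1 \<le> ln (GX / (\<epsilon> * \<delta>)) \<and>
      real (rpd_iters (ncomp P) (const_L P + const_Lxx P) (const_mu P) DX
        (accuracy \<epsilon> k * \<delta> / (3 * real (num_iters P \<epsilon> x0 l0)))) \<le> 7 * ((3 * N) * ln (GX / (\<epsilon> * \<delta>)))"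
    using primal_run_cost[OF x0 l0, of DX] unfolding GX_def N_def n_def by (elim exE conjE)
  obtain \<epsilon>2 where \<epsilon>2: "0 < \<epsilon>2" "0 < const_Lll P \<longrightarrow> (\<forall>\<epsilon> \<delta> k j. 0 < \<epsilon> \<and> \<epsilon> < \<epsilon>2 \<and> 0 < \<delta> \<and> \<delta> < 1 \<and>
      k < num_iters P \<epsilon> x0 l0 \<and> j \<le> num_iters P \<epsilon> x0 l0 \<longrightarrow>
      1 \<le> ln (GL / (\<epsilon> * \<delta>)) \<and>
      real (rpd_iters (ncomp P) (const_Lll P) (rho P j) DL
        (accuracy \<epsilon> k * \<delta> / (3 * real (num_iters P \<epsilon> x0 l0))))
        \<le> 11 * ((n + 3 * q * sqrt (n * const_Lll P / \<epsilon>)) * ln (GL / (\<epsilon> * \<delta>))))"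
  proof (cases "0 < const_Lll P")
    case True
    show thesis
      using dual_run_cost[OF x0 l0 True, of DL] that unfolding GL_def n_def q_def by (elim exE conjE) blast
  next
    case False
    then show thesis using that[of 1] by simp
  qed
  define \<epsilon>0 where "\<epsilon>0 = min (LD P) (min \<epsilon>1 \<epsilon>2)"
  show "\<exists>\<epsilon>0>0. \<forall>\<epsilon>>0. \<forall>\<delta>\<in>{0<..<1}. \<forall>(M :: 'w measure) E.
         ipds_exec M c P \<epsilon> \<delta> x0 l0 E \<longrightarrow>
         (let K = num_iters P \<epsilon> x0 l0;
              A = 66 * c * (2 * sqrt (16 * Bomega P + real_of_ereal (gap P x0 l0) / LD P) + 2)\<^sup>2
          in
            \<P>(w in M. gap P (iterx E K w) (iterl E K w) \<le> ereal \<epsilon>) \<ge> 1 - \<delta> \<and>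
            (\<epsilon> < \<epsilon>0 \<longrightarrow> (\<forall>w\<in>space M.
               real (primal_complexity E K w) \<le> A * primal_bound P \<epsilon> \<delta> \<and>
               (0 < const_Lll P \<longrightarrow>
                  real (dual_complexity E K w) \<le> A * dual_bound P \<epsilon> \<delta>))))"
    unfolding Let_def iters_factor_def[symmetric] q_def[symmetric]
  proof (intro exI[of _ \<epsilon>0] conjI allI impI ballI)
    show "0 < \<epsilon>0" unfolding \<epsilon>0_def using LD_pos \<epsilon>1(1) \<epsilon>2(1) by simp
  next
    fix \<epsilon> \<delta> :: real and M :: "'w measure" and E
    assume e: "0 < \<epsilon>" and d: "\<delta> \<in> {0<..<1}" and ex: "ipds_exec M c P \<epsilon> \<delta> x0 l0 E"
    interpret ipds_run P M c \<epsilon> \<delta> x0 l0 E by unfold_locales (use x0 l0 e d ex in auto)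
    let ?K = "num_iters P \<epsilon> x0 l0"
    show "1 - \<delta> \<le> \<P>(w in M. gap P (iterx E ?K w) (iterl E ?K w) \<le> ereal \<epsilon>)"
      by (rule gap_high_probability)
    {
      assume small: "\<epsilon> < \<epsilon>0"
      have K: "real ?K \<le> q * sqrt (LD P / \<epsilon>)"
        unfolding q_def by (rule num_iters_le[OF x0 l0 e]) (use small in \<open>simp add: \<epsilon>0_def\<close>)
      fix w assume w: "w \<in> space M"
      show "real (primal_complexity E ?K w) \<le> 66 * c * q\<^sup>2 * primal_bound P \<epsilon> \<delta>"
      proof -
        define \<Lambda> where "\<Lambda> = ln (GX / (\<epsilon> * \<delta>))"
        have run: "1 \<le> \<Lambda> \<and> real (rpd_iters (ncomp P) (const_L P + const_Lxx P) (const_mu P) DX (tol k)) \<le> 7 * ((3 * N) * \<Lambda>)"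
          if "k < ?K" for k
          using \<epsilon>1(2) e d small that unfolding \<Lambda>_def tol_def \<epsilon>0_def by simp
        have \<Lambda>: "1 \<le> \<Lambda>" using run[of 0] num_iters_pos[of P \<epsilon> x0 l0] by simp
        have pb: "primal_bound P \<epsilon> \<delta> = N * sqrt (LD P / \<epsilon>) * \<Lambda>"
          unfolding primal_bound_def Let_def \<Lambda>_def GX_def N_def n_def by simp
        have "real (primal_complexity E ?K w) \<le> real ?K * (2 * (c * (7 * ((3 * N) * \<Lambda>))))"
          by (rule primal_complexity_le[OF w]) (use assms run in \<open>auto simp: DX_def\<close>)
        also have "\<dots> \<le> q * sqrt (LD P / \<epsilon>) * (2 * (c * (7 * ((3 * N) * \<Lambda>))))"
          using K assms N \<Lambda> by (intro mult_right_mono) auto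
        also have "\<dots> = (42 * c * q) * primal_bound P \<epsilon> \<delta>" unfolding pb by simp
        also have "\<dots> \<le> (66 * c * q\<^sup>2) * primal_bound P \<epsilon> \<delta>"
        proof (rule mult_right_mono)
          have "q * 1 \<le> q * q" using q by (intro mult_left_mono) auto
          then have "c * q \<le> c * q\<^sup>2" using assms by (simp add: power2_eq_square)
          moreover have "0 \<le> c * q\<^sup>2" using assms by simp
          ultimately show "42 * c * q \<le> 66 * c * q\<^sup>2" by linarith
          show "0 \<le> primal_bound P \<epsilon> \<delta>" unfolding pb using N \<Lambda> e LD_pos by simp
        qed
        finally show ?thesis .
      qed
      assume l: "0 < const_Lll P"
      show "real (dual_complexity E ?K w) \<le> 66 * c * q\<^sup>2 * dual_bound P \<epsilon> \<delta>"
      proof -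
        define \<Lambda> where "\<Lambda> = ln (GL / (\<epsilon> * \<delta>))"
        define L where "L = const_Lll P"
        define T where "T = n + 3 * q * sqrt (n * L / \<epsilon>)"
        have run: "1 \<le> \<Lambda> \<and> real (rpd_iters (ncomp P) (const_Lll P) (rho P j) DL (tol k)) \<le> 11 * (T * \<Lambda>)"
          if "k < ?K" "j \<le> ?K" for k j
          using \<epsilon>2(2) l e d small that unfolding \<Lambda>_def tol_def \<epsilon>0_def T_def L_def by simp
        have \<Lambda>: "1 \<le> \<Lambda>" using run[of 0 0] num_iters_pos[of P \<epsilon> x0 l0] by simp
        have L: "0 < L" using l unfolding L_def .
        have T: "0 \<le> T" unfolding T_def using n q L e by simp
        have db: "dual_bound P \<epsilon> \<delta> = (n * sqrt (LD P / \<epsilon>) + sqrt (n * L * LD P) / \<epsilon>) * \<Lambda>"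
          unfolding dual_bound_def Let_def \<Lambda>_def GL_def L_def n_def by simp
        have "real (dual_complexity E ?K w) \<le> real ?K * (2 * (c * (11 * (T * \<Lambda>))))"
          by (rule dual_complexity_le[OF w]) (use assms run in \<open>auto simp: DL_def\<close>)
        also have "\<dots> \<le> q * sqrt (LD P / \<epsilon>) * (2 * (c * (11 * (T * \<Lambda>))))"
          using K assms T \<Lambda> by (intro mult_right_mono) auto
        also have "\<dots> = (22 * c * \<Lambda>) * (q * (sqrt (LD P / \<epsilon>) * T))" by simp
        also have "\<dots> \<le> (22 * c * \<Lambda>) * (3 * q\<^sup>2 * (n * sqrt (LD P / \<epsilon>) + sqrt (n * L * LD P) / \<epsilon>))"
        proof (rule mult_left_mono)
          have "sqrt (LD P / \<epsilon>) * sqrt (n * L / \<epsilon>) = sqrt (n * L * LD P / \<epsilon>\<^sup>2)"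
            unfolding real_sqrt_mult[symmetric] by (simp add: power2_eq_square mult_ac)
          also have "\<dots> = sqrt (n * L * LD P) / \<epsilon>" using e by (simp add: real_sqrt_divide)
          finally have "q * (sqrt (LD P / \<epsilon>) * T)
              = q * (n * sqrt (LD P / \<epsilon>)) + 3 * q\<^sup>2 * (sqrt (n * L * LD P) / \<epsilon>)"
            unfolding T_def by (simp add: distrib_left power2_eq_square mult_ac)
          moreover have "q * (n * sqrt (LD P / \<epsilon>)) \<le> 3 * q\<^sup>2 * (n * sqrt (LD P / \<epsilon>))"
          proof (rule mult_right_mono)
            have "q * 1 \<le> q * (3 * q)" using q by (intro mult_left_mono) auto
            then show "q \<le> 3 * q\<^sup>2" by (simp add: power2_eq_square)
            show "0 \<le> n * sqrt (LD P / \<epsilon>)" using n LD_pos e by simp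
          qed
          ultimately show "q * (sqrt (LD P / \<epsilon>) * T)
              \<le> 3 * q\<^sup>2 * (n * sqrt (LD P / \<epsilon>) + sqrt (n * L * LD P) / \<epsilon>)"
            by (simp add: distrib_left)
          show "0 \<le> 22 * c * \<Lambda>" using assms \<Lambda> by simp
        qed
        also have "\<dots> = 66 * c * q\<^sup>2 * dual_bound P \<epsilon> \<delta>" unfolding db by simp
        finally show ?thesis .
      qed
    }
  qed
qed

end
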